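(* Let $m\ge 3$ and let $G(m)$ be the dihedral Artin group with free product generating set $X=\{x,y\}$. Then the language $\mathsf{ConjGeo}(G(m),X)$ of all conjugacy geodesics is regular.
   Context: For $m\ge 3$, $G(m)=\langle a,b \mid {}_m(a,b)={}_m(b,a)\rangle$, where ${}_m(a,b)$ is the alternating word $abab\cdots$ of length $m$. Free product generating set $X=\{x,y\}$ (closed under inverses, so words in $X^*$ are over $\{x^{\pm1},y^{\pm1}\}$): for $m$ odd, $x={}_m(a,b)$, $y=ab$, giving $G(m)\cong\langle x,y\mid x^2=y^m\rangle$; for $m=2p$ even, $x=ab$, $y=a$, giving $G(m)\cong\langle x,y\mid y^{-1}x^py=x^p\rangle=\mathrm{BS}(p,p)$. For a group $G$ with finite inverse-closed generating set $X$ and natural projection $\pi:X^*\to G$, the length of a conjugacy class $[g]$ is $|[g]|=\min\{|h| : h\in[g]\}$, with $|h|$ the word length of $h$, and $\mathsf{ConjGeo}(G,X)=\{w\in X^*\mid l(w)=|[\pi(w)]|\}$, where $l(w)$ is the length of the word $w$. A language is regular if it is recognised by a finite state automaton. *)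

theory Defs
  imports "HOL-Algebra.Generated_Groups"
begin

text \<open>
  A word in the free monoid on formal generators and their formal inverses is a list of pairs
  \<open>(s, e)\<close>, where \<open>(s, True)\<close> stands for \<open>s\<close> and \<open>(s, False)\<close> for \<open>s\<^sup>-\<^sup>1\<close>.
  A set \<open>R\<close> of pairs of words is read as a set of defining relations \<open>u = v\<close>.
\<close>

type_synonym 's gword = "('s \<times> bool) list"

inductive pres_eq :: "('s gword \<times> 's gword) set \<Rightarrow> 's gword \<Rightarrow> 's gword \<Rightarrow> bool"
  for R :: "('s gword \<times> 's gword) set" where
  refl: "pres_eq R u u"
| sym: "pres_eq R u v \<Longrightarrow> pres_eq R v u"
| trans: "pres_eq R u v \<Longrightarrow> pres_eq R v w \<Longrightarrow> pres_eq R u w"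
| append: "pres_eq R u v \<Longrightarrow> pres_eq R u' v' \<Longrightarrow> pres_eq R (u @ u') (v @ v')"
| cancel: "pres_eq R [(s, e), (s, \<not> e)] []"
| rel: "(u, v) \<in> R \<Longrightarrow> pres_eq R u v"

definition pres_class :: "('s gword \<times> 's gword) set \<Rightarrow> 's gword \<Rightarrow> 's gword set" where
  "pres_class R u = {v. pres_eq R u v}"

definition pres_group :: "('s gword \<times> 's gword) set \<Rightarrow> 's gword set monoid" where
  "pres_group R =
     \<lparr>carrier = range (pres_class R),
      mult = (\<lambda>A B. \<Union>u\<in>A. \<Union>v\<in>B. pres_class R (u @ v)),
      one = pres_class R []\<rparr>"

lemma pres_class_eq_iff: "pres_class R u = pres_class R v \<longleftrightarrow> pres_eq R u v"
proof
  assume "pres_class R u = pres_class R v"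
  then have "v \<in> pres_class R u" by (simp add: pres_class_def pres_eq.refl)
  then show "pres_eq R u v" by (simp add: pres_class_def)
next
  assume uv: "pres_eq R u v"
  have "pres_eq R u w \<longleftrightarrow> pres_eq R v w" for w
    using pres_eq.trans[OF uv, of w] pres_eq.trans[OF pres_eq.sym[OF uv], of w] by iprover
  then show "pres_class R u = pres_class R v" by (simp add: pres_class_def)
qed

lemma pres_class_in_carrier [simp]: "pres_class R u \<in> carrier (pres_group R)"
  by (simp add: pres_group_def)

lemma pres_group_mult [simp]:
  "pres_class R u \<otimes>\<^bsub>pres_group R\<^esub> pres_class R v = pres_class R (u @ v)"
proof -
  have eq: "pres_class R (u' @ v') = pres_class R (u @ v)"
    if "u' \<in> pres_class R u" "v' \<in> pres_class R v" for u' v'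
  proof -
    have "pres_eq R u u'" "pres_eq R v v'" using that by (simp_all add: pres_class_def)
    then have "pres_eq R (u @ v) (u' @ v')" by (rule pres_eq.append)
    then show ?thesis by (simp add: pres_class_eq_iff pres_eq.sym)
  qed
  have "u \<in> pres_class R u" "v \<in> pres_class R v"
    by (simp_all add: pres_class_def pres_eq.refl)
  then have "(\<Union>u'\<in>pres_class R u. \<Union>v'\<in>pres_class R v. pres_class R (u' @ v'))
      = pres_class R (u @ v)"
    using eq by blast
  then show ?thesis by (simp add: pres_group_def)
qed

lemma pres_group_one: "\<one>\<^bsub>pres_group R\<^esub> = pres_class R []"
  by (simp add: pres_group_def)

definition inv_word :: "'s gword \<Rightarrow> 's gword" where
  "inv_word u = rev (map (\<lambda>(s, e). (s, \<not> e)) u)"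

lemma pres_eq_inv_word: "pres_eq R (inv_word u @ u) []"
proof (induction u)
  case Nil
  then show ?case by (simp add: inv_word_def pres_eq.refl)
next
  case (Cons p u)
  obtain s e where p: "p = (s, e)" by (cases p)
  have "pres_eq R ([(s, \<not> e), (s, e)] @ u) ([] @ u)"
    using pres_eq.cancel[of R s "\<not> e"] by (intro pres_eq.append[OF _ pres_eq.refl]) simp
  then have "pres_eq R (inv_word u @ [(s, \<not> e), (s, e)] @ u) (inv_word u @ [] @ u)"
    by (rule pres_eq.append[OF pres_eq.refl])
  moreover have "inv_word (p # u) @ p # u = inv_word u @ [(s, \<not> e), (s, e)] @ u"
    by (simp add: inv_word_def p)
  ultimately show ?case using pres_eq.trans[OF _ Cons.IH] by (metis append_Nil)
qed

lemma group_pres_group: "group (pres_group R)"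
proof (rule groupI)
  fix x y assume "x \<in> carrier (pres_group R)" "y \<in> carrier (pres_group R)"
  then obtain u v where "x = pres_class R u" "y = pres_class R v"
    by (auto simp: pres_group_def)
  then show "x \<otimes>\<^bsub>pres_group R\<^esub> y \<in> carrier (pres_group R)"
    by simp
next
  show "\<one>\<^bsub>pres_group R\<^esub> \<in> carrier (pres_group R)"
    by (simp add: pres_group_one)
next
  fix x y z
  assume "x \<in> carrier (pres_group R)" "y \<in> carrier (pres_group R)" "z \<in> carrier (pres_group R)"
  then obtain u v w where "x = pres_class R u" "y = pres_class R v" "z = pres_class R w"
    by (auto simp: pres_group_def)
  then show "x \<otimes>\<^bsub>pres_group R\<^esub> y \<otimes>\<^bsub>pres_group R\<^esub> z =
             x \<otimes>\<^bsub>pres_group R\<^esub> (y \<otimes>\<^bsub>pres_group R\<^esub> z)"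
    by simp
next
  fix x assume "x \<in> carrier (pres_group R)"
  then obtain u where u: "x = pres_class R u" by (auto simp: pres_group_def)
  then show "\<one>\<^bsub>pres_group R\<^esub> \<otimes>\<^bsub>pres_group R\<^esub> x = x"
    by (simp add: pres_group_one)
  have "pres_class R (inv_word u) \<otimes>\<^bsub>pres_group R\<^esub> x = \<one>\<^bsub>pres_group R\<^esub>"
    by (simp add: u pres_group_one pres_class_eq_iff pres_eq_inv_word)
  then show "\<exists>y\<in>carrier (pres_group R). y \<otimes>\<^bsub>pres_group R\<^esub> x = \<one>\<^bsub>pres_group R\<^esub>"
    by (rule bexI) (rule pres_class_in_carrier)
qed

lemma inv_pres_class:
  "inv\<^bsub>pres_group R\<^esub> (pres_class R u) = pres_class R (inv_word u)"
proof -
  interpret group "pres_group R" by (rule group_pres_group)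
  show ?thesis
    by (rule inv_equality) (simp_all add: pres_group_one pres_class_eq_iff pres_eq_inv_word)
qed

datatype gen = Ga | Gb

abbreviation word_a :: "gen gword" where "word_a \<equiv> [(Ga, True)]"
abbreviation word_b :: "gen gword" where "word_b \<equiv> [(Gb, True)]"

primrec alt_word :: "nat \<Rightarrow> 's gword \<Rightarrow> 's gword \<Rightarrow> 's gword" where
  "alt_word 0 u v = []"
| "alt_word (Suc n) u v = u @ alt_word n v u"

definition artin_rels :: "nat \<Rightarrow> (gen gword \<times> gen gword) set" where
  "artin_rels m = {(alt_word m word_a word_b, alt_word m word_b word_a)}"

definition dihedral_artin :: "nat \<Rightarrow> gen gword set monoid" where
  "dihedral_artin m = pres_group (artin_rels m)"

definition gen_x :: "nat \<Rightarrow> gen gword set" where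
  "gen_x m = pres_class (artin_rels m)
     (if odd m then alt_word m word_a word_b else word_a @ word_b)"

definition gen_y :: "nat \<Rightarrow> gen gword set" where
  "gen_y m = pres_class (artin_rels m) (if odd m then word_a @ word_b else word_a)"

definition free_product_gens :: "nat \<Rightarrow> gen gword set set" where
  "free_product_gens m =
     {gen_x m, inv\<^bsub>dihedral_artin m\<^esub> (gen_x m), gen_y m, inv\<^bsub>dihedral_artin m\<^esub> (gen_y m)}"

text \<open>
  Words over a generating set \<open>X \<subseteq> carrier G\<close> are the elements of \<open>lists X\<close>.
\<close>

definition word_proj :: "('a, 'b) monoid_scheme \<Rightarrow> 'a list \<Rightarrow> 'a" where
  "word_proj G w = foldr (\<lambda>g h. g \<otimes>\<^bsub>G\<^esub> h) w \<one>\<^bsub>G\<^esub>"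

definition word_length :: "('a, 'b) monoid_scheme \<Rightarrow> 'a set \<Rightarrow> 'a \<Rightarrow> nat" where
  "word_length G X g = (LEAST n. \<exists>w\<in>lists X. word_proj G w = g \<and> length w = n)"

definition conj_class :: "('a, 'b) monoid_scheme \<Rightarrow> 'a \<Rightarrow> 'a set" where
  "conj_class G g = {h \<otimes>\<^bsub>G\<^esub> g \<otimes>\<^bsub>G\<^esub> inv\<^bsub>G\<^esub> h | h. h \<in> carrier G}"

definition conj_length :: "('a, 'b) monoid_scheme \<Rightarrow> 'a set \<Rightarrow> 'a \<Rightarrow> nat" where
  "conj_length G X g = (LEAST n. \<exists>h\<in>conj_class G g. word_length G X h = n)"

definition ConjGeo :: "('a, 'b) monoid_scheme \<Rightarrow> 'a set \<Rightarrow> 'a list set" where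
  "ConjGeo G X = {w \<in> lists X. length w = conj_length G X (word_proj G w)}"

text \<open>
  Recognition by a complete deterministic finite automaton with state set \<open>Q\<close>, transition
  function \<open>\<delta>\<close>, initial state \<open>q0\<close> and accepting states \<open>F\<close>. Every finite state set can be
  renamed into \<open>nat\<close>, so fixing the type of states loses no generality.
\<close>

definition regular_language :: "'a set \<Rightarrow> 'a list set \<Rightarrow> bool" where
  "regular_language \<Sigma> L \<longleftrightarrow> finite \<Sigma> \<and>
     (\<exists>(Q :: nat set) \<delta> q0 F. finite Q \<and> q0 \<in> Q \<and> F \<subseteq> Q \<and>
        (\<forall>q\<in>Q. \<forall>c\<in>\<Sigma>. \<delta> q c \<in> Q) \<and>
        L = {w \<in> lists \<Sigma>. foldl \<delta> q0 w \<in> F})"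

lemma alt_word_odd:
  "pres_class R (alt_word (Suc (2 * k)) u v) =
     pres_class R (u @ v) [^]\<^bsub>pres_group R\<^esub> k \<otimes>\<^bsub>pres_group R\<^esub> pres_class R u"
proof -
  interpret group "pres_group R" by (rule group_pres_group)
  let ?c = "pres_class R"
  have c: "?c w \<in> carrier (pres_group R)" for w by simp
  show ?thesis
  proof (induction k)
    case 0
    show ?case by (simp add: pres_group_one)
  next
    case (Suc k)
    have "alt_word (Suc (2 * Suc k)) u v = (u @ v) @ alt_word (Suc (2 * k)) u v"
      by simp
    then have "?c (alt_word (Suc (2 * Suc k)) u v) =
        ?c (u @ v) \<otimes>\<^bsub>pres_group R\<^esub> ?c (alt_word (Suc (2 * k)) u v)"
      by (simp only: pres_group_mult)
    also have "\<dots> = ?c (u @ v) \<otimes>\<^bsub>pres_group R\<^esub>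
        (?c (u @ v) [^]\<^bsub>pres_group R\<^esub> k \<otimes>\<^bsub>pres_group R\<^esub> ?c u)"
      by (simp only: Suc.IH)
    also have "\<dots> = ?c (u @ v) [^]\<^bsub>pres_group R\<^esub> Suc k \<otimes>\<^bsub>pres_group R\<^esub> ?c u"
      by (simp only: nat_pow_Suc2[OF c] m_assoc[OF c nat_pow_closed[OF c] c])
    finally show ?case .
  qed
qed

lemma generate_free_product_gens:
  "generate (dihedral_artin m) (free_product_gens m) = carrier (dihedral_artin m)"
proof -
  let ?G = "dihedral_artin m" and ?c = "pres_class (artin_rels m)"
  interpret group ?G unfolding dihedral_artin_def by (rule group_pres_group)
  have carr: "?c u \<in> carrier ?G" for u by (simp add: dihedral_artin_def)
  have mult: "?c u \<otimes>\<^bsub>?G\<^esub> ?c v = ?c (u @ v)" for u v by (simp add: dihedral_artin_def)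
  have sub: "free_product_gens m \<subseteq> carrier ?G"
    using carr by (auto simp: free_product_gens_def gen_x_def gen_y_def)
  define H where "H = generate ?G (free_product_gens m)"
  interpret H: subgroup H ?G unfolding H_def by (rule generate_is_subgroup[OF sub])
  have x: "gen_x m \<in> H" and y: "gen_y m \<in> H"
    unfolding H_def free_product_gens_def by (auto intro: generate.incl)
  have pow: "g [^]\<^bsub>?G\<^esub> (k::nat) \<in> H" if "g \<in> H" for g k
    using that by (induction k) auto
  have left: "?c v \<in> H" if "?c u \<otimes>\<^bsub>?G\<^esub> ?c v \<in> H" "?c u \<in> H" for u v
  proof -
    have "?c v = inv\<^bsub>?G\<^esub> (?c u) \<otimes>\<^bsub>?G\<^esub> (?c u \<otimes>\<^bsub>?G\<^esub> ?c v)"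
      using carr by (simp add: m_assoc[symmetric])
    then show ?thesis using that by (metis H.m_closed H.m_inv_closed)
  qed
  have a: "?c word_a \<in> H"
  proof (cases "odd m")
    case True
    then obtain k where k: "m = Suc (2 * k)" by (auto elim: oddE)
    let ?p = "?c (word_a @ word_b) [^]\<^bsub>?G\<^esub> k"
    have "gen_x m = ?p \<otimes>\<^bsub>?G\<^esub> ?c word_a"
      using True alt_word_odd[of "artin_rels m" k word_a word_b]
      by (simp only: gen_x_def dihedral_artin_def if_True not_False_eq_True k[symmetric])
    moreover have p: "?p \<in> H" using y True by (intro pow) (simp add: gen_y_def)
    ultimately have "?c word_a = inv\<^bsub>?G\<^esub> ?p \<otimes>\<^bsub>?G\<^esub> gen_x m"
      using carr by (simp add: m_assoc[symmetric])
    then show ?thesis using p x by (metis H.m_closed H.m_inv_closed)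
  next
    case False
    then show ?thesis using y by (simp add: gen_y_def)
  qed
  have "?c (word_a @ word_b) \<in> H"
    using x y by (cases "odd m") (simp_all add: gen_x_def gen_y_def)
  then have b: "?c word_b \<in> H"
    using a left[of word_a word_b] by (simp only: mult)
  have letter: "?c [p] \<in> H" for p
  proof -
    obtain s e where p: "p = (s, e)" by (cases p)
    have pos: "?c [(s, True)] \<in> H" using a b by (cases s) auto
    have "?c [(s, False)] = inv\<^bsub>?G\<^esub> (?c [(s, True)])"
      by (simp add: dihedral_artin_def inv_pres_class inv_word_def)
    with pos have "?c [(s, False)] \<in> H" by simp
    with pos show ?thesis by (cases e) (auto simp: p)
  qed
  have "?c u \<in> H" for u
  proof (induction u)
    case Nil
    show ?case using H.one_closed by (simp add: dihedral_artin_def pres_group_one)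
  next
    case (Cons p u)
    then show ?case using H.m_closed[OF letter[of p] Cons] by (simp add: mult)
  qed
  then have "carrier ?G \<subseteq> H" by (auto simp: dihedral_artin_def pres_group_def)
  then show ?thesis using H.subset unfolding H_def by blast
qed

end

theory Submission
  imports Defs "HOL-Library.Multiset"
begin

text \<open>
  Both groups are \<open>\<langle>x, y | x\<^sup>a central, x\<^sup>a = y\<^sup>b\<rangle>\<close>: for odd \<open>m\<close> with \<open>a = 2\<close>, \<open>b = m\<close>, and for
  \<open>m = 2p\<close> with \<open>a = p\<close> and the last relation absent (\<open>b = 0\<close>). Modulo \<open>x\<^sup>a\<close> such a group is a free
  product of two cyclic groups, and the class of an element is determined by its class there and a
  homomorphism to the integers. So the length of a class with cyclic syllables
  \<open>x\<^sup>r y\<^sup>s x\<^sup>t y\<^sup>u \<dots>\<close> is the minimum of the sum of the absolute values of exponents in the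
  prescribed residue classes (modulo \<open>a\<close> and \<open>b\<close>) with a prescribed weighted sum. Since the absolute
  value is convex, a choice is optimal iff there is one integer slope \<open>l\<close>, \<open>\<bar>l\<bar> \<le> a\<close>, at which every
  single syllable is optimal in its residue class. For fixed \<open>l\<close> this is a condition on the separate
  syllables of a cyclic word that is ultimately periodic in the exponents, hence regular; the only
  complication is that for \<open>\<bar>l\<bar> = a\<close> blocks \<open>x\<^sup>l\<close> may be inserted anywhere without loss. The
  multiset of residues is a conjugacy invariant because counting a syllable in normal forms is a
  quasimorphism, which can be evaluated on large powers.
\<close>

section \<open>Regular languages\<close>

text \<open>A common slope exists because moving one factor x^a from one syllable to another does
  not change the group element. In a geodesic no such move lowers the cost, so the intervals from
  left to right difference of the syllables meet pairwise and share an integer point. An x-syllable,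
  possibly with exponent 0, confines this point to -a, ..., a. Hence finitely many slopes suffice
  and the language is a finite union, closed under rotation.

  The conjugacy problem is not solved in full. Optimality is certified by two invariants, the
  multiset of residues and the weighted sum. Neither sees the cyclic order, and none is needed,
  since at a given slope the syllables are optimised one by one. A word is compared only with
  geodesics of its class, because minimality is what makes their syllables nontrivial modulo the
  centre.

  The obstacle is that a geodesic is not given as a list of syllables: central blocks may sit inside
  a y-syllable. They are all merged into a single x-syllable, and equality in the triangle
  inequalities then forces them to have one sign and the slope to be a or -a.\<close>

text \<open>Myhill-Nerode in a convenient form: \<open>S\<close> is any right-invariant labelling of
  words with finite image that saturates \<open>L\<close>. The injection \<open>g\<close> moves the
  labels to \<open>nat\<close>, the state type fixed by the definition.\<close>

lemma regular_languageI:
  fixes S :: "'a list \<Rightarrow> 'q"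
  assumes fin: "finite A" and finS: "finite (S ` lists A)"
    and step: "\<And>u v c. u \<in> lists A \<Longrightarrow> v \<in> lists A \<Longrightarrow> c \<in> A \<Longrightarrow> S u = S v \<Longrightarrow> S (u @ [c]) = S (v @ [c])"
    and acc: "\<And>u v. u \<in> lists A \<Longrightarrow> v \<in> lists A \<Longrightarrow> S u = S v \<Longrightarrow> u \<in> L \<Longrightarrow> v \<in> L"
    and sub: "L \<subseteq> lists A"
  shows "regular_language A L"
proof -
  obtain g :: "'q \<Rightarrow> nat" where g: "inj_on g (S ` lists A)"
    using finite_imp_inj_to_nat_seg[OF finS] by auto
  \<comment> \<open>A representative word for each state; transitions append a letter to it, and
    \<open>step\<close> makes the result independent of the choice.\<close>
  define r where "r q = (SOME w. w \<in> lists A \<and> g (S w) = q)" for q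
  define \<delta> where "\<delta> q c = g (S (r q @ [c]))" for q c
  have r: "r (g (S w)) \<in> lists A \<and> g (S (r (g (S w)))) = g (S w)" if "w \<in> lists A" for w
    unfolding r_def by (rule someI[of _ w]) (use that in simp)
  have rS: "r (g (S w)) \<in> lists A" "S (r (g (S w))) = S w" if "w \<in> lists A" for w
    using r[OF that] g that by (auto dest: inj_onD)
  have \<delta>: "\<delta> (g (S w)) c = g (S (w @ [c]))" if "w \<in> lists A" "c \<in> A" for w c
    unfolding \<delta>_def using step[OF rS(1)[OF that(1)] that rS(2)[OF that(1)]] by simp
  have run: "foldl \<delta> (g (S [])) w = g (S w)" if "w \<in> lists A" for w
    using that by (induction w rule: rev_induct) (auto simp: \<delta>)
  let ?Q = "g ` S ` lists A"
  have L: "L = {w \<in> lists A. foldl \<delta> (g (S [])) w \<in> g ` S ` L}"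
  proof (intro equalityI subsetI)
    fix w assume "w \<in> L"
    moreover from this have "w \<in> lists A" using sub by blast
    ultimately show "w \<in> {w \<in> lists A. foldl \<delta> (g (S [])) w \<in> g ` S ` L}" using run by simp
  next
    fix w assume "w \<in> {w \<in> lists A. foldl \<delta> (g (S [])) w \<in> g ` S ` L}"
    then have "w \<in> lists A" "g (S w) \<in> g ` S ` L" using run[of w] by simp_all
    then obtain v where "w \<in> lists A" "v \<in> L" "g (S w) = g (S v)" by blast
    then show "w \<in> L" using acc[of v w] inj_onD[OF g, of "S w" "S v"] subsetD[OF sub, of v] by (metis imageI)
  qed
  have closed: "\<forall>q\<in>?Q. \<forall>c\<in>A. \<delta> q c \<in> ?Q"
  proof (intro ballI)
    fix q c assume "q \<in> ?Q" and c: "c \<in> A"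
    then obtain w where w: "w \<in> lists A" "q = g (S w)" by auto
    have "w @ [c] \<in> lists A" using w c by simp
    then show "\<delta> q c \<in> ?Q" using \<delta>[OF w(1) c] w(2) by blast
  qed
  show ?thesis unfolding regular_language_def
    using fin finS closed L sub
    apply (intro conjI)
     apply assumption
    apply (rule exI[of _ ?Q], rule exI[of _ \<delta>], rule exI[of _ "g (S [])"], rule exI[of _ "g ` S ` L"])
    apply (intro conjI)
         apply simp
        apply blast
       apply blast
    by assumption+
qed

lemma regular_languageE:
  fixes L :: "'a::finite list set"
  assumes "regular_language UNIV L"
  obtains Q F :: "nat set" and \<delta> q0 where "finite Q" "q0 \<in> Q"
    "\<And>q w. q \<in> Q \<Longrightarrow> foldl \<delta> q w \<in> Q" "\<And>w. w \<in> L \<longleftrightarrow> foldl \<delta> q0 w \<in> F"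
proof -
  obtain Q :: "nat set" and \<delta> q0 F where Q: "finite Q" "q0 \<in> Q" "\<forall>q\<in>Q. \<forall>c. \<delta> q c \<in> Q"
    "L = {w. foldl \<delta> q0 w \<in> F}"
    using assms by (auto simp: regular_language_def)
  have "foldl \<delta> q w \<in> Q" if "q \<in> Q" for q w
    using that Q(3) by (induction w arbitrary: q) auto
  then show ?thesis using that Q by blast
qed

lemma regular_UNIV_I:
  fixes S :: "'a::finite list \<Rightarrow> 'q"
  assumes "range S \<subseteq> R" "finite R" "\<And>w c. S (w @ [c]) = d (S w) c" "\<And>w. w \<in> L \<longleftrightarrow> acc (S w)"
  shows "regular_language UNIV L"
proof (rule regular_languageI[where S = S])
  show "finite (S ` lists UNIV)" using assms(1,2) finite_subset by auto
  show "S (u @ [c]) = S (v @ [c])" if "S u = S v" for u v c using that by (simp only: assms(3))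
  show "v \<in> L" if "S u = S v" "u \<in> L" for u v using that by (simp only: assms(4))
qed simp_all

lemma regular_empty: "regular_language UNIV ({} :: 'a::finite list set)"
  by (rule regular_UNIV_I[where S = "\<lambda>_. ()" and R = UNIV and d = "\<lambda>_ _. ()" and acc = "\<lambda>_. False"]) simp_all

text \<open>The state is a prefix of length at most \<open>Suc (length u)\<close>; the extra letter
  separates \<open>u\<close> from its proper extensions.\<close>

lemma regular_singleton: "regular_language UNIV {u :: 'a::finite list}"
proof (rule regular_UNIV_I[where S = "take (Suc (length u))" and acc = "\<lambda>s. s = u"
      and R = "{w. set w \<subseteq> UNIV \<and> length w \<le> Suc (length u)}" and d = "\<lambda>s c. take (Suc (length u)) (s @ [c])"])
  show "finite {w :: 'a list. set w \<subseteq> UNIV \<and> length w \<le> Suc (length u)}"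
    by (rule finite_lists_length_le) simp
  show "w \<in> {u} \<longleftrightarrow> take (Suc (length u)) w = u" for w :: "'a list"
  proof
    assume *: "take (Suc (length u)) w = u"
    then have "length (take (Suc (length u)) w) = length u" by (rule arg_cong)
    then have "length w \<le> length u" by (simp add: min_def split: if_splits)
    then show "w \<in> {u}" using * by simp
  qed simp
qed (auto simp: min_def)

lemma regular_Un:
  fixes L M :: "'a::finite list set"
  assumes "regular_language UNIV L" "regular_language UNIV M"
  shows "regular_language UNIV (L \<union> M)" and "regular_language UNIV (L \<inter> M)"
proof -
  obtain Q F \<delta> q0 where 1: "finite Q" "q0 \<in> Q"
    "\<And>q w. q \<in> Q \<Longrightarrow> foldl \<delta> q w \<in> Q" "\<And>w. w \<in> L \<longleftrightarrow> foldl \<delta> (q0::nat) w \<in> F"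
    by (rule regular_languageE[OF assms(1)]) blast
  obtain Q' F' \<delta>' q0' where 2: "finite Q'" "q0' \<in> Q'"
    "\<And>q w. q \<in> Q' \<Longrightarrow> foldl \<delta>' q w \<in> Q'" "\<And>w. w \<in> M \<longleftrightarrow> foldl \<delta>' (q0'::nat) w \<in> F'"
    by (rule regular_languageE[OF assms(2)]) blast
  \<comment> \<open>One product automaton decides every Boolean combination \<open>P\<close> of the
    two memberships.\<close>
  have "regular_language UNIV {w. P (w \<in> L) (w \<in> M)}" for P
    by (rule regular_UNIV_I[where S = "\<lambda>w. (foldl \<delta> q0 w, foldl \<delta>' q0' w)" and R = "Q \<times> Q'"
          and d = "\<lambda>(p, q) c. (\<delta> p c, \<delta>' q c)" and acc = "\<lambda>(p, q). P (p \<in> F) (q \<in> F')"])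
      (simp_all add: image_subset_iff 1 2)
  from this[of "(\<or>)"] this[of "(\<and>)"]
  show "regular_language UNIV (L \<union> M)" and "regular_language UNIV (L \<inter> M)"
    by (simp_all add: Un_def Int_def)
qed

lemma regular_UN:
  fixes L :: "'i \<Rightarrow> 'a::finite list set"
  assumes "finite I" "\<And>i. i \<in> I \<Longrightarrow> regular_language UNIV (L i)"
  shows "regular_language UNIV (\<Union>i\<in>I. L i)"
  using assms by (induction I rule: finite_induct) (auto intro: regular_empty regular_Un)

section \<open>Concatenation, star and rotation\<close>

definition lang_conc :: "'a list set \<Rightarrow> 'a list set \<Rightarrow> 'a list set" where
  "lang_conc L M = {u @ v | u v. u \<in> L \<and> v \<in> M}"

definition lang_star :: "'a list set \<Rightarrow> 'a list set" where
  "lang_star L = concat ` lists L"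

definition lang_rot :: "'a list set \<Rightarrow> 'a list set" where
  "lang_rot L = {u @ v | u v. v @ u \<in> L}"

text \<open>The subset constructions below remember a value \<open>f u v\<close> for every
  admissible split of the input. Reading \<open>c\<close> updates the old values by
  \<open>g\<close>, and the only new split has an empty second part.\<close>

lemma snoc_splits:
  assumes "\<And>u v. f u (v @ [c]) = g (f u v)"
  shows "{f u v | u v. w @ [c] = u @ v \<and> P u} =
     g ` {f u v | u v. w = u @ v \<and> P u} \<union> (if P (w @ [c]) then {f (w @ [c]) []} else {})"
    (is "?L = ?R")
proof
  show "?L \<subseteq> ?R"
  proof
    fix z assume "z \<in> ?L"
    then obtain u v where uv: "w @ [c] = u @ v" "P u" "z = f u v" by blast
    show "z \<in> ?R"
    proof (cases v rule: rev_cases)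
      case Nil then show ?thesis using uv by simp
    next
      case (snoc v' d)
      then have "z = g (f u v')" "w = u @ v'" using uv assms by simp_all
      then show ?thesis using uv(2) by blast
    qed
  qed
  have "g (f u v) \<in> ?L" if "w = u @ v" "P u" for u v
    using that by (intro CollectI exI[of _ u] exI[of _ "v @ [c]"]) (simp add: assms)
  moreover have "f (w @ [c]) [] \<in> ?L" if "P (w @ [c])"
    using that by (intro CollectI exI[of _ "w @ [c]"] exI[of _ "[]"]) simp
  ultimately show "?R \<subseteq> ?L" by auto
qed

lemma regular_conc:
  fixes L M :: "'a::finite list set"
  assumes "regular_language UNIV L" "regular_language UNIV M"
  shows "regular_language UNIV (lang_conc L M)"
proof -
  obtain Q F \<delta> q0 where 1: "finite Q" "q0 \<in> Q"
    "\<And>q w. q \<in> Q \<Longrightarrow> foldl \<delta> q w \<in> Q" "\<And>w. w \<in> L \<longleftrightarrow> foldl \<delta> (q0::nat) w \<in> F"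
    by (rule regular_languageE[OF assms(1)]) blast
  obtain Q' F' \<delta>' q0' where 2: "finite Q'" "q0' \<in> Q'"
    "\<And>q w. q \<in> Q' \<Longrightarrow> foldl \<delta>' q w \<in> Q'" "\<And>w. w \<in> M \<longleftrightarrow> foldl \<delta>' (q0'::nat) w \<in> F'"
    by (rule regular_languageE[OF assms(2)]) blast
  \<comment> \<open>The possible states of the second automaton, started once after each prefix in
    \<open>L\<close>.\<close>
  define C where "C w = {foldl \<delta>' q0' v | u v. w = u @ v \<and> u \<in> L}" for w
  have C: "C (w @ [c]) = (\<lambda>q. \<delta>' q c) ` C w \<union> (if w @ [c] \<in> L then {q0'} else {})" for w c
    unfolding C_def by (subst snoc_splits[where g = "\<lambda>q. \<delta>' q c"]) simp_all
  show ?thesis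
  proof (rule regular_UNIV_I[where S = "\<lambda>w. (foldl \<delta> q0 w, C w)" and R = "Q \<times> Pow Q'"
        and d = "\<lambda>(p, X) c. (\<delta> p c, (\<lambda>q. \<delta>' q c) ` X \<union> (if \<delta> p c \<in> F then {q0'} else {}))"
        and acc = "\<lambda>(p, X). X \<inter> F' \<noteq> {}"])
    show "range (\<lambda>w. (foldl \<delta> q0 w, C w)) \<subseteq> Q \<times> Pow Q'"
      using 1(3)[OF 1(2)] 2(3)[OF 2(2)] by (auto simp: C_def)
    show "finite (Q \<times> Pow Q')" using 1(1) 2(1) by simp
    show "(w \<in> lang_conc L M) = (case (foldl \<delta> q0 w, C w) of (p, X) \<Rightarrow> X \<inter> F' \<noteq> {})" for w
    proof -
      have "w \<in> lang_conc L M \<longleftrightarrow> (\<exists>u v. w = u @ v \<and> u \<in> L \<and> foldl \<delta>' q0' v \<in> F')"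
        by (simp add: lang_conc_def 2(4))
      also have "\<dots> \<longleftrightarrow> C w \<inter> F' \<noteq> {}" unfolding C_def by blast
      finally show ?thesis by simp
    qed
  qed (simp_all add: 1(4) C)
qed

lemma lang_star_Nil: "[] \<in> lang_star L"
  unfolding lang_star_def by (rule image_eqI[of _ _ "[]"]) auto

lemma lang_star_append: "u \<in> lang_star L \<Longrightarrow> v \<in> lang_star L \<Longrightarrow> u @ v \<in> lang_star L"
proof -
  assume "u \<in> lang_star L" "v \<in> lang_star L"
  then obtain us vs where "us \<in> lists L" "vs \<in> lists L" "u = concat us" "v = concat vs"
    by (auto simp: lang_star_def)
  then show ?thesis unfolding lang_star_def by (intro image_eqI[of _ _ "us @ vs"]) simp_all
qed

lemma lang_star_incl: "u \<in> L \<Longrightarrow> u \<in> lang_star L"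
  unfolding lang_star_def by (rule image_eqI[of _ _ "[u]"]) auto

lemma lang_star_replicate: "u \<in> L \<Longrightarrow> concat (replicate n u) \<in> lang_star L"
  unfolding lang_star_def by (rule image_eqI[of _ _ "replicate n u"]) auto

lemma lang_star_induct [consumes 1, case_names Nil append]:
  assumes "w \<in> lang_star L" "P []" "\<And>u v. u \<in> L \<Longrightarrow> v \<in> lang_star L \<Longrightarrow> P v \<Longrightarrow> P (u @ v)"
  shows "P w"
proof -
  have "P (concat ws)" if "ws \<in> lists L" for ws
    using that
  proof (induction ws)
    case (Cons u ws)
    then show ?case using assms(3)[of u "concat ws"] by (auto simp: lang_star_def)
  qed (use assms(2) in simp)
  then show ?thesis using assms(1) by (auto simp: lang_star_def)
qed

text \<open>Trailing empty factors are discarded until the last factor ends in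
  \<open>c\<close>.\<close>

lemma lang_star_snocE:
  assumes "w @ [c] \<in> lang_star L"
  obtains u v where "w = u @ v" "u \<in> lang_star L" "v @ [c] \<in> L"
proof -
  have "\<exists>u v. w = u @ v \<and> u \<in> lang_star L \<and> v @ [c] \<in> L"
    if "ws \<in> lists L" "w @ [c] = concat ws" for ws
    using that
  proof (induction ws rule: rev_induct)
    case (snoc x ws)
    show ?case
    proof (cases x rule: rev_cases)
      case Nil then show ?thesis using snoc.IH snoc.prems by simp
    next
      case (snoc y d)
      then have "w = concat ws @ y" "y @ [c] \<in> L" "concat ws \<in> lang_star L"
        using snoc.prems by (simp_all add: lang_star_def)
      then show ?thesis by blast
    qed
  qed simp
  moreover obtain ws where "ws \<in> lists L" "w @ [c] = concat ws" using assms by (auto simp: lang_star_def)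
  ultimately show ?thesis using that by blast
qed

lemma regular_star:
  fixes L :: "'a::finite list set"
  assumes "regular_language UNIV L"
  shows "regular_language UNIV (lang_star L)"
proof -
  obtain Q F \<delta> q0 where 1: "finite Q" "q0 \<in> Q"
    "\<And>q w. q \<in> Q \<Longrightarrow> foldl \<delta> q w \<in> Q" "\<And>w. w \<in> L \<longleftrightarrow> foldl \<delta> (q0::nat) w \<in> F"
    by (rule regular_languageE[OF assms(1)]) blast
  \<comment> \<open>Runs on the unfinished last factor, one for each prefix that already lies in the
    star.\<close>
  define C where "C w = {foldl \<delta> q0 v | u v. w = u @ v \<and> u \<in> lang_star L}" for w
  have C: "C (w @ [c]) = (\<lambda>q. \<delta> q c) ` C w \<union> (if w @ [c] \<in> lang_star L then {q0} else {})" for w c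
    unfolding C_def by (subst snoc_splits[where g = "\<lambda>q. \<delta> q c"]) simp_all
  have mem: "w @ [c] \<in> lang_star L \<longleftrightarrow> (\<exists>q\<in>C w. \<delta> q c \<in> F)" for w c
  proof -
    have "w @ [c] \<in> lang_star L \<longleftrightarrow> (\<exists>u v. w = u @ v \<and> u \<in> lang_star L \<and> v @ [c] \<in> L)"
    proof
      assume "w @ [c] \<in> lang_star L"
      then show "\<exists>u v. w = u @ v \<and> u \<in> lang_star L \<and> v @ [c] \<in> L"
        by (rule lang_star_snocE) blast
    next
      assume "\<exists>u v. w = u @ v \<and> u \<in> lang_star L \<and> v @ [c] \<in> L"
      then obtain u v where "w @ [c] = u @ (v @ [c])" "u \<in> lang_star L" "v @ [c] \<in> L" by auto
      then show "w @ [c] \<in> lang_star L" using lang_star_append lang_star_incl by metis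
    qed
    also have "\<dots> \<longleftrightarrow> (\<exists>u v. w = u @ v \<and> u \<in> lang_star L \<and> \<delta> (foldl \<delta> q0 v) c \<in> F)"
      by (simp add: 1(4))
    also have "\<dots> \<longleftrightarrow> (\<exists>q\<in>C w. \<delta> q c \<in> F)" unfolding C_def by blast
    finally show ?thesis .
  qed
  show ?thesis
  proof (rule regular_UNIV_I[where S = "\<lambda>w. (w \<in> lang_star L, C w)" and R = "UNIV \<times> Pow Q"
        and d = "\<lambda>(p, X) c. (\<exists>q\<in>X. \<delta> q c \<in> F, (\<lambda>q. \<delta> q c) ` X \<union> (if \<exists>q\<in>X. \<delta> q c \<in> F then {q0} else {}))"
        and acc = fst])
    show "range (\<lambda>w. (w \<in> lang_star L, C w)) \<subseteq> UNIV \<times> Pow Q"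
      using 1(3)[OF 1(2)] by (auto simp: C_def)
    show "finite ((UNIV :: bool set) \<times> Pow Q)" using 1(1) by simp
  qed (simp_all add: C mem)
qed

text \<open>The part \<open>u\<close> is read before the state reached by \<open>v\<close> is known.
  So the whole transition map of \<open>u\<close> is stored, restricted to \<open>Q\<close> to leave
  finitely many maps, together with the state after \<open>v\<close>.\<close>

lemma regular_rot:
  fixes L :: "'a::finite list set"
  assumes "regular_language UNIV L"
  shows "regular_language UNIV (lang_rot L)"
proof -
  obtain Q F \<delta> q0 where 1: "finite Q" "q0 \<in> Q"
    "\<And>q w. q \<in> Q \<Longrightarrow> foldl \<delta> q w \<in> Q" "\<And>w. w \<in> L \<longleftrightarrow> foldl \<delta> (q0::nat) w \<in> F"
    by (rule regular_languageE[OF assms(1)]) blast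
  define f where "f w = (\<lambda>q\<in>Q. foldl \<delta> q w)" for w
  have fQ: "f w \<in> Q \<rightarrow>\<^sub>E Q" for w using 1(3) by (auto simp: f_def)
  have fs: "f (w @ [c]) = (\<lambda>q\<in>Q. \<delta> (f w q) c)" for w c by (auto simp: f_def restrict_def)
  define C where "C w = {(f u, foldl \<delta> q0 v) | u v. w = u @ v \<and> True}" for w
  have C: "C (w @ [c]) = (\<lambda>(g, q). (g, \<delta> q c)) ` C w \<union> {(f (w @ [c]), q0)}" for w c
    unfolding C_def by (subst snoc_splits[where g = "\<lambda>(g, q). (g, \<delta> q c)"]) simp_all
  show ?thesis
  proof (rule regular_UNIV_I[where S = "\<lambda>w. (f w, C w)" and R = "range f \<times> Pow (range f \<times> Q)"
        and d = "\<lambda>(p, X) c. (\<lambda>q\<in>Q. \<delta> (p q) c,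
            (\<lambda>(g, q). (g, \<delta> q c)) ` X \<union> {(\<lambda>q\<in>Q. \<delta> (p q) c, q0)})"
        and acc = "\<lambda>(p, X). \<exists>(g, q) \<in> X. g q \<in> F"])
    show "range (\<lambda>w. (f w, C w)) \<subseteq> range f \<times> Pow (range f \<times> Q)"
    proof -
      have Q: "foldl \<delta> q0 v \<in> Q" for v using 1(3)[OF 1(2)] .
      have "C w \<subseteq> range f \<times> Q" for w using Q by (auto simp: C_def)
      then show ?thesis by auto
    qed
    have "range f \<subseteq> Q \<rightarrow>\<^sub>E Q" using fQ by blast
    then have "finite (range f)" using finite_PiE[of Q "\<lambda>_. Q"] 1(1) finite_subset by blast
    then show "finite (range f \<times> Pow (range f \<times> Q))" using 1(1) by simp
    show "(w \<in> lang_rot L) = (case (f w, C w) of (p, X) \<Rightarrow> \<exists>(g, q) \<in> X. g q \<in> F)" for w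
    proof -
      have fa: "f u (foldl \<delta> q0 v) \<in> F \<longleftrightarrow> v @ u \<in> L" for u v
        using 1(3)[OF 1(2)] by (simp add: f_def 1(4))
      have "w \<in> lang_rot L \<longleftrightarrow> (\<exists>u v. w = u @ v \<and> f u (foldl \<delta> q0 v) \<in> F)"
        by (simp add: lang_rot_def fa)
      also have "\<dots> \<longleftrightarrow> (\<exists>(g, q) \<in> C w. g q \<in> F)" unfolding C_def by blast
      finally show ?thesis by simp
    qed
    show "(f (w @ [c]), C (w @ [c])) = (case (f w, C w) of (p, X) \<Rightarrow> \<lambda>c. (\<lambda>q\<in>Q. \<delta> (p q) c,
            (\<lambda>(g, q). (g, \<delta> q c)) ` X \<union> {(\<lambda>q\<in>Q. \<delta> (p q) c, q0)})) c" for w c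
      by (simp only: C fs prod.case)
  qed
qed

section \<open>Counting letters and changing the alphabet\<close>

definition ult_periodic :: "nat set \<Rightarrow> bool" where
  "ult_periodic N \<longleftrightarrow> (\<exists>K M. M > 0 \<and> (\<forall>n\<ge>K. n + M \<in> N \<longleftrightarrow> n \<in> N))"

lemma ult_periodic_mod:
  fixes K M n n' :: nat
  assumes "\<forall>n\<ge>K. n + M \<in> N \<longleftrightarrow> n \<in> N" "K \<le> n" "K \<le> n'" "n mod M = n' mod M"
  shows "n \<in> N \<longleftrightarrow> n' \<in> N"
proof -
  have add: "n + M * j \<in> N \<longleftrightarrow> n \<in> N" if "K \<le> n" for n and j :: nat
  proof (induct j)
    case (Suc j)
    have "n + M * j + M \<in> N \<longleftrightarrow> n + M * j \<in> N" using assms(1) that by simp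
    moreover have "n + M * Suc j = n + M * j + M" by simp
    ultimately show ?case using Suc by (simp only:)
  qed simp
  have *: "n \<in> N \<longleftrightarrow> n' \<in> N" if le: "n \<le> n'" "K \<le> n" "n mod M = n' mod M" for n n'
  proof -
    obtain j where "n' = n + M * j" using mod_eq_nat1E[OF le(3)[symmetric] le(1)] by blast
    then show ?thesis using add[OF le(2), of j] by simp
  qed
  show ?thesis
  proof (cases "n \<le> n'")
    case True then show ?thesis using *[OF True assms(2,4)] by simp
  next
    case False
    then have "n' \<le> n" by simp
    then show ?thesis using *[OF _ assms(3) assms(4)[symmetric]] by simp
  qed
qed

lemma regular_count:
  fixes x :: "'a::finite"
  assumes "ult_periodic N"
  shows "regular_language UNIV {w. count_list w x \<in> N}"
proof -
  obtain K M where KM: "M > 0" "\<forall>n\<ge>K. n + M \<in> N \<longleftrightarrow> n \<in> N"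
    using assms unfolding ult_periodic_def by blast
  \<comment> \<open>Below the threshold \<open>K\<close> the count is known exactly, above it only
    modulo \<open>M\<close>.\<close>
  define k where "k n = (min n K, n mod M)" for n
  have k1: "k (Suc n) = k (Suc n')" if "k n = k n'" for n n'
  proof -
    have "min (Suc n) K = min (Suc n') K" using that unfolding k_def prod.inject by linarith
    then show ?thesis using that by (simp add: k_def mod_Suc)
  qed
  have kN: "n' \<in> N" if "k n = k n'" "n \<in> N" for n n'
  proof (cases "n < K")
    case True
    then have "n = n'" using that(1) unfolding k_def prod.inject by linarith
    then show ?thesis using that by simp
  next
    case False
    then have "K \<le> n" "K \<le> n'" using that(1) unfolding k_def prod.inject by linarith+
    moreover have "n mod M = n' mod M" using that(1) by (simp add: k_def)
    ultimately have "n \<in> N \<longleftrightarrow> n' \<in> N" by (rule ult_periodic_mod[OF KM(2)])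
    then show ?thesis using that(2) by simp
  qed
  have c: "count_list (w @ [c]) x = (if c = x then Suc (count_list w x) else count_list w x)" for w c
    by simp
  show ?thesis
  proof (rule regular_languageI[where S = "\<lambda>w. k (count_list w x)"])
    have "(\<lambda>w. k (count_list w x)) ` lists UNIV \<subseteq> {..K} \<times> {..<M}"
      using KM(1) by (simp add: k_def image_subset_iff)
    then show "finite ((\<lambda>w. k (count_list w x)) ` lists UNIV)" using finite_subset by blast
    show "k (count_list (u @ [c]) x) = k (count_list (v @ [c]) x)"
      if "k (count_list u x) = k (count_list v x)" for u v and c :: 'a
      using that k1[OF that] by (simp add: c del: count_list_append)
    show "v \<in> {w. count_list w x \<in> N}"
      if "k (count_list u x) = k (count_list v x)" "u \<in> {w. count_list w x \<in> N}" for u v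
      using that(2) kN[OF that(1)] by simp
  qed simp_all
qed

text \<open>The alphabet \<open>A\<close> is a finite subset of a possibly infinite type; in this
  way a language over formal letters becomes one over group elements.\<close>

lemma regular_map_preimage:
  fixes L :: "'b::finite list set"
  assumes "regular_language UNIV L" "finite A"
  shows "regular_language A {w \<in> lists A. map h w \<in> L}"
proof -
  obtain Q F \<delta> q0 where 1: "finite Q" "q0 \<in> Q"
    "\<And>q w. q \<in> Q \<Longrightarrow> foldl \<delta> q w \<in> Q" "\<And>w. w \<in> L \<longleftrightarrow> foldl \<delta> (q0::nat) w \<in> F"
    by (rule regular_languageE[OF assms(1)]) blast
  show ?thesis
  proof (rule regular_languageI[where S = "\<lambda>w. foldl \<delta> q0 (map h w)"])
    show "finite ((\<lambda>w. foldl \<delta> q0 (map h w)) ` lists A)"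
      using 1(3)[OF 1(2)] by (intro finite_subset[OF _ 1(1)]) blast
    show "foldl \<delta> q0 (map h (u @ [c])) = foldl \<delta> q0 (map h (v @ [c]))"
      if "foldl \<delta> q0 (map h u) = foldl \<delta> q0 (map h v)" for u v c using that by simp
    show "v \<in> {w \<in> lists A. map h w \<in> L}"
      if "v \<in> lists A" "foldl \<delta> q0 (map h u) = foldl \<delta> q0 (map h v)" "u \<in> {w \<in> lists A. map h w \<in> L}" for u v
      using that by (simp add: 1(4))
  qed (use assms(2) in blast)+
qed

section \<open>Presentations and words in two generators\<close>

lemmas pres_eq_trans [trans] = pres_eq.trans

lemma pres_eq_left: "pres_eq R u v \<Longrightarrow> pres_eq R (w @ u) (w @ v)"
  by (rule pres_eq.append[OF pres_eq.refl])

lemma pres_eq_right: "pres_eq R u v \<Longrightarrow> pres_eq R (u @ w) (v @ w)"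
  by (rule pres_eq.append[OF _ pres_eq.refl])

lemma pres_eq_mid: "pres_eq R u v \<Longrightarrow> pres_eq R (p @ u @ q) (p @ v @ q)"
  by (intro pres_eq_left pres_eq_right)

lemma inv_word_append: "inv_word (u @ v) = inv_word v @ inv_word u"
  by (simp add: inv_word_def)

lemma inv_word_inv_word [simp]: "inv_word (inv_word u) = u"
  by (induction u) (auto simp: inv_word_def)

lemma pres_eq_inv_word_right: "pres_eq R (u @ inv_word u) []"
  using pres_eq_inv_word[of R "inv_word u"] by simp

lemma pres_eq_cancel_left:
  assumes "pres_eq R (w @ u) (w @ v)"
  shows "pres_eq R u v"
proof -
  have e: "pres_eq R (inv_word w @ w @ x) x" for x
    using pres_eq_right[OF pres_eq_inv_word, of R w x] by simp
  have "pres_eq R (inv_word w @ w @ u) (inv_word w @ w @ v)"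
    by (rule pres_eq_left[OF assms])
  then show ?thesis using e pres_eq.sym pres_eq.trans by metis
qed

lemma pres_eq_inv_word_cong:
  assumes "pres_eq R u v"
  shows "pres_eq R (inv_word u) (inv_word v)"
proof (rule pres_eq_cancel_left[of _ v])
  have "pres_eq R (v @ inv_word u) (u @ inv_word u)"
    by (rule pres_eq_right[OF pres_eq.sym[OF assms]])
  then show "pres_eq R (v @ inv_word u) (v @ inv_word v)"
    using pres_eq_inv_word_right pres_eq.sym pres_eq.trans by metis
qed

lemma pres_eq_commute_append:
  assumes "pres_eq R (u @ v) (v @ u)" "pres_eq R (u @ w) (w @ u)"
  shows "pres_eq R (u @ v @ w) ((v @ w) @ u)"
proof -
  have "pres_eq R (u @ v @ w) (v @ u @ w)" using pres_eq_right[OF assms(1), of w] by simp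
  moreover have "pres_eq R (v @ u @ w) (v @ w @ u)" by (rule pres_eq_left[OF assms(2)])
  ultimately show ?thesis using pres_eq.trans by fastforce
qed

lemma pres_eq_commute_inverse:
  assumes "pres_eq R (u @ v) (v @ u)" "pres_eq R (v @ w) []" "pres_eq R (w @ v) []"
  shows "pres_eq R (u @ w) (w @ u)"
proof (rule pres_eq_cancel_left[of _ v])
  have "pres_eq R (v @ u @ w) (u @ v @ w)"
    using pres_eq_right[OF pres_eq.sym[OF assms(1)], of w] by simp
  also have "pres_eq R (u @ v @ w) (u @ [])" by (rule pres_eq_left[OF assms(2)])
  also have "pres_eq R (u @ []) ((v @ w) @ u)"
    using pres_eq_right[OF pres_eq.sym[OF assms(2)], of u] by simp
  finally show "pres_eq R (v @ u @ w) (v @ w @ u)" by simp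
qed

section \<open>Powers, exponent sums and syllables\<close>

definition pw :: "gen \<Rightarrow> int \<Rightarrow> gen gword" where
  "pw s e = replicate (nat \<bar>e\<bar>) (s, 0 \<le> e)"

lemma length_pw [simp]: "length (pw s e) = nat \<bar>e\<bar>"
  by (simp add: pw_def)

lemma pw_0 [simp]: "pw s 0 = []"
  by (simp add: pw_def)

lemma pw_nonneg: "0 \<le> e \<Longrightarrow> pw s e = replicate (nat e) (s, True)"
  by (simp add: pw_def)

lemma pw_nonpos: "e \<le> 0 \<Longrightarrow> pw s e = replicate (nat (- e)) (s, False)"
  by (cases "e = 0") (simp_all add: pw_def)

lemma pw_plus_1: "pres_eq R (pw s e @ [(s, True)]) (pw s (e + 1))"
proof (cases "0 \<le> e")
  case True
  then have "pw s e @ [(s, True)] = pw s (e + 1)"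
    by (simp add: pw_nonneg replicate_append_same nat_add_distrib)
  then show ?thesis by (simp add: pres_eq.refl)
next
  case False
  have "nat (- e) = Suc (nat (- (e + 1)))" using False by simp
  then have "pw s e @ [(s, True)] = pw s (e + 1) @ [(s, False), (s, True)]"
    using False by (simp add: pw_nonpos replicate_append_same[symmetric])
  then show ?thesis using pres_eq_left[OF pres_eq.cancel, of R "pw s (e + 1)" s False] by simp
qed

lemma pw_minus_1: "pres_eq R (pw s e @ [(s, False)]) (pw s (e - 1))"
proof (cases "e \<le> 0")
  case True
  have "nat (- (e - 1)) = Suc (nat (- e))" using True by simp
  then have "pw s e @ [(s, False)] = pw s (e - 1)"
    using True by (simp add: pw_nonpos replicate_append_same)
  then show ?thesis by (simp add: pres_eq.refl)
next
  case False
  have "nat e = Suc (nat (e - 1))" using False by simp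
  then have "pw s e @ [(s, False)] = pw s (e - 1) @ [(s, True), (s, False)]"
    using False by (simp add: pw_nonneg replicate_append_same[symmetric])
  then show ?thesis using pres_eq_left[OF pres_eq.cancel, of R "pw s (e - 1)" s True] by simp
qed

lemma pw_add: "pres_eq R (pw s e @ pw s f) (pw s (e + f))"
proof (induction f rule: int_induct[where k = 0])
  case base
  show ?case by (simp add: pres_eq.refl)
next
  case (step1 f)
  have "pres_eq R (pw s e @ pw s f @ [(s, True)]) (pw s (e + f) @ [(s, True)])"
    using pres_eq_right[OF step1(2), of "[(s, True)]"] by simp
  moreover have "pres_eq R (pw s e @ pw s (f + 1)) (pw s e @ pw s f @ [(s, True)])"
    by (rule pres_eq_left[OF pres_eq.sym[OF pw_plus_1]])
  moreover have "pres_eq R (pw s (e + f) @ [(s, True)]) (pw s (e + (f + 1)))"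
    using pw_plus_1[of R s "e + f"] by (simp add: add.assoc)
  ultimately show ?case using pres_eq.trans by metis
next
  case (step2 f)
  have "pres_eq R (pw s e @ pw s f @ [(s, False)]) (pw s (e + f) @ [(s, False)])"
    using pres_eq_right[OF step2(2), of "[(s, False)]"] by simp
  moreover have "pres_eq R (pw s e @ pw s (f - 1)) (pw s e @ pw s f @ [(s, False)])"
    by (rule pres_eq_left[OF pres_eq.sym[OF pw_minus_1]])
  moreover have "pres_eq R (pw s (e + f) @ [(s, False)]) (pw s (e + (f - 1)))"
    using pw_minus_1[of R s "e + f"] by (simp add: algebra_simps)
  ultimately show ?case using pres_eq.trans by metis
qed

definition letter_sign :: "'s \<times> bool \<Rightarrow> int" where
  "letter_sign c = (if snd c then 1 else - 1)"

definition expo :: "gen \<Rightarrow> gen gword \<Rightarrow> int" where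
  "expo s w = (\<Sum>c\<leftarrow>w. if fst c = s then letter_sign c else 0)"

lemma expo_simps [simp]:
  "expo s [] = 0" "expo s (c # w) = (if fst c = s then letter_sign c else 0) + expo s w"
  "expo s (u @ v) = expo s u + expo s v"
  by (simp_all add: expo_def)

lemma expo_replicate: "expo s (replicate n c) = (if fst c = s then int n * letter_sign c else 0)"
  by (induction n) (auto simp: algebra_simps)

lemma expo_pw [simp]: "expo s (pw s' e) = (if s' = s then e else 0)"
  by (simp add: pw_def expo_replicate letter_sign_def)

lemma abs_expo_le: "\<bar>expo s w\<bar> \<le> int (length w)"
proof (induction w)
  case (Cons c w)
  then show ?case by (simp add: letter_sign_def) arith
qed simp

lemma abs_expo_add_le: "\<bar>expo Ga w\<bar> + \<bar>expo Gb w\<bar> \<le> int (length w)"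
proof (induction w)
  case (Cons c w)
  then show ?case by (cases "fst c"; simp add: letter_sign_def; arith)
qed simp

lemma monochrome_pres_eq:
  assumes "\<forall>c\<in>set w. fst c = s"
  shows "pres_eq R w (pw s (expo s w))"
  using assms
proof (induction w rule: rev_induct)
  case Nil
  then show ?case by (simp add: pres_eq.refl)
next
  case (snoc c w)
  then have "pres_eq R (w @ [c]) (pw s (expo s w) @ [c])" by (intro pres_eq_right) simp
  moreover have "pres_eq R (pw s (expo s w) @ [c]) (pw s (expo s (w @ [c])))"
  proof (cases "snd c")
    case True
    then have "c = (s, True)" using snoc.prems by (simp add: prod_eq_iff)
    then show ?thesis using pw_plus_1[of R s "expo s w"] by (simp add: letter_sign_def)
  next
    case False
    then have "c = (s, False)" using snoc.prems by (simp add: prod_eq_iff)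
    then show ?thesis using pw_minus_1[of R s "expo s w"] by (simp add: letter_sign_def)
  qed
  ultimately show ?case by (rule pres_eq.trans)
qed

text \<open>If the exponent sum is as large as the length, letters of opposite sign cannot both
  occur.\<close>

lemma monochrome_eq_pw:
  assumes "\<forall>c\<in>set w. fst c = s" "\<bar>expo s w\<bar> = int (length w)"
  shows "w = pw s (expo s w)"
  using assms
proof (induction w)
  case (Cons c w)
  have c: "fst c = s" using Cons.prems(1) by simp
  have len: "\<bar>expo s w\<bar> = int (length w)"
    using Cons.prems(2) abs_expo_le[of s w] c by (auto simp: letter_sign_def split: if_splits)
  then have w: "w = pw s (expo s w)" using Cons by simp
  show ?case
  proof (cases "snd c")
    case True
    then have "0 \<le> expo s w" using Cons.prems(2) abs_expo_le[of s w] c by (auto simp: letter_sign_def)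
    moreover have "c = (s, True)" using c True by (simp add: prod_eq_iff)
    moreover have "c # w = (s, True) # replicate (nat (expo s w)) (s, True)"
      using w pw_nonneg[of "expo s w" s] calculation by simp
    ultimately show ?thesis by (simp add: letter_sign_def pw_nonneg nat_add_distrib)
  next
    case False
    then have "expo s w \<le> 0" using Cons.prems(2) abs_expo_le[of s w] c by (auto simp: letter_sign_def)
    moreover have "c = (s, False)" using c False by (simp add: prod_eq_iff)
    moreover have "c # w = (s, False) # replicate (nat (- expo s w)) (s, False)"
      using w pw_nonpos[of "expo s w" s] calculation by simp
    moreover have "nat (1 - expo s w) = Suc (nat (- expo s w))" using calculation by simp
    ultimately show ?thesis by (simp add: letter_sign_def pw_nonpos)
  qed
qed simp

lemma count_list_concat_replicate: "count_list (concat (replicate n w)) x = n * count_list w x"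
  by (induction n) simp_all

lemma concat_replicate_commute: "concat (replicate n w) @ w = w @ concat (replicate n w)"
  by (induction n) simp_all

definition flat :: "(gen \<times> int) list \<Rightarrow> gen gword" where
  "flat Z = concat (map (\<lambda>(s, e). pw s e) Z)"

lemma flat_simps [simp]:
  "flat [] = []" "flat (p # Z) = pw (fst p) (snd p) @ flat Z" "flat (Z @ Z') = flat Z @ flat Z'"
  by (simp_all add: flat_def case_prod_beta)

lemma flat_concat_replicate: "flat (concat (replicate n Z)) = concat (replicate n (flat Z))"
  by (induction n) simp_all

text \<open>Begins with an x-syllable and ends with a y-syllable, so repeated copies still
  alternate: a reduced list of this form is cyclically reduced.\<close>

definition pairs :: "(int \<times> int) list \<Rightarrow> (gen \<times> int) list" where
  "pairs S = concat (map (\<lambda>(e, f). [(Ga, e), (Gb, f)]) S)"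

lemma pairs_simps [simp]:
  "pairs [] = []" "pairs (p # S) = (Ga, fst p) # (Gb, snd p) # pairs S" "pairs (S @ S') = pairs S @ pairs S'"
  by (simp_all add: pairs_def case_prod_beta)

lemma pairs_concat_replicate: "pairs (concat (replicate n S)) = concat (replicate n (pairs S))"
  by (induction n) simp_all

lemma pw_mult: "pw s (l * int n) = concat (replicate n (pw s l))"
proof -
  have rep: "concat (replicate n (replicate m x)) = replicate (n * m) x" for n m and x :: "gen \<times> bool"
    by (induction n) (simp_all add: replicate_add)
  show ?thesis
  proof (cases "0 \<le> l")
    case True
    then show ?thesis by (simp add: pw_nonneg rep nat_mult_distrib mult.commute)
  next
    case False
    have "- (l * int n) = int n * (- l)" by simp
    then have "nat (- (l * int n)) = n * nat (- l)"
      using nat_mult_distrib[of "int n" "- l"] by (simp only: nat_int of_nat_0_le_iff)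
    moreover have "l * int n \<le> 0" "l \<le> 0" using False by (simp_all add: mult_nonpos_nonneg)
    ultimately show ?thesis by (simp only: pw_nonpos rep)
  qed
qed

lemma pw_letter_sign: "pw s (letter_sign (s, d) * int n) = replicate n (s, d)"
  by (cases d) (simp_all add: letter_sign_def pw_nonneg pw_nonpos)

lemma lang_star_letter: "w \<in> lang_star {[c]} \<longleftrightarrow> w = replicate (count_list w c) c"
proof
  assume "w \<in> lang_star {[c]}"
  then show "w = replicate (count_list w c) c"
    by (induction rule: lang_star_induct) simp_all
next
  assume *: "w = replicate (count_list w c) c"
  have "replicate n c = concat (replicate n [c])" for n by (induction n) simp_all
  then show "w \<in> lang_star {[c]}" using * lang_star_replicate[of "[c]" "{[c]}"] by (metis singletonI)
qed

lemma UNIV_gen: "UNIV = {Ga, Gb}"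
  using gen.exhaust by auto

instance gen :: finite
  by standard (simp add: UNIV_gen)

text \<open>The generators \<open>x\<close> and \<open>y\<close> are encoded as \<open>Ga\<close> and \<open>Gb\<close>; \<open>b = 0\<close> stands for an element \<open>y\<close> of
  infinite order modulo the centre, in accordance with \<open>e mod 0 = e\<close> and \<open>e div 0 = 0\<close>.\<close>

locale two_gen =
  fixes a b :: int
  assumes a: "2 \<le> a" and b: "b = 0 \<or> a < b"
begin

definition modulus :: "gen \<Rightarrow> int" where
  "modulus s = (case s of Ga \<Rightarrow> a | Gb \<Rightarrow> b)"

lemma modulus_simps [simp]: "modulus Ga = a" "modulus Gb = b"
  by (simp_all add: modulus_def)

definition rels :: "(gen gword \<times> gen gword) set" where
  "rels = insert (pw Ga a @ pw Gb 1, pw Gb 1 @ pw Ga a) (if b = 0 then {} else {(pw Gb b, pw Ga a)})"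

abbreviation eqv :: "gen gword \<Rightarrow> gen gword \<Rightarrow> bool" (infix "\<approx>" 50) where
  "u \<approx> v \<equiv> pres_eq rels u v"

lemma pw_neg_eqv: "pw s e \<approx> w \<Longrightarrow> pw s (- e) @ w \<approx> []"
  using pres_eq.trans[OF pres_eq.sym[OF pres_eq_left[of rels "pw s e" w "pw s (- e)"]] pw_add[of rels s "- e" e]]
  by simp

section \<open>The central element x^a\<close>

lemma central_letter: "pw Ga a @ [c] \<approx> [c] @ pw Ga a"
proof -
  have pos: "pw Ga a @ [(s, True)] \<approx> [(s, True)] @ pw Ga a" for s
  proof (cases s)
    case Ga
    have "pw Ga a @ pw Ga 1 \<approx> pw Ga (a + 1)" by (rule pw_add)
    also have "pw Ga (a + 1) \<approx> pw Ga 1 @ pw Ga a"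
      using pres_eq.sym[OF pw_add[of rels Ga 1 a]] by (simp add: add.commute)
    finally show ?thesis using Ga by (simp add: pw_def)
  next
    case Gb
    then show ?thesis
      using pres_eq.rel[of "pw Ga a @ pw Gb 1" "pw Gb 1 @ pw Ga a" rels]
      by (simp add: rels_def pw_def)
  qed
  have "pw Ga a @ [(s, False)] \<approx> [(s, False)] @ pw Ga a" for s
    by (rule pres_eq_commute_inverse[OF pos])
      (use pres_eq.cancel[of rels s True] pres_eq.cancel[of rels s False] in simp_all)
  then show ?thesis using pos by (cases c, cases "snd c") simp_all
qed

lemma central_1: "pw Ga a @ w \<approx> w @ pw Ga a"
proof (induction w)
  case Nil
  show ?case by (simp add: pres_eq.refl)
next
  case (Cons c w)
  from pres_eq_commute_append[OF central_letter this, of c] show ?case by simp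
qed

lemma central: "pw Ga (t * a) @ w \<approx> w @ pw Ga (t * a)"
proof -
  have step: "pw Ga (t * a + d) @ w \<approx> w @ pw Ga (t * a + d)"
    if IH: "pw Ga (t * a) @ w \<approx> w @ pw Ga (t * a)" and d: "pw Ga d @ w \<approx> w @ pw Ga d" for t d
  proof -
    have "pw Ga (t * a + d) @ w \<approx> (pw Ga (t * a) @ pw Ga d) @ w"
      by (rule pres_eq_right[OF pres_eq.sym[OF pw_add]])
    also have "\<dots> \<approx> w @ pw Ga (t * a) @ pw Ga d"
      using pres_eq.sym[OF pres_eq_commute_append[OF pres_eq.sym[OF IH] pres_eq.sym[OF d]]] by simp
    also have "\<dots> \<approx> w @ pw Ga (t * a + d)" by (rule pres_eq_left[OF pw_add])
    finally show ?thesis .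
  qed
  have neg: "pw Ga (- a) @ w \<approx> w @ pw Ga (- a)"
  proof -
    have "w @ pw Ga (- a) \<approx> pw Ga (- a) @ w"
      by (rule pres_eq_commute_inverse[OF pres_eq.sym[OF central_1]])
        (use pw_add[of rels Ga a "- a"] pw_add[of rels Ga "- a" a] in simp_all)
    then show ?thesis by (rule pres_eq.sym)
  qed
  show ?thesis
  proof (induction t rule: int_induct[where k = 0])
    case base
    show ?case by (simp add: pres_eq.refl)
  next
    case (step1 t)
    then show ?case using step[OF step1(2) central_1] by (simp add: algebra_simps)
  next
    case (step2 t)
    then show ?case using step[OF step2(2) neg] by (simp add: algebra_simps)
  qed
qed

lemma pw_Gb_shift:
  assumes "b \<noteq> 0"
  shows "pw Gb (t * b) \<approx> pw Ga (t * a)"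
proof -
  have pos: "pw Gb b \<approx> pw Ga a" using assms by (intro pres_eq.rel) (simp add: rels_def)
  have neg: "pw Gb (- b) \<approx> pw Ga (- a)"
  proof -
    have "pw Gb (- b) \<approx> pw Gb (- b) @ pw Ga a @ pw Ga (- a)"
      using pres_eq_left[OF pres_eq.sym[OF pw_add[of rels Ga a "- a"]], of "pw Gb (- b)"] by simp
    also have "\<dots> \<approx> [] @ pw Ga (- a)"
      using pres_eq_right[OF pw_neg_eqv[OF pos], of "pw Ga (- a)"] by simp
    finally show ?thesis by simp
  qed
  have step: "pw Gb (t * b + d) \<approx> pw Ga (t * a + d')"
    if "pw Gb (t * b) \<approx> pw Ga (t * a)" "pw Gb d \<approx> pw Ga d'" for t d d'
  proof -
    have "pw Gb (t * b + d) \<approx> pw Gb (t * b) @ pw Gb d" by (rule pres_eq.sym[OF pw_add])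
    also have "\<dots> \<approx> pw Ga (t * a) @ pw Ga d'" using that by (rule pres_eq.append)
    also have "\<dots> \<approx> pw Ga (t * a + d')" by (rule pw_add)
    finally show ?thesis .
  qed
  show ?thesis
  proof (induction t rule: int_induct[where k = 0])
    case base
    show ?case by (simp add: pres_eq.refl)
  next
    case (step1 t)
    then show ?case using step[OF step1(2) pos] by (simp add: algebra_simps)
  next
    case (step2 t)
    then show ?case using step[OF step2(2) neg] by (simp add: algebra_simps)
  qed
qed

lemma pw_shift:
  assumes "modulus s \<noteq> 0"
  shows "pw s (e + t * modulus s) \<approx> pw Ga (t * a) @ pw s e"
proof -
  have "pw s (e + t * modulus s) \<approx> pw s (t * modulus s) @ pw s e"
    using pres_eq.sym[OF pw_add[of rels s "t * modulus s" e]] by (simp add: add.commute)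
  also have "\<dots> \<approx> pw Ga (t * a) @ pw s e"
    using assms pw_Gb_shift by (cases s) (auto intro: pres_eq_right pres_eq.refl)
  finally show ?thesis .
qed

text \<open>A full modulus of any syllable is worth x^a, which can be moved to the front from every
  position. The exchange arguments rest on this.\<close>

lemma flat_shift:
  assumes "i < length Z" "Z ! i = (s, e)" "modulus s \<noteq> 0"
  shows "flat (Z[i := (s, e + t * modulus s)]) \<approx> pw Ga (t * a) @ flat Z"
proof -
  let ?p = "flat (take i Z)" and ?q = "flat (drop (Suc i) Z)"
  have Z: "flat Z = ?p @ pw s e @ ?q"
    using arg_cong[OF id_take_nth_drop[OF assms(1)], of flat] assms(2) by simp
  have "flat (Z[i := (s, e + t * modulus s)]) = ?p @ pw s (e + t * modulus s) @ ?q"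
    by (simp add: upd_conv_take_nth_drop assms(1))
  also have "\<dots> \<approx> ?p @ (pw Ga (t * a) @ pw s e) @ ?q"
    by (rule pres_eq_mid[OF pw_shift[OF assms(3)]])
  also have "\<dots> \<approx> pw Ga (t * a) @ ?p @ pw s e @ ?q"
    using pres_eq_right[OF pres_eq.sym[OF central[of t ?p]], of "pw s e @ ?q"] by simp
  finally show ?thesis using Z by simp
qed

section \<open>Invariants from exponent sums\<close>

text \<open>The homomorphism to the integers: x and y receive b and a, so that x^a and y^b agree.
  For \<open>b = 0\<close> the exponent sum of y is recorded in full by the residue, as
  \<open>e mod 0 = e\<close>, and only x is weighted.\<close>

definition wt :: "gen gword \<Rightarrow> int" where
  "wt w = (if b = 0 then expo Ga w else b * expo Ga w + a * expo Gb w)"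

lemma wt_append [simp]: "wt (u @ v) = wt u + wt v"
  by (simp add: wt_def algebra_simps)

lemma eqv_expo:
  assumes "u \<approx> v"
  shows "modulus s dvd expo s u - expo s v" "wt u = wt v"
proof -
  have "a dvd expo Ga u - expo Ga v \<and> b dvd expo Gb u - expo Gb v \<and> wt u = wt v"
    using assms
  proof (induction rule: pres_eq.induct)
    case (sym u v)
    then show ?case by (simp add: dvd_diff_commute)
  next
    case (trans u v w)
    have "expo s u - expo s w = (expo s u - expo s v) + (expo s v - expo s w)" for s by simp
    then show ?case using trans.IH by (simp only: dvd_add)
  next
    case (append u v u' v')
    have "expo s (u @ u') - expo s (v @ v') = (expo s u - expo s v) + (expo s u' - expo s v')" for s by simp
    then show ?case using append.IH by (simp only: dvd_add wt_append)
  next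
    case (cancel s e)
    then show ?case by (simp add: wt_def letter_sign_def)
  next
    case (rel u v)
    then show ?case by (auto simp: rels_def wt_def split: if_splits)
  qed (simp add: refl)
  then show "modulus s dvd expo s u - expo s v" "wt u = wt v" by (cases s; simp)+
qed

section \<open>Normal forms in the free product of cyclic groups\<close>

definition push :: "gen \<Rightarrow> int \<Rightarrow> (gen \<times> int) list \<Rightarrow> (gen \<times> int) list" where
  "push s q st = (if q = 0 then st else (s, q) # st)"

text \<open>Stacks are the normal forms in the free product of cyclic groups, with the last syllable on top;
  \<open>syl s e\<close> multiplies a normal form by the \<open>e\<close>-th power of \<open>s\<close> on the right.\<close>

fun syl :: "gen \<Rightarrow> int \<Rightarrow> (gen \<times> int) list \<Rightarrow> (gen \<times> int) list" where
  "syl s e [] = push s (e mod modulus s) []"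
| "syl s e ((s', r) # st) = (if s' = s then push s ((r + e) mod modulus s) st
     else push s (e mod modulus s) ((s', r) # st))"

fun stack :: "(gen \<times> int) list \<Rightarrow> bool" where
  "stack [] \<longleftrightarrow> True"
| "stack ((s, r) # st) \<longleftrightarrow> r \<noteq> 0 \<and> r mod modulus s = r \<and> (st = [] \<or> fst (hd st) \<noteq> s) \<and> stack st"

lemma syl_other: "st = [] \<or> fst (hd st) \<noteq> s \<Longrightarrow> syl s e st = push s (e mod modulus s) st"
  by (cases "(s, e, st)" rule: syl.cases) auto

lemma stack_push:
  "stack st \<Longrightarrow> st = [] \<or> fst (hd st) \<noteq> s \<Longrightarrow> stack (push s (q mod modulus s) st)"
  by (simp add: push_def)

lemma stack_syl: "stack st \<Longrightarrow> stack (syl s e st)"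
proof (cases st)
  case (Cons p st')
  assume "stack st"
  then show ?thesis using Cons stack_push[of st' s] stack_push[of st s] by (cases p) auto
qed (use stack_push in simp)

lemma syl_syl:
  assumes "stack st"
  shows "syl s f (syl s e st) = syl s (e + f) st"
proof -
  have push: "syl s f (push s (q mod modulus s) st') = push s ((q + f) mod modulus s) st'"
    if "st' = [] \<or> fst (hd st') \<noteq> s" for q st'
  proof (cases "q mod modulus s = 0")
    case True
    then have "(q + f) mod modulus s = f mod modulus s" by (metis add.left_neutral mod_add_left_eq)
    then show ?thesis using True syl_other[OF that, of f] by (simp add: push_def)
  next
    case False
    then show ?thesis by (simp add: push_def mod_add_left_eq)
  qed
  show ?thesis
  proof (cases "st = [] \<or> fst (hd st) \<noteq> s")
    case True
    then show ?thesis using push[OF True] by (simp add: syl_other)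
  next
    case False
    then obtain r st' where st: "st = (s, r) # st'" by (cases st) auto
    then have "st' = [] \<or> fst (hd st') \<noteq> s" using assms by simp
    from push[OF this, of "r + e"] show ?thesis using st by (simp add: add.assoc)
  qed
qed

lemma syl_dvd:
  assumes "stack st" "modulus s dvd e"
  shows "syl s e st = st"
proof (cases "st = [] \<or> fst (hd st) \<noteq> s")
  case True
  then show ?thesis using assms(2) by (simp add: syl_other push_def)
next
  case False
  then obtain r st' where st: "st = (s, r) # st'" by (cases st) auto
  obtain k where "e = modulus s * k" using assms(2) by (auto simp: dvd_def)
  then show ?thesis using st assms(1) by (simp add: push_def)
qed

definition act :: "gen gword \<Rightarrow> (gen \<times> int) list \<Rightarrow> (gen \<times> int) list" where
  "act w st = foldl (\<lambda>st c. syl (fst c) (letter_sign c) st) st w"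

lemma act_simps [simp]:
  "act [] st = st" "act (c # w) st = act w (syl (fst c) (letter_sign c) st)" "act (u @ v) st = act v (act u st)"
  by (simp_all add: act_def)

lemma stack_act: "stack st \<Longrightarrow> stack (act w st)"
  by (induction w arbitrary: st) (simp_all add: stack_syl)

lemma act_pw:
  assumes "stack st"
  shows "act (pw s e) st = syl s e st"
proof -
  have "act (replicate n c) st = syl (fst c) (int n * letter_sign c) st" if "stack st" for n c st
    using that
  proof (induction n arbitrary: st)
    case 0
    then show ?case by (simp add: syl_dvd)
  next
    case (Suc n)
    then show ?case by (simp add: stack_syl syl_syl algebra_simps)
  qed
  from this[OF assms] show ?thesis by (simp add: pw_def letter_sign_def)
qed

text \<open>In the free product x^a and y^b are trivial, so the two sides of each defining relation
  act alike. This makes \<open>act u []\<close> an invariant of the group element without any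
  confluence argument.\<close>

lemma eqv_act:
  assumes "u \<approx> v" "stack st"
  shows "act u st = act v st"
  using assms
proof (induction arbitrary: st rule: pres_eq.induct)
  case (append u v u' v')
  then show ?case by (simp add: stack_act)
next
  case (cancel s e)
  then show ?case by (simp add: syl_syl syl_dvd letter_sign_def)
next
  case (rel u v)
  have "act (pw Ga a @ pw Gb 1) st = act (pw Gb 1 @ pw Ga a) st"
    "act (pw Gb b) st = act (pw Ga a) st"
    using rel(2) by (simp_all add: act_pw stack_syl syl_dvd)
  moreover have "u = pw Ga a @ pw Gb 1 \<and> v = pw Gb 1 @ pw Ga a \<or> u = pw Gb b \<and> v = pw Ga a"
    using rel(1) by (auto simp: rels_def split: if_splits)
  ultimately show ?case by blast
qed simp_all

text \<open>Only the top syllable is added, removed or changed.\<close>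

lemma count_syl: "\<bar>int (count_list (syl s e st) q) - int (count_list st q)\<bar> \<le> 1"
  by (cases "(s, e, st)" rule: syl.cases) (simp_all add: push_def)

lemma count_act: "\<bar>int (count_list (act w st) q) - int (count_list st q)\<bar> \<le> int (length w)"
proof (induction w arbitrary: st)
  case (Cons c w)
  show ?case using Cons[of "syl (fst c) (letter_sign c) st"] count_syl[of "fst c" "letter_sign c" st q]
    by (simp only: act_simps list.size)
qed simp

section \<open>Counting syllables in powers\<close>

fun reduced :: "(gen \<times> int) list \<Rightarrow> bool" where
  "reduced [] \<longleftrightarrow> True"
| "reduced ((s, e) # Z) \<longleftrightarrow> \<not> modulus s dvd e \<and> (Z = [] \<or> fst (hd Z) \<noteq> s) \<and> reduced Z"

lemma reduced_pairs: "reduced (pairs S) \<longleftrightarrow> (\<forall>(e, f)\<in>set S. \<not> a dvd e \<and> \<not> b dvd f)"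
proof (induction S)
  case (Cons p S)
  then show ?case by (cases S) auto
qed simp

definition residues :: "(gen \<times> int) list \<Rightarrow> (gen \<times> int) list" where
  "residues Z = map (\<lambda>(s, e). (s, e mod modulus s)) Z"

lemma residues_simps [simp]:
  "residues [] = []" "residues ((s, e) # Z) = (s, e mod modulus s) # residues Z"
  "residues (Z @ Z') = residues Z @ residues Z'"
  by (simp_all add: residues_def)

lemma residues_concat_replicate: "residues (concat (replicate n Z)) = concat (replicate n (residues Z))"
  by (induction n) simp_all

lemma act_flat_reduced:
  assumes "reduced Z" "stack st" "Z = [] \<or> st = [] \<or> fst (hd Z) \<noteq> fst (hd st)"
  shows "act (flat Z) st = rev (residues Z) @ st"
  using assms
proof (induction Z arbitrary: st rule: reduced.induct)
  case (2 s e Z)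
  have "st = [] \<or> fst (hd st) \<noteq> s" using 2(4) by auto
  then have "syl s e st = (s, e mod modulus s) # st"
    using 2(2) by (simp add: syl_other push_def mod_eq_0_iff_dvd)
  then show ?case using 2 stack_syl[OF 2(3), of s e] by (auto simp: act_pw)
qed simp

text \<open>Pushing a reduced word on an arbitrary stack only cancels a part whose size is bounded by the
  stack. Hence counting the occurrences of a fixed syllable is a quasimorphism.\<close>

lemma count_act_flat_reduced:
  assumes "reduced Z" "stack st"
  shows "\<bar>int (count_list (act (flat Z) st) q) - int (count_list (residues Z) q)\<bar> \<le> 2 * int (length st)"
  using assms
proof (induction Z arbitrary: st rule: reduced.induct)
  case 1
  then show ?case using count_le_length[of st q] by simp
next
  case (2 s e Z)
  show ?case
  proof (cases "st = [] \<or> s \<noteq> fst (hd st)")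
    case True
    then have "act (flat ((s, e) # Z)) st = rev (residues ((s, e) # Z)) @ st"
      using 2(2,3) by (intro act_flat_reduced) auto
    then show ?thesis using count_le_length[of st q] by simp
  next
    case False
    then obtain r st' where st: "st = (s, r) # st'" by (cases st) auto
    have st': "stack st'" using 2(3) st by simp
    show ?thesis
    \<comment> \<open>Either the syllable cancels the top of the stack, and the induction continues
      on a shorter stack, or cancellation ends and the rest is stacked unchanged. Each stack entry
      thus accounts for an error of at most 2: itself and the syllable that it meets.\<close>
    proof (cases "(r + e) mod modulus s = 0")
      case True
      then have "act (flat ((s, e) # Z)) st = act (flat Z) st'"
        using st 2(3) by (simp add: act_pw push_def)
      moreover have "\<bar>int (count_list (act (flat Z) st') q) - int (count_list (residues Z) q)\<bar>
          \<le> 2 * int (length st')"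
        using 2 st' by simp
      ultimately show ?thesis using st by (simp add: abs_le_iff)
    next
      case False
      let ?st = "(s, (r + e) mod modulus s) # st'"
      have "act (flat ((s, e) # Z)) st = act (flat Z) ?st"
        using st 2(3) False by (simp add: act_pw push_def)
      also have "\<dots> = rev (residues Z) @ ?st"
        using 2(2,3) st False by (intro act_flat_reduced) auto
      finally show ?thesis using st count_le_length[of st' q] by (simp add: abs_le_iff)
    qed
  qed
qed

lemma power_conj:
  assumes "v @ w \<approx> w @ u"
  shows "concat (replicate n v) @ w \<approx> w @ concat (replicate n u)"
proof (induction n)
  case 0
  show ?case by (simp add: pres_eq.refl)
next
  case (Suc n)
  have "concat (replicate (Suc n) v) @ w \<approx> v @ w @ concat (replicate n u)"
    using pres_eq_left[OF Suc, of v] by simp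
  also have "\<dots> \<approx> w @ u @ concat (replicate n u)"
    using pres_eq_right[OF assms, of "concat (replicate n u)"] by simp
  finally show ?case by simp
qed

text \<open>The counting quasimorphism evaluated on powers. Conjugation by the fixed word
  \<open>w\<close> disturbs the count by an amount independent of \<open>n\<close>, while on powers
  of the reduced word the count is exactly linear.\<close>

lemma count_powers:
  assumes red: "reduced (pairs S)" and conj: "v @ w \<approx> w @ flat (pairs S)"
  shows "\<exists>C. \<forall>n. \<bar>int (count_list (act (concat (replicate n v)) []) q)
           - int n * int (count_list (residues (pairs S)) q)\<bar> \<le> C"
proof (intro exI allI)
  fix n
  let ?v = "concat (replicate n v)" and ?Z = "pairs (concat (replicate n S))"
  have Z: "reduced ?Z" using red by (auto simp: reduced_pairs)
  have "?v @ w \<approx> w @ flat ?Z"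
    using power_conj[OF conj, of n] by (simp add: pairs_concat_replicate flat_concat_replicate)
  then have "act w (act ?v []) = act (flat ?Z) (act w [])"
    using eqv_act[of "?v @ w" "w @ flat ?Z" "[]"] by simp
  moreover have "count_list (residues ?Z) q = n * count_list (residues (pairs S)) q"
    by (simp add: pairs_concat_replicate residues_concat_replicate count_list_concat_replicate)
  \<comment> \<open>The first summand bounds the effect of \<open>w\<close> on the right, the second
    the effect of starting from the normal form of \<open>w\<close>.\<close>
  ultimately show "\<bar>int (count_list (act ?v []) q) - int n * int (count_list (residues (pairs S)) q)\<bar>
      \<le> int (length w) + 2 * int (length (act w []))"
    using count_act[of w "act ?v []" q] count_act_flat_reduced[OF Z, of "act w []" q]
      stack_act[of "[]" w] by simp
qed

subsection \<open>Conjugacy and slopes\<close>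

definition conjugate :: "gen gword \<Rightarrow> gen gword \<Rightarrow> bool" where
  "conjugate u v \<longleftrightarrow> (\<exists>w. u @ w \<approx> w @ v)"

lemma eqv_imp_conjugate: "u \<approx> v \<Longrightarrow> conjugate u v"
  unfolding conjugate_def by (rule exI[of _ "[]"]) simp

lemma conjugate_sym:
  assumes "conjugate u v"
  shows "conjugate v u"
proof -
  obtain w where w: "u @ w \<approx> w @ v" using assms by (auto simp: conjugate_def)
  have "w @ v @ inv_word w \<approx> u @ w @ inv_word w"
    using pres_eq_right[OF pres_eq.sym[OF w], of "inv_word w"] by simp
  also have "\<dots> \<approx> u @ []" by (rule pres_eq_left[OF pres_eq_inv_word_right])
  also have "u @ [] \<approx> w @ inv_word w @ u"
    using pres_eq_right[OF pres_eq.sym[OF pres_eq_inv_word_right[of rels w]], of u] by simp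
  finally have "v @ inv_word w \<approx> inv_word w @ u" by (rule pres_eq_cancel_left)
  then show ?thesis unfolding conjugate_def by blast
qed

lemma conjugate_trans [trans]:
  assumes "conjugate u v" "conjugate v w"
  shows "conjugate u w"
proof -
  obtain x y where x: "u @ x \<approx> x @ v" and y: "v @ y \<approx> y @ w" using assms by (auto simp: conjugate_def)
  have "u @ x @ y \<approx> x @ v @ y" using pres_eq_right[OF x, of y] by simp
  also have "\<dots> \<approx> x @ y @ w" by (rule pres_eq_left[OF y])
  finally show ?thesis unfolding conjugate_def by (intro exI[of _ "x @ y"]) simp
qed

lemma conjugate_append_commute: "conjugate (u @ v) (v @ u)"
  unfolding conjugate_def by (rule exI[of _ u]) (simp add: pres_eq.refl)

lemma conjugate_expo:
  assumes "conjugate u v"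
  shows "modulus s dvd expo s u - expo s v" "wt u = wt v"
proof -
  obtain w where "u @ w \<approx> w @ v" using assms by (auto simp: conjugate_def)
  from eqv_expo[OF this] show "modulus s dvd expo s u - expo s v" "wt u = wt v" by simp_all
qed

definition geo :: "gen gword \<Rightarrow> bool" where
  "geo u \<longleftrightarrow> (\<forall>v. conjugate u v \<longrightarrow> length u \<le> length v)"

lemma geo_conjugate: "geo u \<Longrightarrow> conjugate u v \<Longrightarrow> length v = length u \<Longrightarrow> geo v"
  unfolding geo_def using conjugate_trans by metis

lemma ex_geo: "\<exists>v. conjugate u v \<and> geo v"
proof -
  have "conjugate u u" by (rule eqv_imp_conjugate[OF pres_eq.refl])
  from ex_has_least_nat[of "conjugate u" u length, OF this]
  obtain v where v: "conjugate u v" "\<And>w. conjugate u w \<Longrightarrow> length v \<le> length w" by blast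
  have "geo v" unfolding geo_def using v(2) conjugate_trans[OF v(1)] by blast
  then show ?thesis using v(1) by blast
qed

section \<open>Syllable costs and optimal slopes\<close>

definition cost :: "(gen \<times> int) list \<Rightarrow> int" where
  "cost Z = (\<Sum>p\<leftarrow>Z. \<bar>snd p\<bar>)"

lemma cost_simps [simp]:
  "cost [] = 0" "cost (p # Z) = \<bar>snd p\<bar> + cost Z" "cost (Z @ Z') = cost Z + cost Z'"
  by (simp_all add: cost_def)

lemma length_flat [simp]: "int (length (flat Z)) = cost Z"
  by (induction Z) simp_all

lemma cost_update:
  assumes "i < length Z"
  shows "cost (Z[i := p]) = cost Z - \<bar>snd (Z ! i)\<bar> + \<bar>snd p\<bar>"
proof -
  have "cost Z = cost (take i Z) + \<bar>snd (Z ! i)\<bar> + cost (drop (Suc i) Z)"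
    using arg_cong[OF id_take_nth_drop[OF assms], of cost] by simp
  then show ?thesis using assms by (simp add: upd_conv_take_nth_drop)
qed

lemma geo_flat_le:
  assumes "geo (flat Z)" "flat Z \<approx> w"
  shows "cost Z \<le> int (length w)"
  using assms eqv_imp_conjugate[OF assms(2)] length_flat[of Z] unfolding geo_def by (metis zle_int)

text \<open>No exponent in the residue class of \<open>e\<close> is cheaper than \<open>e\<close> when each factor \<open>x\<^sup>a\<close> is worth \<open>l\<close>.\<close>

definition opt :: "int \<Rightarrow> int \<Rightarrow> int \<Rightarrow> bool" where
  "opt M l e \<longleftrightarrow> (\<forall>e'. e' mod M = e mod M \<longrightarrow> \<bar>e\<bar> - l * (e div M) \<le> \<bar>e'\<bar> - l * (e' div M))"

lemma opt_0 [simp]: "opt 0 l e"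
  by (simp add: opt_def)

text \<open>By convexity of the absolute value the two neighbours \<open>e + M\<close> and
  \<open>e - M\<close> decide: \<open>l\<close> has to lie between the left and the right difference
  at \<open>e\<close>.\<close>

lemma opt_iff:
  assumes M: "0 < M"
  shows "opt M l e \<longleftrightarrow> l \<le> \<bar>e + M\<bar> - \<bar>e\<bar> \<and> \<bar>e\<bar> - \<bar>e - M\<bar> \<le> l"
proof
  assume *: "opt M l e"
  have "(e + M) div M = e div M + 1" using M div_add_self2[of M e] by simp
  moreover have "(e - M) div M = e div M - 1" using M div_add_self2[of M "e - M"] by simp
  ultimately have "\<bar>e\<bar> - l * (e div M) \<le> \<bar>e + M\<bar> - l * (e div M + 1)"
    "\<bar>e\<bar> - l * (e div M) \<le> \<bar>e - M\<bar> - l * (e div M - 1)"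
    using *[unfolded opt_def, rule_format, of "e + M"] *[unfolded opt_def, rule_format, of "e - M"]
    by (simp_all only: mod_add_self2 minus_mod_self2)
  then show "l \<le> \<bar>e + M\<bar> - \<bar>e\<bar> \<and> \<bar>e\<bar> - \<bar>e - M\<bar> \<le> l"
    by (simp add: algebra_simps)
next
  assume l: "l \<le> \<bar>e + M\<bar> - \<bar>e\<bar> \<and> \<bar>e\<bar> - \<bar>e - M\<bar> \<le> l"
  \<comment> \<open>Convexity along steps \<open>d\<close>: e + d is a convex combination of e + d t
    and e, with weights 1/t and (t - 1)/t. It is applied to \<open>M\<close> and, mirrored, to
    \<open>- M\<close>.\<close>
  have up: "\<bar>e\<bar> + l * t \<le> \<bar>e + d * t\<bar>" if "l \<le> \<bar>e + d\<bar> - \<bar>e\<bar>" "1 \<le> t" for l d t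
  proof -
    have "t * (e + d) = (e + d * t) + (t - 1) * e" by (simp add: algebra_simps)
    moreover have "t * \<bar>e + d\<bar> = \<bar>t * (e + d)\<bar>" using that(2) by (simp add: abs_mult)
    ultimately have "t * \<bar>e + d\<bar> = \<bar>(e + d * t) + (t - 1) * e\<bar>" by simp
    also have "\<dots> \<le> \<bar>e + d * t\<bar> + (t - 1) * \<bar>e\<bar>"
      using abs_triangle_ineq[of "e + d * t" "(t - 1) * e"] that(2) by (simp add: abs_mult)
    finally have "t * \<bar>e + d\<bar> \<le> \<bar>e + d * t\<bar> + (t - 1) * \<bar>e\<bar>" .
    moreover have "t * l \<le> t * (\<bar>e + d\<bar> - \<bar>e\<bar>)" using that by (intro mult_left_mono) auto
    ultimately show ?thesis by (simp add: algebra_simps)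
  qed
  show "opt M l e"
    unfolding opt_def
  proof (intro allI impI)
    fix e' assume e': "e' mod M = e mod M"
    define t where "t = e' div M - e div M"
    have "M * (e' div M) + e mod M = e'" "M * (e div M) + e mod M = e"
      using mult_div_mod_eq[of M e'] mult_div_mod_eq[of M e] by (simp_all only: e')
    then have eq: "e' = e + M * t" unfolding t_def right_diff_distrib by linarith
    have "\<bar>e\<bar> + l * t \<le> \<bar>e + M * t\<bar>"
      using up[of l M t] up[of "- l" "- M" "- t"] l by (cases "t = 0"; cases "1 \<le> t") auto
    then have "\<bar>e\<bar> + l * t \<le> \<bar>e'\<bar>" by (simp only: eq)
    moreover have "l * t = l * (e' div M) - l * (e div M)" by (simp only: t_def right_diff_distrib)
    ultimately show "\<bar>e\<bar> - l * (e div M) \<le> \<bar>e'\<bar> - l * (e' div M)" by linarith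
  qed
qed

definition weight :: "gen \<Rightarrow> int" where
  "weight s = (case s of Ga \<Rightarrow> if b = 0 then 1 else b | Gb \<Rightarrow> if b = 0 then 0 else a)"

lemma wt_flat: "wt (flat Z) = (\<Sum>p\<leftarrow>Z. weight (fst p) * snd p)"
proof (induction Z)
  case Nil
  show ?case by (simp add: wt_def)
next
  case (Cons p Z)
  have "wt (pw s e) = weight s * e" for s e
    by (cases s) (simp_all add: wt_def weight_def)
  then show ?case using Cons by simp
qed

text \<open>Weak linear programming duality.\<close>

lemma opt_cost_le:
  assumes opt: "\<forall>p\<in>set Z. opt (modulus (fst p)) l (snd p)"
    and res: "mset (residues Z) = mset (residues Z')" and wt: "wt (flat Z) = wt (flat Z')"
  shows "cost Z \<le> cost Z'"
proof -
  define dv where "dv p = snd p div modulus (fst p)" for p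
  define md where "md p = (fst p, snd p mod modulus (fst p))" for p
  \<comment> \<open>\<open>Z\<close> and \<open>Z'\<close> are linked only through their residues,
    so an optimal exponent is chosen for each residue class; \<open>g\<close> is the least reduced
    cost in the class.\<close>
  define h where "h q = (SOME e. e mod modulus (fst q) = snd q \<and> opt (modulus (fst q)) l e)" for q
  define g where "g q = \<bar>h q\<bar> - l * (h q div modulus (fst q))" for q
  \<comment> \<open>This is \<open>weight s * modulus s\<close> for x and, if \<open>b\<close> is
    nonzero, also for y. If \<open>b = 0\<close>, a y-syllable contributes nothing, because its
    weight and \<open>e div 0\<close> are both 0.\<close>
  define D where "D = (if b = 0 then a else a * b)"
  have residues: "residues X = map md X" for X
    by (simp add: residues_def md_def case_prod_beta)
  have h: "h q mod modulus (fst q) = snd q" "opt (modulus (fst q)) l (h q)"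
    if "q \<in> md ` set Z" for q
  proof -
    have "\<exists>e. e mod modulus (fst q) = snd q \<and> opt (modulus (fst q)) l e"
      using that opt by (force simp: md_def)
    from someI_ex[OF this] show "h q mod modulus (fst q) = snd q" "opt (modulus (fst q)) l (h q)"
      unfolding h_def by blast+
  qed
  have le: "g (md p) \<le> \<bar>snd p\<bar> - l * dv p" if "md p \<in> md ` set Z" for p
    using h[OF that] unfolding opt_def g_def dv_def md_def by simp
  have ge: "\<bar>snd p\<bar> - l * dv p \<le> g (md p)" if "p \<in> set Z" for p
  proof -
    have "md p \<in> md ` set Z" using that by simp
    from h(1)[OF this] show ?thesis
      using opt[rule_format, OF that] unfolding opt_def g_def dv_def md_def by simp
  qed
  have sum: "(\<Sum>p\<leftarrow>Z. f (md p)) = (\<Sum>p\<leftarrow>Z'. f (md p))" for f :: "gen \<times> int \<Rightarrow> int"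
  proof -
    have "(\<Sum>q\<leftarrow>residues X. f q) = sum_mset (image_mset f (mset (residues X)))" for X
      by (simp add: sum_mset_sum_list[symmetric] del: sum_mset_sum_list)
    then show ?thesis using res by (simp add: residues o_def)
  qed
  have split: "weight s * e = D * (e div modulus s) + weight s * (e mod modulus s)" for s e
  proof -
    have "weight s * (modulus s * (e div modulus s)) = D * (e div modulus s)"
      by (cases s) (simp_all add: D_def weight_def)
    moreover have "weight s * e = weight s * (modulus s * (e div modulus s) + e mod modulus s)" by simp
    ultimately show ?thesis by (simp only: distrib_left)
  qed
  have wtX: "wt (flat X) = D * (\<Sum>p\<leftarrow>X. dv p) + (\<Sum>p\<leftarrow>X. weight (fst (md p)) * snd (md p))" for X
  proof -
    have "wt (flat X) = (\<Sum>p\<leftarrow>X. D * dv p + weight (fst (md p)) * snd (md p))"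
      unfolding wt_flat by (simp only: dv_def md_def fst_conv snd_conv split[symmetric])
    then show ?thesis by (simp add: sum_list_addf sum_list_const_mult)
  qed
  \<comment> \<open>Equal residues and equal weights force equal sums of quotients, so the total
    price paid at slope \<open>l\<close> is the same on both sides.\<close>
  have "D * (\<Sum>p\<leftarrow>Z. dv p) = D * (\<Sum>p\<leftarrow>Z'. dv p)"
    using wt wtX[of Z] wtX[of Z'] sum[of "\<lambda>q. weight (fst q) * snd q"] by simp
  moreover have "D \<noteq> 0" using a by (simp add: D_def)
  ultimately have dvs: "(\<Sum>p\<leftarrow>Z. dv p) = (\<Sum>p\<leftarrow>Z'. dv p)" by simp
  have md_set: "md ` set Z' = md ` set Z"
    using arg_cong[OF res, of set_mset] by (simp add: residues)
  have cost: "cost X = (\<Sum>p\<leftarrow>X. \<bar>snd p\<bar> - l * dv p) + l * (\<Sum>p\<leftarrow>X. dv p)" for X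
    unfolding cost_def by (induction X) (simp_all add: algebra_simps)
  have "(\<Sum>p\<leftarrow>Z. \<bar>snd p\<bar> - l * dv p) \<le> (\<Sum>p\<leftarrow>Z. g (md p))"
    using ge by (intro sum_list_mono) blast
  also have "\<dots> = (\<Sum>p\<leftarrow>Z'. g (md p))" by (rule sum)
  also have "\<dots> \<le> (\<Sum>p\<leftarrow>Z'. \<bar>snd p\<bar> - l * dv p)"
    using le md_set by (intro sum_list_mono) blast
  finally show ?thesis using cost[of Z] cost[of Z'] dvs by simp
qed

text \<open>One modulus is taken from syllable \<open>i\<close> and given to syllable
  \<open>j\<close>. This removes and restores a central x^a, so the element is unchanged and the
  cost cannot drop.\<close>

lemma geo_exchange:
  assumes geo: "geo (flat Z)" and ij: "i < length Z" "j < length Z" "i \<noteq> j"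
    and Zi: "Z ! i = (s, e)" "modulus s \<noteq> 0" and Zj: "Z ! j = (s', e')" "modulus s' \<noteq> 0"
  shows "\<bar>e\<bar> - \<bar>e - modulus s\<bar> \<le> \<bar>e' + modulus s'\<bar> - \<bar>e'\<bar>"
proof -
  let ?Z1 = "Z[i := (s, e - modulus s)]"
  let ?Z2 = "?Z1[j := (s', e' + modulus s')]"
  have "flat ?Z2 \<approx> pw Ga a @ flat ?Z1"
    using flat_shift[of j ?Z1 s' e' 1] ij Zj by simp
  also have "\<dots> \<approx> pw Ga a @ pw Ga (- a) @ flat Z"
    using pres_eq_left[OF flat_shift[OF ij(1) Zi, of "- 1"], of "pw Ga a"] by simp
  also have "\<dots> \<approx> flat Z" using pres_eq_right[OF pw_add[of rels Ga a "- a"], of "flat Z"] by simp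
  finally have "cost Z \<le> cost ?Z2" using geo_flat_le[OF geo pres_eq.sym] by fastforce
  moreover have "cost ?Z2 = cost Z - \<bar>e\<bar> + \<bar>e - modulus s\<bar> - \<bar>e'\<bar> + \<bar>e' + modulus s'\<bar>"
    using ij Zi Zj by (simp add: cost_update)
  ultimately show ?thesis by simp
qed

lemma modulus_nonneg: "0 \<le> modulus s"
  using a b by (cases s) auto

text \<open>Intervals on a line that meet pairwise have a common point; the largest left endpoint is
  one. The x-syllable has its interval inside \<open>{- a..a}\<close>, and syllables of modulus 0
  impose no condition.\<close>

lemma geo_ex_slope:
  assumes geo: "geo (flat Z)" and Ga: "(Ga, e) \<in> set Z"
  shows "\<exists>l\<in>{- a..a}. \<forall>p\<in>set Z. opt (modulus (fst p)) l (snd p)"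
proof -
  define I where "I = {i. i < length Z \<and> modulus (fst (Z ! i)) \<noteq> 0}"
  define left where "left i = \<bar>snd (Z ! i)\<bar> - \<bar>snd (Z ! i) - modulus (fst (Z ! i))\<bar>" for i
  define right where "right i = \<bar>snd (Z ! i) + modulus (fst (Z ! i))\<bar> - \<bar>snd (Z ! i)\<bar>" for i
  obtain i0 where i0: "i0 < length Z" "Z ! i0 = (Ga, e)" using Ga by (auto simp: in_set_conv_nth)
  have fin: "finite I" by (simp add: I_def)
  have i0I: "i0 \<in> I" using i0 a by (simp add: I_def)
  have lr: "left i \<le> right j" if "i \<in> I" "j \<in> I" for i j
  proof (cases "i = j")
    case True
    then show ?thesis unfolding left_def right_def by arith
  next
    case False
    then show ?thesis
      using geo_exchange[OF geo, of i j "fst (Z ! i)" "snd (Z ! i)" "fst (Z ! j)" "snd (Z ! j)"] that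
      by (simp add: I_def left_def right_def)
  qed
  define l where "l = Max (left ` I)"
  have left: "left i \<le> l" if "i \<in> I" for i
    unfolding l_def using fin that by (intro Max_ge) auto
  have "l \<in> left ` I" unfolding l_def using fin i0I by (intro Max_in) auto
  then have right: "l \<le> right i" if "i \<in> I" for i
    using lr that by auto
  have opt: "opt (modulus (fst p)) l (snd p)" if "p \<in> set Z" for p
  proof (cases "modulus (fst p) = 0")
    case False
    then have "0 < modulus (fst p)" using modulus_nonneg[of "fst p"] by simp
    moreover obtain i where "i < length Z" "Z ! i = p"
      using \<open>p \<in> set Z\<close> unfolding in_set_conv_nth by blast
    ultimately show ?thesis
      using left[of i] right[of i] by (simp add: opt_iff I_def left_def right_def)
  qed simp
  have "- a \<le> left i0" "right i0 \<le> a" using i0 a by (simp_all add: left_def right_def)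
  then have "l \<in> {- a..a}" using left[OF i0I] right[OF i0I] by simp
  then show ?thesis using opt by blast
qed

text \<open>Trading y^(t b) for x^(t a) would save letters, since \<open>a < b\<close> when
  \<open>b\<close> is nonzero.\<close>

lemma geo_no_Gb_power:
  assumes geo: "geo (flat Z)" and mem: "(Gb, f) \<in> set Z" and dvd: "b dvd f"
  shows "f = 0"
proof (rule ccontr)
  assume f: "f \<noteq> 0"
  obtain i where i: "i < length Z" "Z ! i = (Gb, f)" using mem by (auto simp: in_set_conv_nth)
  obtain t where t: "f = t * b" using dvd by (metis dvd_div_mult_self)
  have b0: "b \<noteq> 0" "t \<noteq> 0" using f t by auto
  let ?Z = "Z[i := (Gb, f + (- t) * modulus Gb)]"
  have "flat Z \<approx> pw Ga (t * a) @ pw Ga (- t * a) @ flat Z"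
    using pres_eq_right[OF pres_eq.sym[OF pw_add[of rels Ga "t * a" "- t * a"]], of "flat Z"] by simp
  also have "\<dots> \<approx> pw Ga (t * a) @ flat ?Z"
    by (rule pres_eq_left[OF pres_eq.sym[OF flat_shift[OF i]]]) (use b0 in simp)
  finally have "cost Z \<le> \<bar>t * a\<bar> + cost ?Z" using geo_flat_le[OF geo] by fastforce
  also have "cost ?Z = cost Z - \<bar>t * b\<bar>" using i t by (simp add: cost_update)
  finally have "\<bar>t\<bar> * b \<le> \<bar>t\<bar> * a" using a b b0 by (simp add: abs_mult)
  then show False using a b b0 by simp
qed

section \<open>Shapes of words up to rotation\<close>

definition mono_x :: "gen gword \<Rightarrow> bool" where
  "mono_x A \<longleftrightarrow> (\<forall>c\<in>set A. fst c = Ga)"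

lemma mono_x_simps [simp]: "mono_x []" "mono_x (c # A) \<longleftrightarrow> fst c = Ga \<and> mono_x A"
  "mono_x (A @ A') \<longleftrightarrow> mono_x A \<and> mono_x A'"
  by (auto simp: mono_x_def)

lemma mono_x_eqv: "mono_x A \<Longrightarrow> A \<approx> pw Ga (expo Ga A)"
  unfolding mono_x_def by (rule monochrome_pres_eq)

lemma expo_Gb_mono_x [simp]: "mono_x A \<Longrightarrow> expo Gb A = 0"
  by (induction A) simp_all

definition y_word :: "(gen gword \<times> bool) list \<Rightarrow> gen gword" where
  "y_word Q = concat (map (\<lambda>(A, d). A @ [(Gb, d)]) Q)"

lemma y_word_simps [simp]:
  "y_word [] = []" "y_word (p # Q) = fst p @ (Gb, snd p) # y_word Q"
  "y_word (Q @ Q') = y_word Q @ y_word Q'"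
  by (simp_all add: y_word_def case_prod_beta)

definition y_shape :: "(gen gword \<times> bool) list \<Rightarrow> bool" where
  "y_shape Q \<longleftrightarrow> (\<forall>p\<in>set Q. mono_x (fst p))"

text \<open>All x-parts are central, so such a word represents a power of y times a central
  element.\<close>

definition central_shape :: "(gen gword \<times> bool) list \<Rightarrow> bool" where
  "central_shape Q \<longleftrightarrow> (\<forall>p\<in>set Q. mono_x (fst p) \<and> a dvd expo Ga (fst p))"

lemma central_shape_simps [simp]:
  "central_shape []"
  "central_shape (p # Q) \<longleftrightarrow> mono_x (fst p) \<and> a dvd expo Ga (fst p) \<and> central_shape Q"
  "central_shape (Q @ Q') \<longleftrightarrow> central_shape Q \<and> central_shape Q'"
  by (auto simp: central_shape_def)

type_synonym block = "gen gword \<times> (gen gword \<times> bool) list"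

definition blocks_word :: "block list \<Rightarrow> gen gword" where
  "blocks_word Bs = concat (map (\<lambda>(A, Q). A @ y_word Q) Bs)"

lemma blocks_word_simps [simp]:
  "blocks_word [] = []" "blocks_word (p # Bs) = fst p @ y_word (snd p) @ blocks_word Bs"
  "blocks_word (Bs @ Bs') = blocks_word Bs @ blocks_word Bs'"
  by (simp_all add: blocks_word_def case_prod_beta)

text \<open>One x-syllable and one y-syllable modulo the centre, with central parts kept in place
  because the language has to describe the actual words. The y-exponent may still be divisible by
  \<open>b\<close>; minimality excludes this later.\<close>

definition block_shape :: "block \<Rightarrow> bool" where
  "block_shape B \<longleftrightarrow> mono_x (fst B) \<and> \<not> a dvd expo Ga (fst B) \<and> snd B \<noteq> [] \<and> central_shape (snd B)"

lemma ex_y_decomp: "\<exists>Q A. v = y_word Q @ A \<and> y_shape Q \<and> mono_x A"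
proof (induction v)
  case Nil
  show ?case by (intro exI[of _ "[]"]) (simp add: y_shape_def)
next
  case (Cons c v)
  then obtain Q A where v: "v = y_word Q @ A" "y_shape Q" "mono_x A" by blast
  show ?case
  proof (cases "fst c")
    case Gb
    then have "c # v = y_word (([], snd c) # Q) @ A" using v by (simp add: prod_eq_iff)
    moreover have "y_shape (([], snd c) # Q)" using v by (simp add: y_shape_def)
    ultimately show ?thesis using v(3) by blast
  next
    case Ga
    show ?thesis
    proof (cases Q)
      case Nil
      then have "c # v = y_word [] @ (c # A)" "mono_x (c # A)" using v Ga by simp_all
      then show ?thesis by (intro exI[of _ "[]"] exI[of _ "c # A"]) (simp add: y_shape_def)
    next
      case (Cons p Q')
      then have "c # v = y_word ((c # fst p, snd p) # Q') @ A" using v by simp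
      moreover have "y_shape ((c # fst p, snd p) # Q')" using v Cons Ga by (simp add: y_shape_def)
      ultimately show ?thesis using v(3) by blast
    qed
  qed
qed

lemma ex_block_decomp:
  "y_shape P \<Longrightarrow> \<exists>Q Bs. y_word P = y_word Q @ blocks_word Bs \<and> central_shape Q \<and> (\<forall>B\<in>set Bs. block_shape B)"
proof (induction P)
  case Nil
  show ?case by (intro exI[of _ "[]"]) simp
next
  case (Cons p P)
  then obtain Q Bs where IH: "y_word P = y_word Q @ blocks_word Bs" "central_shape Q" "\<forall>B\<in>set Bs. block_shape B"
    by (auto simp: y_shape_def)
  have p: "mono_x (fst p)" using Cons.prems by (simp add: y_shape_def)
  show ?case
  proof (cases "a dvd expo Ga (fst p)")
    case True
    have "y_word (p # P) = y_word (p # Q) @ blocks_word Bs" "central_shape (p # Q)"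
      using IH True p by simp_all
    then show ?thesis using IH(3) by blast
  next
    case False
    let ?B = "(fst p, ([], snd p) # Q)"
    have "y_word (p # P) = y_word [] @ blocks_word (?B # Bs)" "block_shape ?B"
      using IH False p by (simp_all add: block_shape_def)
    then show ?thesis using IH(3) central_shape_simps(1) by (metis set_ConsD)
  qed
qed

text \<open>A trailing x-part is rotated to the front. Then an initial stretch with central x-parts
  is rotated to the end, where the last block absorbs it. Left over are words without y and words
  without a noncentral x-part.\<close>

lemma ex_shape:
  obtains n where "mono_x (rotate n v)"
  | n Q where "rotate n v = y_word Q" "central_shape Q"
  | n Bs where "rotate n v = blocks_word Bs" "Bs \<noteq> []" "\<forall>B\<in>set Bs. block_shape B"
proof -
  obtain P A where P: "v = y_word P @ A" "y_shape P" "mono_x A" using ex_y_decomp by blast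
  show thesis
  proof (cases P)
    case Nil
    then have "mono_x (rotate 0 v)" using P by simp
    then show thesis by (rule that(1))
  next
    case (Cons p P')
    let ?P = "(A @ fst p, snd p) # P'"
    have rot: "rotate (length (y_word P)) v = y_word ?P"
      using P(1) Cons rotate_append[of "y_word P" A] by simp
    have "y_shape ?P" using P Cons by (simp add: y_shape_def)
    then obtain Q Bs where Q: "y_word ?P = y_word Q @ blocks_word Bs" "central_shape Q" "\<forall>B\<in>set Bs. block_shape B"
      using ex_block_decomp by blast
    show thesis
    proof (cases Bs rule: rev_cases)
      case Nil
      then show thesis using that(2)[of "length (y_word P)" Q] rot Q by simp
    next
      case (snoc Bs' B)
      let ?Bs = "Bs' @ [(fst B, snd B @ Q)]"
      have "rotate (length (y_word Q)) (y_word ?P) = blocks_word Bs @ y_word Q"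
        unfolding Q(1) by (rule rotate_append)
      also have "\<dots> = blocks_word ?Bs" using snoc by simp
      finally have "rotate (length (y_word Q) + length (y_word P)) v = blocks_word ?Bs"
        using rot by (simp only: rotate_rotate[symmetric])
      moreover have "\<forall>B\<in>set ?Bs. block_shape B"
        using Q(2,3) snoc by (simp add: block_shape_def)
      ultimately show thesis using that(3) by blast
    qed
  qed
qed

lemma conjugate_rotate: "conjugate v (rotate n v)"
proof -
  have "rotate n v = drop (n mod length v) v @ take (n mod length v) v" by (rule rotate_drop_take)
  then show ?thesis
    using conjugate_append_commute[of "take (n mod length v) v" "drop (n mod length v) v"] by simp
qed

lemma y_word_eqv:
  assumes "central_shape Q"
  shows "y_word Q \<approx> pw Ga (expo Ga (y_word Q)) @ pw Gb (expo Gb (y_word Q))" "a dvd expo Ga (y_word Q)"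
proof -
  have "y_word Q \<approx> pw Ga (expo Ga (y_word Q)) @ pw Gb (expo Gb (y_word Q)) \<and> a dvd expo Ga (y_word Q)"
    using assms
  proof (induction Q)
    case Nil
    show ?case by (simp add: pres_eq.refl)
  next
    case (Cons p Q)
    let ?t = "expo Ga (fst p)" and ?T = "expo Ga (y_word Q)" and ?F = "expo Gb (y_word Q)"
    let ?d = "letter_sign (Gb, snd p)"
    have IH: "y_word Q \<approx> pw Ga ?T @ pw Gb ?F" "a dvd ?T" using Cons by auto
    have p: "mono_x (fst p)" "a dvd ?t" using Cons.prems by simp_all
    obtain k where k: "?T = k * a" using IH(2) by (metis dvd_div_mult_self)
    have d: "[(Gb, snd p)] = pw Gb ?d" by (simp add: pw_def letter_sign_def)
    have "y_word (p # Q) \<approx> fst p @ pw Gb ?d @ pw Ga ?T @ pw Gb ?F"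
      using pres_eq_left[OF pres_eq_left[OF IH(1), of "pw Gb ?d"], of "fst p"]
      by (simp add: d[symmetric])
    also have "\<dots> \<approx> pw Ga ?t @ pw Gb ?d @ pw Ga ?T @ pw Gb ?F"
      by (rule pres_eq_right[OF mono_x_eqv[OF p(1)]])
    also have "\<dots> \<approx> pw Ga ?t @ (pw Ga ?T @ pw Gb ?d) @ pw Gb ?F"
      using pres_eq_mid[OF pres_eq.sym[OF central[of k "pw Gb ?d"]]] k by simp
    also have "\<dots> \<approx> pw Ga (?t + ?T) @ pw Gb ?d @ pw Gb ?F"
      using pres_eq_right[OF pw_add[of rels Ga ?t ?T], of "pw Gb ?d @ pw Gb ?F"] by simp
    also have "\<dots> \<approx> pw Ga (?t + ?T) @ pw Gb (?d + ?F)"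
      by (rule pres_eq_left[OF pw_add])
    finally show ?case using p IH(2) by simp
  qed
  then show "y_word Q \<approx> pw Ga (expo Ga (y_word Q)) @ pw Gb (expo Gb (y_word Q))" "a dvd expo Ga (y_word Q)"
    by simp_all
qed

definition block_exps :: "block list \<Rightarrow> (int \<times> int) list" where
  "block_exps Bs = map (\<lambda>B. (expo Ga (fst B), expo Gb (y_word (snd B)))) Bs"

definition block_T :: "block list \<Rightarrow> int" where
  "block_T Bs = (\<Sum>B\<leftarrow>Bs. expo Ga (y_word (snd B)))"

lemma block_exps_simps [simp]:
  "block_exps [] = []"
  "block_exps (B # Bs) = (expo Ga (fst B), expo Gb (y_word (snd B))) # block_exps Bs"
  "block_T [] = 0" "block_T (B # Bs) = expo Ga (y_word (snd B)) + block_T Bs"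
  by (simp_all add: block_exps_def block_T_def)

lemma blocks_word_eqv:
  assumes "\<forall>B\<in>set Bs. block_shape B"
  shows "blocks_word Bs \<approx> pw Ga (block_T Bs) @ flat (pairs (block_exps Bs))" "a dvd block_T Bs"
proof -
  have "blocks_word Bs \<approx> pw Ga (block_T Bs) @ flat (pairs (block_exps Bs)) \<and> a dvd block_T Bs"
    using assms
  proof (induction Bs)
    case Nil
    show ?case by (simp add: pres_eq.refl)
  next
    case (Cons B Bs)
    let ?e = "pw Ga (expo Ga (fst B))" and ?t = "expo Ga (y_word (snd B))"
      and ?F = "pw Gb (expo Gb (y_word (snd B)))" and ?T = "block_T Bs"
      and ?X = "flat (pairs (block_exps Bs))"
    have IH: "blocks_word Bs \<approx> pw Ga ?T @ ?X" "a dvd ?T" using Cons by auto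
    have B: "mono_x (fst B)" "central_shape (snd B)" using Cons.prems by (simp_all add: block_shape_def)
    obtain k where k: "?T = k * a" using IH(2) by (metis dvd_div_mult_self)
    obtain j where j: "?t = j * a" using y_word_eqv(2)[OF B(2)] by (metis dvd_div_mult_self)
    have "blocks_word (B # Bs) \<approx> ?e @ (pw Ga ?t @ ?F) @ pw Ga ?T @ ?X"
      using pres_eq.append[OF mono_x_eqv[OF B(1)] pres_eq.append[OF y_word_eqv(1)[OF B(2)] IH(1)]] by simp
    also have "\<dots> \<approx> pw Ga ?T @ (?e @ pw Ga ?t @ ?F) @ ?X"
      using pres_eq_right[OF pres_eq.sym[OF central[of k "?e @ pw Ga ?t @ ?F"]], of ?X] k by simp
    also have "\<dots> \<approx> pw Ga ?T @ (pw Ga ?t @ ?e) @ ?F @ ?X"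
      using pres_eq_mid[OF pres_eq.sym[OF central[of j ?e]], of "pw Ga ?T" "?F @ ?X"] j by simp
    also have "\<dots> \<approx> pw Ga (?t + ?T) @ ?e @ ?F @ ?X"
      using pres_eq_right[OF pw_add[of rels Ga ?T ?t], of "?e @ ?F @ ?X"] by (simp add: add.commute)
    finally show ?case using IH(2) y_word_eqv(2)[OF B(2)] by simp
  qed
  then show "blocks_word Bs \<approx> pw Ga (block_T Bs) @ flat (pairs (block_exps Bs))" "a dvd block_T Bs"
    by simp_all
qed

subsection \<open>The language of conjugacy geodesics\<close>

text \<open>For \<open>\<bar>l\<bar> = a\<close> the central block \<open>pw Ga l\<close> may be interspersed in a \<open>y\<close>-syllable.\<close>

definition lang_U :: "int \<Rightarrow> bool \<Rightarrow> gen gword set" where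
  "lang_U l d = insert [(Gb, d)] (if \<bar>l\<bar> = a then {pw Ga l} else {})"

definition lang_Y :: "int \<Rightarrow> (int \<Rightarrow> bool) \<Rightarrow> gen gword set" where
  "lang_Y l P = (\<Union>d. {w \<in> lang_star (lang_U l d). P (letter_sign (Gb, d) * int (count_list w (Gb, d)))})"

definition lang_pw :: "gen \<Rightarrow> (int \<Rightarrow> bool) \<Rightarrow> gen gword set" where
  "lang_pw s P = {pw s e | e. P e}"

definition ess :: "int \<Rightarrow> int \<Rightarrow> int \<Rightarrow> bool" where
  "ess M l e \<longleftrightarrow> opt M l e \<and> \<not> M dvd e"

definition lang_B :: "int \<Rightarrow> gen gword set" where
  "lang_B l = lang_star (lang_conc (lang_pw Ga (ess a l)) (lang_Y l (ess b l)))"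

text \<open>The middle family uses \<open>opt\<close> because its y-exponent may be divisible by
  \<open>b\<close>; the block words use \<open>ess\<close>, which makes their syllable lists
  cyclically reduced.\<close>

definition geo_lang :: "gen gword set" where
  "geo_lang = lang_rot (lang_pw Ga (\<lambda>_. True) \<union> (\<Union>l\<in>{- a..a}. lang_Y l (opt b l) \<union> lang_B l))"

text \<open>All letters y have sign \<open>d\<close> and all central blocks are copies of
  \<open>pw Ga l\<close>, so nothing cancels and the length is the sum of the two absolute
  exponents.\<close>

lemma lang_star_UD:
  assumes "w \<in> lang_star (lang_U l d)"
  shows "expo Gb w = letter_sign (Gb, d) * int (count_list w (Gb, d))"
    and "w \<approx> pw Ga (expo Ga w) @ pw Gb (expo Gb w)"
    and "\<exists>n. expo Ga w = l * int n \<and> (n \<noteq> 0 \<longrightarrow> \<bar>l\<bar> = a)"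
    and "int (length w) = \<bar>expo Ga w\<bar> + \<bar>expo Gb w\<bar>"
proof -
  \<comment> \<open>The induction carries the number \<open>n\<close> of central blocks, since |l| n
    is additive, unlike the absolute value of an exponent sum.\<close>
  have "expo Gb w = letter_sign (Gb, d) * int (count_list w (Gb, d)) \<and> w \<approx> pw Ga (expo Ga w) @ pw Gb (expo Gb w) \<and>
    (\<exists>n. expo Ga w = l * int n \<and> (n \<noteq> 0 \<longrightarrow> \<bar>l\<bar> = a) \<and>
      int (length w) = \<bar>l\<bar> * int n + int (count_list w (Gb, d)))"
    using assms
  proof (induction rule: lang_star_induct)
    case Nil
    show ?case by (auto intro: pres_eq.refl)
  next
    case (append u v)
    then obtain n where n: "expo Ga v = l * int n" "n \<noteq> 0 \<longrightarrow> \<bar>l\<bar> = a"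
      "int (length v) = \<bar>l\<bar> * int n + int (count_list v (Gb, d))" by blast
    have v: "v \<approx> pw Ga (expo Ga v) @ pw Gb (expo Gb v)" "expo Gb v = letter_sign (Gb, d) * int (count_list v (Gb, d))"
      using append by blast+
    show ?case
    proof (cases "u = [(Gb, d)]")
      case True
      have "a dvd expo Ga v" using n(1,2) by (cases "n = 0") auto
      then obtain k where k: "expo Ga v = k * a" by (metis dvd_div_mult_self)
      have d: "u = pw Gb (letter_sign (Gb, d))" using True by (simp add: pw_def letter_sign_def)
      have "u @ v \<approx> pw Gb (letter_sign (Gb, d)) @ pw Ga (expo Ga v) @ pw Gb (expo Gb v)"
        unfolding d by (rule pres_eq_left[OF v(1)])
      also have "\<dots> \<approx> pw Ga (expo Ga v) @ pw Gb (letter_sign (Gb, d)) @ pw Gb (expo Gb v)"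
        using pres_eq_right[OF pres_eq.sym[OF central[of k "pw Gb (letter_sign (Gb, d))"]], of "pw Gb (expo Gb v)"] k
        by simp
      also have "\<dots> \<approx> pw Ga (expo Ga v) @ pw Gb (letter_sign (Gb, d) + expo Gb v)"
        by (rule pres_eq_left[OF pw_add])
      finally have "u @ v \<approx> pw Ga (expo Ga (u @ v)) @ pw Gb (expo Gb (u @ v))" using True by simp
      then show ?thesis using True n v(2) by (auto simp: algebra_simps intro!: exI[of _ n])
    next
      case False
      then have u: "u = pw Ga l" "\<bar>l\<bar> = a"
        using append(1) by (auto simp: lang_U_def split: if_splits)
      have "u @ v \<approx> pw Ga l @ pw Ga (expo Ga v) @ pw Gb (expo Gb v)"
        unfolding u(1) by (rule pres_eq_left[OF v(1)])
      also have "\<dots> \<approx> pw Ga (l + expo Ga v) @ pw Gb (expo Gb v)"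
        using pres_eq_right[OF pw_add[of rels Ga l "expo Ga v"], of "pw Gb (expo Gb v)"] by simp
      finally have "u @ v \<approx> pw Ga (expo Ga (u @ v)) @ pw Gb (expo Gb (u @ v))" using u by simp
      moreover have "count_list u (Gb, d) = 0" using u by (simp add: pw_def)
      ultimately show ?thesis using u n v(2) by (auto simp: algebra_simps intro!: exI[of _ "Suc n"])
    qed
  qed
  then show "expo Gb w = letter_sign (Gb, d) * int (count_list w (Gb, d))"
    "w \<approx> pw Ga (expo Ga w) @ pw Gb (expo Gb w)"
    "\<exists>n. expo Ga w = l * int n \<and> (n \<noteq> 0 \<longrightarrow> \<bar>l\<bar> = a)"
    "int (length w) = \<bar>expo Ga w\<bar> + \<bar>expo Gb w\<bar>"
    by (auto simp: letter_sign_def abs_mult)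
qed

text \<open>Conversely, a length equal to the sum of the absolute exponents rules out cancellation:
  the letters y share the sign \<open>d\<close> and the central parts the sign
  \<open>\<sigma>\<close>, so each central part is a repetition of \<open>pw Ga l\<close>.\<close>

lemma y_word_in_lang_star:
  assumes "central_shape Q" "\<bar>expo Ga (y_word Q)\<bar> + \<bar>expo Gb (y_word Q)\<bar> = int (length (y_word Q))"
    and "\<sigma> = 1 \<or> \<sigma> = - 1" "\<sigma> * expo Ga (y_word Q) = \<bar>expo Ga (y_word Q)\<bar>"
    and "letter_sign (Gb, d) * expo Gb (y_word Q) = \<bar>expo Gb (y_word Q)\<bar>"
    and "expo Ga (y_word Q) \<noteq> 0 \<Longrightarrow> l = \<sigma> * a"
  shows "y_word Q \<in> lang_star (lang_U l d)"
  using assms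
proof (induction Q)
  case Nil
  show ?case by (simp add: lang_star_Nil)
next
  case (Cons p Q)
  let ?t = "expo Ga (fst p)" and ?T = "expo Ga (y_word Q)" and ?F = "expo Gb (y_word Q)"
  let ?e = "letter_sign (Gb, snd p)"
  have p: "mono_x (fst p)" "a dvd ?t" "central_shape Q" using Cons.prems(1) by simp_all
  have e: "\<bar>?e\<bar> = 1" by (simp add: letter_sign_def)
  have exs: "expo Ga (y_word (p # Q)) = ?t + ?T" "expo Gb (y_word (p # Q)) = ?e + ?F"
    "int (length (y_word (p # Q))) = int (length (fst p)) + 1 + int (length (y_word Q))"
    using p by simp_all
  note le = abs_expo_le[of Ga "fst p"] abs_expo_add_le[of "y_word Q"]
  have tight: "\<bar>?t\<bar> = int (length (fst p))" "\<bar>?T\<bar> + \<bar>?F\<bar> = int (length (y_word Q))"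
    "\<bar>?t + ?T\<bar> = \<bar>?t\<bar> + \<bar>?T\<bar>" "\<bar>?e + ?F\<bar> = 1 + \<bar>?F\<bar>"
  proof -
    \<comment> \<open>Equality in a sum of estimates forces equality in each of them.\<close>
    have *: "t = A \<and> T + F = L \<and> p = t + T \<and> q = 1 + F"
      if "p \<le> t + T" "q \<le> e + F" "p + q = A + 1 + L" "t \<le> A" "T + F \<le> L" "e = 1"
      for t T F A L p q e :: int
      using that by linarith
    from *[OF abs_triangle_ineq abs_triangle_ineq Cons.prems(2)[unfolded exs] le e]
    show "\<bar>?t\<bar> = int (length (fst p))" "\<bar>?T\<bar> + \<bar>?F\<bar> = int (length (y_word Q))"
      "\<bar>?t + ?T\<bar> = \<bar>?t\<bar> + \<bar>?T\<bar>" "\<bar>?e + ?F\<bar> = 1 + \<bar>?F\<bar>"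
      by simp_all
  qed
  have sgn: "s * x = \<bar>x\<bar> \<and> s * y = \<bar>y\<bar>"
    if s: "s = 1 \<or> s = - 1" "s * (x + y) = \<bar>x + y\<bar>" "\<bar>x + y\<bar> = \<bar>x\<bar> + \<bar>y\<bar>" for s x y :: int
    using s(1)
  proof
    assume 1: "s = 1"
    show ?thesis using s(2,3) unfolding 1 abs_if by (auto split: if_splits)
  next
    assume 1: "s = - 1"
    show ?thesis using s(2,3) unfolding 1 abs_if by (auto split: if_splits)
  qed
  have sT: "\<sigma> * ?t = \<bar>?t\<bar>" "\<sigma> * ?T = \<bar>?T\<bar>"
    using sgn[OF Cons.prems(3) Cons.prems(4)[unfolded exs] tight(3)] by simp_all
  have "letter_sign (Gb, d) = 1 \<or> letter_sign (Gb, d) = - 1" by (simp add: letter_sign_def)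
  from sgn[OF this Cons.prems(5)[unfolded exs]]
  have sd: "letter_sign (Gb, d) * ?e = \<bar>?e\<bar>" and sF: "letter_sign (Gb, d) * ?F = \<bar>?F\<bar>" using tight(4) e by simp_all
  then have dp: "snd p = d" by (auto simp: letter_sign_def split: if_splits)
  have l: "l = \<sigma> * a" if "?t \<noteq> 0 \<or> ?T \<noteq> 0"
  proof -
    have "?t + ?T \<noteq> 0" using that tight(3) by arith
    then show ?thesis using Cons.prems(6) unfolding exs by blast
  qed
  have "y_word Q \<in> lang_star (lang_U l d)"
    using Cons.IH[OF p(3) tight(2) Cons.prems(3) sT(2) sF] l by blast
  moreover have "[(Gb, d)] \<in> lang_star (lang_U l d)"
    by (rule lang_star_incl) (simp add: lang_U_def)
  moreover have "fst p \<in> lang_star (lang_U l d)"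
  proof (cases "?t = 0")
    case True
    then show ?thesis using tight(1) by (simp add: lang_star_Nil)
  next
    case False
    have A: "fst p = pw Ga ?t" using p(1) tight(1) unfolding mono_x_def by (intro monochrome_eq_pw)
    obtain k where k: "?t = a * k" using p(2) by (auto simp: dvd_def)
    have la: "l = \<sigma> * a" "\<bar>l\<bar> = a" using l False a Cons.prems(3) by auto
    have "0 \<le> \<sigma> * k"
    proof -
      have "a * (\<sigma> * k) = \<bar>?t\<bar>" using sT(1) k by (simp add: mult.left_commute)
      then have "0 \<le> a * (\<sigma> * k)" by simp
      then show ?thesis using a by (simp add: zero_le_mult_iff)
    qed
    then have "?t = l * int (nat (\<sigma> * k))" using k la Cons.prems(3) by auto
    then have "fst p = concat (replicate (nat (\<sigma> * k)) (pw Ga l))"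
      using A pw_mult[of Ga l "nat (\<sigma> * k)"] by simp
    then show ?thesis using la by (simp add: lang_star_replicate lang_U_def)
  qed
  ultimately show ?case
    using lang_star_append[of "fst p" _ "[(Gb, d)] @ y_word Q"] lang_star_append[of "[(Gb, d)]" _ "y_word Q"] dp
    by simp
qed

text \<open>At slope a the optimal exponents are the nonnegative ones, at slope -a the nonpositive
  ones, so adding multiples of \<open>l\<close> keeps optimality and never cancels.\<close>

lemma opt_shift:
  assumes "opt a l e" "\<bar>l\<bar> = a"
  shows "opt a l (e + l * int n)" "\<bar>e + l * int n\<bar> = \<bar>e\<bar> + \<bar>l * int n\<bar>"
proof -
  have a0: "0 < a" using a by simp
  consider "l = a" | "l = - a" using assms(2) by linarith
  then have "opt a l (e + l * int n) \<and> \<bar>e + l * int n\<bar> = \<bar>e\<bar> + \<bar>l * int n\<bar>"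
  proof cases
    case 1
    have "0 \<le> e" using assms(1) 1 a0 unfolding opt_iff[OF a0] by linarith
    moreover have "0 \<le> l * int n" using 1 a0 by simp
    ultimately show ?thesis using 1 a0 unfolding opt_iff[OF a0] by linarith
  next
    case 2
    have "e \<le> 0" using assms(1) 2 a0 unfolding opt_iff[OF a0] by linarith
    moreover have "l * int n \<le> 0" using 2 a0 by (simp add: mult_nonpos_nonneg)
    ultimately show ?thesis using 2 a0 unfolding opt_iff[OF a0] by linarith
  qed
  then show "opt a l (e + l * int n)" "\<bar>e + l * int n\<bar> = \<bar>e\<bar> + \<bar>l * int n\<bar>" by auto
qed

text \<open>\<open>e + T\<close> lies at distance at least \<open>a\<close> from 0 on the side of
  \<open>T\<close>. There both differences are \<open>sgn T * a\<close>, which leaves one possible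
  slope; \<open>e\<close> is 0 or on the same side.\<close>

lemma opt_unshift:
  assumes "opt a l (e + T)" "a dvd T" "T \<noteq> 0" "\<bar>e + T\<bar> = \<bar>e\<bar> + \<bar>T\<bar>"
  shows "l = sgn T * a" "opt a l e"
proof -
  have a0: "0 < a" using a by simp
  have "a \<le> \<bar>T\<bar>" using assms(2,3) by (simp add: dvd_imp_le_int a0 zdvd_imp_le)
  then have "l = sgn T * a \<and> opt a l e"
    using assms(1,3,4) a0 unfolding opt_iff[OF a0]
    by (cases "0 < T"; simp add: sgn_if; linarith)
  then show "l = sgn T * a" "opt a l e" by auto
qed

lemma opt_0_residue: "\<bar>l\<bar> \<le> a \<Longrightarrow> opt a l 0"
  using a by (simp add: opt_iff abs_le_iff)

section \<open>Residues as conjugacy invariants\<close>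

text \<open>The image in the free product lies in one cyclic factor, so the normal forms of all
  powers have at most one syllable.\<close>

definition slim :: "gen \<Rightarrow> gen gword \<Rightarrow> bool" where
  "slim s v \<longleftrightarrow> (\<exists>e. \<forall>st. stack st \<longrightarrow> act v st = syl s e st)"

lemma slim_power:
  assumes "slim s v"
  shows "length (act (concat (replicate n v)) []) \<le> 1"
proof -
  obtain e where e: "act v st = syl s e st" if "stack st" for st using assms unfolding slim_def by blast
  have "act (concat (replicate n v)) st = syl s (int n * e) st" if "stack st" for n st
    using that
  proof (induction n arbitrary: st)
    case 0
    then show ?case by (simp add: syl_dvd)
  next
    case (Suc n)
    have "act (concat (replicate (Suc n) v)) st = act (concat (replicate n v)) (syl s e st)"
      using e[OF Suc.prems] by simp
    also have "\<dots> = syl s (e + int n * e) st"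
      by (simp only: Suc.IH[OF stack_syl[OF Suc.prems]] syl_syl[OF Suc.prems])
    finally show ?case by (simp only: of_nat_Suc distrib_right mult_1)
  qed
  from this[of "[]" n] show ?thesis by (simp add: push_def)
qed

lemma slim_mono_x: "mono_x v \<Longrightarrow> slim Ga v"
  unfolding slim_def by (rule exI[of _ "expo Ga v"]) (simp add: eqv_act[OF mono_x_eqv] act_pw)

lemma slim_central:
  assumes "v \<approx> pw Ga T @ pw Gb F" "a dvd T"
  shows "slim Gb v"
  unfolding slim_def
  by (rule exI[of _ F]) (simp add: eqv_act[OF assms(1)] assms(2) act_pw syl_dvd)

lemma linear_bounded:
  fixes x C :: int
  assumes "\<And>n :: nat. int n * x \<le> C"
  shows "x \<le> 0"
proof (rule ccontr)
  assume "\<not> x \<le> 0"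
  then have "int (nat (\<bar>C\<bar> + 1)) * 1 \<le> int (nat (\<bar>C\<bar> + 1)) * x" by (intro mult_left_mono) auto
  also have "\<dots> \<le> C" by (rule assms)
  finally show False by simp
qed

text \<open>The residue of the first x-syllable of \<open>S\<close> would be counted at most once in
  every power of \<open>v\<close>, although conjugacy makes this count grow linearly.\<close>

lemma not_conj_slim:
  assumes "reduced (pairs S)" "S \<noteq> []" "slim s v"
  shows "\<not> conjugate v (flat (pairs S))"
proof
  assume "conjugate v (flat (pairs S))"
  then obtain w where w: "v @ w \<approx> w @ flat (pairs S)" by (auto simp: conjugate_def)
  obtain p S' where S: "S = p # S'" using assms(2) by (cases S) auto
  define q where "q = (Ga, fst p mod a)"
  obtain C where C: "\<And>n. \<bar>int (count_list (act (concat (replicate n v)) []) q)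
      - int n * int (count_list (residues (pairs S)) q)\<bar> \<le> C"
    using count_powers[OF assms(1) w, of q] by blast
  have "int n * int (count_list (residues (pairs S)) q) \<le> C + 1" for n
  proof -
    have "count_list (act (concat (replicate n v)) []) q \<le> 1"
      using slim_power[OF assms(3), of n] count_le_length[of "act (concat (replicate n v)) []" q] by simp
    then show ?thesis using C[of n] by linarith
  qed
  then have "int (count_list (residues (pairs S)) q) \<le> 0" by (rule linear_bounded)
  moreover have "0 < count_list (residues (pairs S)) q" by (simp add: S q_def)
  ultimately show False by simp
qed

text \<open>On n-th powers both counts are n times the number of occurrences and they differ by a
  bounded amount, so the numbers agree.\<close>

lemma conjugate_residues:
  assumes "reduced (pairs S)" "reduced (pairs S')" "conjugate (flat (pairs S')) (flat (pairs S))"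
  shows "mset (residues (pairs S)) = mset (residues (pairs S'))"
proof (rule multiset_eqI)
  fix q
  obtain w where w: "flat (pairs S') @ w \<approx> w @ flat (pairs S)" using assms(3) by (auto simp: conjugate_def)
  let ?c = "int (count_list (residues (pairs S)) q)" and ?c' = "int (count_list (residues (pairs S')) q)"
  obtain C where C: "\<And>n. \<bar>int (count_list (act (concat (replicate n (flat (pairs S')))) []) q) - int n * ?c\<bar> \<le> C"
    using count_powers[OF assms(1) w, of q] by blast
  have "\<bar>int n * ?c' - int n * ?c\<bar> \<le> C" for n
  proof -
    let ?Z = "pairs (concat (replicate n S'))"
    have "reduced ?Z" using assms(2) by (auto simp: reduced_pairs)
    then have "act (flat ?Z) [] = rev (residues ?Z) @ []" by (intro act_flat_reduced) simp_all
    then have "count_list (act (concat (replicate n (flat (pairs S')))) []) q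
        = n * count_list (residues (pairs S')) q"
      by (simp add: pairs_concat_replicate flat_concat_replicate residues_concat_replicate
          count_list_concat_replicate)
    then show ?thesis using C[of n] by simp
  qed
  then have "int n * (?c' - ?c) \<le> C" "int n * (?c - ?c') \<le> C" for n
    by (simp_all add: right_diff_distrib abs_le_iff)
  then have "?c' - ?c \<le> 0" "?c - ?c' \<le> 0" by (blast intro: linear_bounded)+
  then show "count (mset (residues (pairs S))) q = count (mset (residues (pairs S'))) q"
    by (simp add: count_mset)
qed

lemma mult_dvd: "n \<noteq> 0 \<longrightarrow> \<bar>l\<bar> = a \<Longrightarrow> a dvd l * int n"
  by (cases "n = 0") auto

section \<open>Block words and their syllables\<close>

lemma lang_B_eqv:
  assumes "w \<in> lang_B l"
  shows "\<exists>n S. w \<approx> pw Ga (l * int n) @ flat (pairs S) \<and> (n \<noteq> 0 \<longrightarrow> \<bar>l\<bar> = a) \<and>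
    int (length w) = \<bar>l * int n\<bar> + cost (pairs S) \<and> (S = [] \<longrightarrow> w = []) \<and>
    (\<forall>p\<in>set (pairs S). ess (modulus (fst p)) l (snd p))"
  using assms unfolding lang_B_def
proof (induction rule: lang_star_induct)
  case Nil
  show ?case by (intro exI[of _ 0] exI[of _ "[]"]) (simp add: pres_eq.refl)
next
  case (append u v)
  then obtain n S where v: "v \<approx> pw Ga (l * int n) @ flat (pairs S)" "n \<noteq> 0 \<longrightarrow> \<bar>l\<bar> = a"
    "int (length v) = \<bar>l * int n\<bar> + cost (pairs S)"
    "\<forall>p\<in>set (pairs S). ess (modulus (fst p)) l (snd p)" by blast
  obtain e y d where u: "u = pw Ga e @ y" "ess a l e" "y \<in> lang_star (lang_U l d)"
    "ess b l (letter_sign (Gb, d) * int (count_list y (Gb, d)))"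
    using append(1) by (auto simp: lang_conc_def lang_pw_def lang_Y_def)
  note y = lang_star_UD[OF u(3)]
  let ?f = "expo Gb y"
  obtain m where m: "expo Ga y = l * int m" "m \<noteq> 0 \<longrightarrow> \<bar>l\<bar> = a" using y(3) by blast
  obtain j where j: "l * int n = j * a" using mult_dvd[OF v(2)] by (metis dvd_div_mult_self)
  obtain k where k: "l * int m = k * a" using mult_dvd[OF m(2)] by (metis dvd_div_mult_self)
  let ?X = "flat (pairs S)"
  have sum: "l * int m + l * int n = l * int (m + n)" by (simp add: distrib_left)
  have "u @ v \<approx> pw Ga e @ (pw Ga (l * int m) @ pw Gb ?f) @ pw Ga (l * int n) @ ?X"
    using pres_eq_left[OF pres_eq.append[OF y(2) v(1)], of "pw Ga e"] u(1) m(1) by simp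
  also have "\<dots> \<approx> (pw Ga (l * int m) @ pw Ga e) @ pw Gb ?f @ pw Ga (l * int n) @ ?X"
    using pres_eq_right[OF pres_eq.sym[OF central[of k "pw Ga e"]], of "pw Gb ?f @ pw Ga (l * int n) @ ?X"] k
    by simp
  also have "\<dots> \<approx> pw Ga (l * int m) @ (pw Ga (l * int n) @ pw Ga e @ pw Gb ?f) @ ?X"
    using pres_eq_mid[OF pres_eq.sym[OF central[of j "pw Ga e @ pw Gb ?f"]], of "pw Ga (l * int m)" ?X] j
    by simp
  also have "\<dots> \<approx> pw Ga (l * int (m + n)) @ flat (pairs ((e, ?f) # S))"
    using pres_eq_right[OF pw_add[of rels Ga "l * int m" "l * int n"], of "pw Ga e @ pw Gb ?f @ ?X"] sum
    by simp
  finally have "u @ v \<approx> pw Ga (l * int (m + n)) @ flat (pairs ((e, ?f) # S))" .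
  moreover have "int (length (u @ v)) = \<bar>l * int (m + n)\<bar> + cost (pairs ((e, ?f) # S))"
  proof -
    have "\<bar>l * int m + l * int n\<bar> = \<bar>l\<bar> * int m + \<bar>l\<bar> * int n"
      by (simp only: sum abs_mult abs_of_nat) (simp add: distrib_left)
    then show ?thesis using v(3) u(1) y(4) m(1) by (simp add: abs_mult distrib_left)
  qed
  moreover have "ess b l ?f" using u(4) y(1) by simp
  ultimately show ?case using u(2) v(2,4) m(2)
    by (intro exI[of _ "m + n"] exI[of _ "(e, ?f) # S"]) auto
qed

text \<open>The collected central power is merged into the first x-syllable. If it is nontrivial
  then |l| = a, and merging preserves both optimality and length.\<close>

lemma lang_B_slope_form:
  assumes "w \<in> lang_B l" "w \<noteq> []"
  shows "\<exists>S. w \<approx> flat (pairs S) \<and> S \<noteq> [] \<and> cost (pairs S) = int (length w) \<and>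
    (\<forall>p\<in>set (pairs S). ess (modulus (fst p)) l (snd p))"
proof -
  obtain n S where w: "w \<approx> pw Ga (l * int n) @ flat (pairs S)" "n \<noteq> 0 \<longrightarrow> \<bar>l\<bar> = a"
    "int (length w) = \<bar>l * int n\<bar> + cost (pairs S)" "S \<noteq> []"
    "\<forall>p\<in>set (pairs S). ess (modulus (fst p)) l (snd p)"
    using lang_B_eqv[OF assms(1)] assms(2) by blast
  obtain e f S' where S: "S = (e, f) # S'" using w(4) by (cases S) auto
  let ?S = "(e + l * int n, f) # S'"
  have e: "ess a l e" using w(5) S by simp
  have shift: "ess a l (e + l * int n)" "\<bar>e + l * int n\<bar> = \<bar>e\<bar> + \<bar>l * int n\<bar>"
    using opt_shift[of l e n] mult_dvd[OF w(2)] w(2) e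
    by (cases "n = 0"; simp add: ess_def dvd_add_left_iff)+
  have "w \<approx> flat (pairs ?S)"
    using pres_eq.trans[OF w(1)] pres_eq_right[OF pw_add[of rels Ga "l * int n" e], of "pw Gb f @ flat (pairs S')"] S
    by (simp add: add.commute)
  then show ?thesis using w(3,5) S shift by (intro exI[of _ ?S]) auto
qed

section \<open>Geodesics belong to the language\<close>

definition block_cost :: "block list \<Rightarrow> int" where
  "block_cost Bs = (\<Sum>B\<leftarrow>Bs. \<bar>expo Ga (y_word (snd B))\<bar>)"

lemma block_cost_simps [simp]:
  "block_cost [] = 0" "block_cost (B # Bs) = \<bar>expo Ga (y_word (snd B))\<bar> + block_cost Bs"
  by (simp_all add: block_cost_def)

lemma length_blocks_word_ge:
  "cost (pairs (block_exps Bs)) + block_cost Bs \<le> int (length (blocks_word Bs))"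
proof (induction Bs)
  case (Cons B Bs)
  then show ?case using abs_expo_le[of Ga "fst B"] abs_expo_add_le[of "y_word (snd B)"] by simp
qed simp

lemma blocks_tight:
  assumes "int (length (blocks_word Bs)) \<le> cost (pairs (block_exps Bs)) + block_cost Bs" "B \<in> set Bs"
  shows "\<bar>expo Ga (fst B)\<bar> = int (length (fst B))"
    and "\<bar>expo Ga (y_word (snd B))\<bar> + \<bar>expo Gb (y_word (snd B))\<bar> = int (length (y_word (snd B)))"
proof -
  have "\<bar>expo Ga (fst B)\<bar> = int (length (fst B)) \<and>
    \<bar>expo Ga (y_word (snd B))\<bar> + \<bar>expo Gb (y_word (snd B))\<bar> = int (length (y_word (snd B)))"
    using assms
  proof (induction Bs)
    case (Cons C Bs)
    note le = length_blocks_word_ge[of Bs] abs_expo_le[of Ga "fst C"] abs_expo_add_le[of "y_word (snd C)"]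
    have prem: "int (length (fst C)) + int (length (y_word (snd C))) + int (length (blocks_word Bs))
        \<le> \<bar>expo Ga (fst C)\<bar> + \<bar>expo Gb (y_word (snd C))\<bar> + cost (pairs (block_exps Bs))
          + (\<bar>expo Ga (y_word (snd C))\<bar> + block_cost Bs)"
      using Cons.prems(1) by simp
    have arith: "p = A \<and> q + r = L \<and> M \<le> c + d"
      if "c + d \<le> M" "p \<le> A" "q + r \<le> L" "A + L + M \<le> p + r + c + (q + d)" for p q r A L M c d :: int
      using that by linarith
    from arith[OF le prem] show ?case using Cons.IH Cons.prems(2) by auto
  qed simp
  then show "\<bar>expo Ga (fst B)\<bar> = int (length (fst B))"
    "\<bar>expo Ga (y_word (snd B))\<bar> + \<bar>expo Gb (y_word (snd B))\<bar> = int (length (y_word (snd B)))"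
    by auto
qed

lemma abs_block_T_le: "\<bar>block_T Bs\<bar> \<le> block_cost Bs"
  unfolding block_T_def block_cost_def
  by (induction Bs) (auto intro: order_trans[OF abs_triangle_ineq])

lemma block_T_sign:
  assumes "\<sigma> * block_T Bs = block_cost Bs" "\<bar>\<sigma>\<bar> = 1" "B \<in> set Bs"
  shows "\<sigma> * expo Ga (y_word (snd B)) = \<bar>expo Ga (y_word (snd B))\<bar>"
  using assms
proof (induction Bs)
  case (Cons C Bs)
  let ?t = "expo Ga (y_word (snd C))"
  have le: "\<sigma> * x \<le> \<bar>x\<bar>" for x
    using abs_ge_self[of "\<sigma> * x"] Cons.prems(2) by (simp add: abs_mult)
  have "\<sigma> * ?t + \<sigma> * block_T Bs = \<bar>?t\<bar> + block_cost Bs"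
    using Cons.prems(1) by (simp add: distrib_left)
  moreover have "\<sigma> * ?t \<le> \<bar>?t\<bar>" by (rule le)
  moreover have "\<sigma> * block_T Bs \<le> block_cost Bs"
    using le[of "block_T Bs"] abs_block_T_le[of Bs] by (rule order_trans)
  ultimately have "\<sigma> * ?t = \<bar>?t\<bar>" "\<sigma> * block_T Bs = block_cost Bs" by simp_all
  then show ?case using Cons.IH Cons.prems(2,3) by auto
qed simp

lemma y_word_length_gt: "Q \<noteq> [] \<Longrightarrow> \<bar>expo Ga (y_word Q)\<bar> < int (length (y_word Q))"
proof (cases Q)
  case (Cons p Q')
  have "\<bar>expo Ga (y_word Q)\<bar> \<le> \<bar>expo Ga (fst p)\<bar> + \<bar>expo Ga (y_word Q')\<bar>"
    using Cons abs_triangle_ineq[of "expo Ga (fst p)" "expo Ga (y_word Q')"] by simp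
  then show ?thesis using Cons abs_expo_le[of Ga "fst p"] abs_expo_le[of Ga "y_word Q'"] by simp
qed simp

lemma ex_sign: "\<exists>d. letter_sign (s, d) * x = \<bar>x\<bar>"
  by (rule exI[of _ "0 \<le> x"]) (simp add: letter_sign_def)

text \<open>Merging all central parts into the first x-syllable does not lengthen the word, so
  minimality turns every estimate on the way into an equality. The merged word is then geodesic and
  has a slope \<open>l\<close>. Nontrivial central parts all have the sign \<open>\<sigma>\<close>
  and force \<open>l = \<sigma> * a\<close>, just as \<open>lang_B\<close> permits.\<close>

lemma geo_blocks:
  assumes geo: "geo (blocks_word Bs)" and Bs: "Bs \<noteq> []" "\<forall>B\<in>set Bs. block_shape B"
  obtains l S where "l \<in> {- a..a}" "blocks_word Bs \<in> lang_B l" "reduced (pairs S)" "S \<noteq> []"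
    "blocks_word Bs \<approx> flat (pairs S)" "cost (pairs S) = int (length (blocks_word Bs))"
proof -
  obtain B Bs' where BBs: "Bs = B # Bs'" using Bs(1) by (cases Bs) auto
  define T where "T = block_T Bs"
  define e where "e = expo Ga (fst B)"
  define S where "S = (e + T, expo Gb (y_word (snd B))) # block_exps Bs'"
  have exps: "block_exps Bs = (e, expo Gb (y_word (snd B))) # block_exps Bs'" by (simp add: BBs e_def)
  have dvdT: "a dvd T" using blocks_word_eqv(2)[OF Bs(2)] by (simp add: T_def)
  have eqv: "blocks_word Bs \<approx> flat (pairs S)"
  proof -
    have "blocks_word Bs \<approx> pw Ga T @ flat (pairs (block_exps Bs))"
      using blocks_word_eqv(1)[OF Bs(2)] by (simp add: T_def)
    also have "\<dots> \<approx> flat (pairs S)"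
      using pres_eq_right[OF pw_add[of rels Ga T e], of "pw Gb (expo Gb (y_word (snd B))) @ flat (pairs (block_exps Bs'))"]
      by (simp add: exps S_def add.commute)
    finally show ?thesis .
  qed
  have le: "int (length (blocks_word Bs)) \<le> cost (pairs S)"
    using geo eqv_imp_conjugate[OF eqv] length_flat[of "pairs S"] unfolding geo_def by (metis zle_int)
  have cost: "cost (pairs (block_exps Bs)) = \<bar>e\<bar> + (\<bar>expo Gb (y_word (snd B))\<bar> + cost (pairs (block_exps Bs')))"
    "cost (pairs S) = \<bar>e + T\<bar> + (\<bar>expo Gb (y_word (snd B))\<bar> + cost (pairs (block_exps Bs')))"
    by (simp_all add: exps S_def)
  have arith: "c = L \<and> L \<le> c' + M \<and> \<bar>e + T\<bar> = \<bar>e\<bar> + \<bar>T\<bar> \<and> M = \<bar>T\<bar>"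
    if "c' + M \<le> L" "L \<le> c" "\<bar>T\<bar> \<le> M" "c' = \<bar>e\<bar> + r" "c = \<bar>e + T\<bar> + r" "\<bar>e + T\<bar> \<le> \<bar>e\<bar> + \<bar>T\<bar>"
    for c c' L M r :: int
    using that by linarith
  have t: "cost (pairs S) = int (length (blocks_word Bs))"
    "int (length (blocks_word Bs)) \<le> cost (pairs (block_exps Bs)) + block_cost Bs"
    "\<bar>e + T\<bar> = \<bar>e\<bar> + \<bar>T\<bar>" "block_cost Bs = \<bar>T\<bar>"
    using arith[OF length_blocks_word_ge le abs_block_T_le[of Bs, folded T_def] cost abs_triangle_ineq]
    by simp_all
  have "int (length (flat (pairs S))) = int (length (blocks_word Bs))" by (simp only: length_flat t(1))
  then have "length (flat (pairs S)) = length (blocks_word Bs)" by (simp only: of_nat_eq_iff)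
  then have geoS: "geo (flat (pairs S))" using geo_conjugate[OF geo eqv_imp_conjugate[OF eqv]] by blast
  obtain l where l: "l \<in> {- a..a}" "\<forall>p\<in>set (pairs S). opt (modulus (fst p)) l (snd p)"
    using geo_ex_slope[OF geoS, of "e + T"] by (auto simp: S_def)
  define \<sigma> where "\<sigma> = (if 0 \<le> T then 1 else - 1 :: int)"
  have \<sigma>: "\<sigma> = 1 \<or> \<sigma> = - 1" "\<bar>\<sigma>\<bar> = 1" "\<sigma> * T = \<bar>T\<bar>" by (auto simp: \<sigma>_def)
  have optT: "opt a l (e + T)" using l(2) by (simp add: S_def)
  have lT: "l = \<sigma> * a" if "T \<noteq> 0"
    using opt_unshift(1)[OF optT dvdT that t(3)] that by (auto simp: \<sigma>_def sgn_if)
  have opt_e: "opt a l e"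
    using opt_unshift(2)[OF optT dvdT _ t(3)] optT by (cases "T = 0") simp_all
  \<comment> \<open>In \<open>S\<close> the first exponent is \<open>e + T\<close> instead of
    \<open>e\<close>; optimality of \<open>e\<close> itself is supplied by
    \<open>opt_e\<close>.\<close>
  have exps_S: "expo Ga (fst C) = e \<and> C = B \<or> (Ga, expo Ga (fst C)) \<in> set (pairs S)"
    "(Gb, expo Gb (y_word (snd C))) \<in> set (pairs S)" if "C \<in> set Bs" for C
  proof -
    have "(Ga, expo Ga (fst C)) \<in> set (pairs (block_exps Xs)) \<and> (Gb, expo Gb (y_word (snd C))) \<in> set (pairs (block_exps Xs))"
      if "C \<in> set Xs" for Xs using that by (induction Xs) auto
    then show "expo Ga (fst C) = e \<and> C = B \<or> (Ga, expo Ga (fst C)) \<in> set (pairs S)"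
      "(Gb, expo Gb (y_word (snd C))) \<in> set (pairs S)"
      using that by (auto simp: BBs S_def e_def)
  qed
  have essA: "ess a l (expo Ga (fst C))" if "C \<in> set Bs" for C
    using exps_S(1)[OF that] l(2) opt_e Bs(2) that unfolding ess_def block_shape_def by force
  have essB: "ess b l (expo Gb (y_word (snd C)))" if "C \<in> set Bs" for C
  proof -
    \<comment> \<open>A divisible exponent would be 0 by minimality, and tightness would then leave
      no letter y, but a block contains one.\<close>
    have "\<not> b dvd expo Gb (y_word (snd C))"
    proof
      assume "b dvd expo Gb (y_word (snd C))"
      then have "expo Gb (y_word (snd C)) = 0" using geo_no_Gb_power[OF geoS exps_S(2)[OF that]] by blast
      moreover have "snd C \<noteq> []" using Bs(2) that by (simp add: block_shape_def)
      ultimately show False using blocks_tight(2)[OF t(2) that] y_word_length_gt[of "snd C"] by simp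
    qed
    moreover have "opt b l (expo Gb (y_word (snd C)))" using l(2) exps_S(2)[OF that] by fastforce
    ultimately show ?thesis by (simp add: ess_def)
  qed
  have in_lang: "fst C @ y_word (snd C) \<in> lang_conc (lang_pw Ga (ess a l)) (lang_Y l (ess b l))"
    if C: "C \<in> set Bs" for C
  proof -
    have shape: "mono_x (fst C)" "central_shape (snd C)" using Bs(2) C by (simp_all add: block_shape_def)
    have "fst C = pw Ga (expo Ga (fst C))"
      using shape(1) blocks_tight(1)[OF t(2) C] unfolding mono_x_def by (rule monochrome_eq_pw)
    then have "fst C \<in> lang_pw Ga (ess a l)" using essA[OF C] unfolding lang_pw_def by blast
    moreover have "y_word (snd C) \<in> lang_Y l (ess b l)"
    proof -
      obtain d where d: "letter_sign (Gb, d) * expo Gb (y_word (snd C)) = \<bar>expo Gb (y_word (snd C))\<bar>"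
        using ex_sign[of Gb "expo Gb (y_word (snd C))"] by blast
      have sT: "\<sigma> * expo Ga (y_word (snd C)) = \<bar>expo Ga (y_word (snd C))\<bar>"
        using block_T_sign[OF _ \<sigma>(2) C] \<sigma>(3) t(4) by (simp add: T_def)
      have "l = \<sigma> * a" if "expo Ga (y_word (snd C)) \<noteq> 0"
      proof (rule lT)
        have "\<bar>expo Ga (y_word (snd C))\<bar> \<le> block_cost Bs"
          unfolding block_cost_def using C by (intro member_le_sum_list) auto
        then show "T \<noteq> 0" using that t(4) by auto
      qed
      then have "y_word (snd C) \<in> lang_star (lang_U l d)"
        by (rule y_word_in_lang_star[OF shape(2) blocks_tight(2)[OF t(2) C] \<sigma>(1) sT d])
      then show ?thesis using essB[OF C] lang_star_UD(1) unfolding lang_Y_def by fastforce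
    qed
    ultimately show ?thesis unfolding lang_conc_def by blast
  qed
  have "blocks_word Bs \<in> lang_B l"
    unfolding lang_B_def lang_star_def
  proof (rule image_eqI)
    show "blocks_word Bs = concat (map (\<lambda>C. fst C @ y_word (snd C)) Bs)"
      by (simp add: blocks_word_def case_prod_unfold)
    show "map (\<lambda>C. fst C @ y_word (snd C)) Bs
        \<in> lists (lang_conc (lang_pw Ga (ess a l)) (lang_Y l (ess b l)))"
      by (simp add: in_lists_conv_set in_lang)
  qed
  moreover have "reduced (pairs S)"
  proof -
    have "reduced (pairs (block_exps Bs))"
      using essA essB by (auto simp: reduced_pairs block_exps_def ess_def)
    then show ?thesis using dvdT by (simp add: exps S_def reduced_pairs dvd_add_left_iff)
  qed
  moreover have "S \<noteq> []" by (simp add: S_def)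
  ultimately show thesis using that[OF l(1)] eqv t(1) by blast
qed

lemma geo_in_lang:
  assumes "geo v"
  shows "v \<in> geo_lang"
proof -
  let ?L = "lang_pw Ga (\<lambda>_. True) \<union> (\<Union>l\<in>{- a..a}. lang_Y l (opt b l) \<union> lang_B l)"
  have rot: "v \<in> geo_lang" if "rotate n v \<in> ?L" for n
  proof -
    let ?k = "n mod length v"
    have "drop ?k v @ take ?k v \<in> ?L" using that by (simp only: rotate_drop_take)
    then show ?thesis unfolding geo_lang_def lang_rot_def
      by (intro CollectI exI[of _ "take ?k v"] exI[of _ "drop ?k v"]) simp
  qed
  have geo: "geo (rotate n v)" for n by (rule geo_conjugate[OF assms conjugate_rotate]) simp
  show ?thesis
  proof (rule ex_shape[of v])
    fix n assume A: "mono_x (rotate n v)"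
    let ?A = "rotate n v"
    have "length ?A \<le> length (pw Ga (expo Ga ?A))"
      using geo[of n] eqv_imp_conjugate[OF mono_x_eqv[OF A]] unfolding geo_def by blast
    then have "\<bar>expo Ga ?A\<bar> = int (length ?A)" using abs_expo_le[of Ga ?A] by simp
    then have "?A = pw Ga (expo Ga ?A)" using A unfolding mono_x_def by (intro monochrome_eq_pw)
    then have "?A \<in> lang_pw Ga (\<lambda>_. True)" unfolding lang_pw_def by blast
    then have "?A \<in> ?L" by blast
    then show ?thesis by (rule rot)
  next
    fix n Q assume Q: "rotate n v = y_word Q" "central_shape Q"
    let ?T = "expo Ga (y_word Q)" and ?F = "expo Gb (y_word Q)"
    \<comment> \<open>The central part counts as an x-syllable even if its exponent is 0, so that a
      slope in \<open>{- a..a}\<close> exists.\<close>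
    let ?Z = "[(Ga, ?T), (Gb, ?F)]"
    have geoQ: "geo (y_word Q)" using geo[of n] Q(1) by simp
    have eqv: "y_word Q \<approx> flat ?Z" using y_word_eqv(1)[OF Q(2)] by simp
    have "length (y_word Q) \<le> length (flat ?Z)" using geoQ eqv_imp_conjugate[OF eqv] unfolding geo_def by blast
    then have len: "\<bar>?T\<bar> + \<bar>?F\<bar> = int (length (y_word Q))" using abs_expo_add_le[of "y_word Q"] by simp
    then have "length (flat ?Z) = length (y_word Q)" by simp
    then have "geo (flat ?Z)" by (rule geo_conjugate[OF geoQ eqv_imp_conjugate[OF eqv]])
    then obtain l where l: "l \<in> {- a..a}" "opt a l ?T" "opt b l ?F"
      using geo_ex_slope[of ?Z ?T] by auto
    define \<sigma> where "\<sigma> = (if 0 \<le> ?T then 1 else - 1 :: int)"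
    have \<sigma>: "\<sigma> = 1 \<or> \<sigma> = - 1" "\<sigma> * ?T = \<bar>?T\<bar>" by (auto simp: \<sigma>_def)
    have "l = \<sigma> * a" if "?T \<noteq> 0"
      using opt_unshift(1)[of l 0 ?T] l(2) y_word_eqv(2)[OF Q(2)] that by (auto simp: \<sigma>_def sgn_if)
    moreover obtain d where d: "letter_sign (Gb, d) * ?F = \<bar>?F\<bar>" using ex_sign[of Gb ?F] by blast
    ultimately have "y_word Q \<in> lang_star (lang_U l d)"
      by (intro y_word_in_lang_star[OF Q(2) len \<sigma>(1) \<sigma>(2) d])
    then have "y_word Q \<in> lang_Y l (opt b l)"
      using l(3) lang_star_UD(1) unfolding lang_Y_def by fastforce
    then have "rotate n v \<in> ?L" using l(1) unfolding Q(1) by blast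
    then show ?thesis by (rule rot)
  next
    fix n Bs assume Bs: "rotate n v = blocks_word Bs" "Bs \<noteq> []" "\<forall>B\<in>set Bs. block_shape B"
    have "geo (blocks_word Bs)" using geo[of n] Bs(1) by simp
    then obtain l where "l \<in> {- a..a}" "blocks_word Bs \<in> lang_B l"
      by (rule geo_blocks[OF _ Bs(2,3)]) blast
    then have "rotate n v \<in> ?L" unfolding Bs(1) by blast
    then show ?thesis by (rule rot)
  qed
qed

text \<open>The weighted exponent sum \<open>wt\<close> charges at most \<open>weight Ga\<close> per letter, with equality for powers
  of \<open>x\<close>.\<close>

lemma geo_pw_Ga: "geo (pw Ga e)"
  unfolding geo_def
proof (intro allI impI)
  fix v assume "conjugate (pw Ga e) v"
  then have wt: "wt (pw Ga e) = wt v" by (rule conjugate_expo(2))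
  have "\<bar>e\<bar> \<le> int (length v)"
  proof (cases "b = 0")
    case True
    then have "e = expo Ga v" using wt unfolding wt_def if_P[OF True] by simp
    then show ?thesis using abs_expo_le[of Ga v] by simp
  next
    case False
    then have b0: "0 < b" "a \<le> b" using a b by auto
    have "b * e = b * expo Ga v + a * expo Gb v" using wt False by (simp add: wt_def)
    moreover have "b * \<bar>e\<bar> = \<bar>b * e\<bar>" using b0 by (simp add: abs_mult)
    ultimately have "b * \<bar>e\<bar> = \<bar>b * expo Ga v + a * expo Gb v\<bar>" by simp
    also have "\<dots> \<le> b * \<bar>expo Ga v\<bar> + a * \<bar>expo Gb v\<bar>"
      using abs_triangle_ineq[of "b * expo Ga v" "a * expo Gb v"] b0 a by (simp add: abs_mult)
    also have "\<dots> \<le> b * \<bar>expo Ga v\<bar> + b * \<bar>expo Gb v\<bar>" 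
      using b0 by (intro add_left_mono mult_right_mono) simp_all
    also have "\<dots> = b * (\<bar>expo Ga v\<bar> + \<bar>expo Gb v\<bar>)" by (simp add: distrib_left)
    also have "\<dots> \<le> b * int (length v)" using b0 abs_expo_add_le[of v] by (intro mult_left_mono) auto
    finally show ?thesis using b0 by simp
  qed
  then show "length (pw Ga e) \<le> length v" by simp
qed

section \<open>Words of the language are geodesic\<close>

text \<open>Geodesics of the class suffice for comparison, and for them the block form yields a
  reduced syllable list, which an arbitrary conjugate need not have.\<close>

lemma geoI:
  assumes "\<And>v. conjugate u v \<Longrightarrow> geo v \<Longrightarrow> length u \<le> length v"
  shows "geo u"
proof -
  obtain v where v: "conjugate u v" "geo v" using ex_geo by blast
  have "length u \<le> length w" if "conjugate u w" for w
    using assms[OF v] v(2) conjugate_trans[OF conjugate_sym[OF v(1)] that] unfolding geo_def by (blast intro: le_trans)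
  then show ?thesis by (simp add: geo_def)
qed

text \<open>A geodesic of the class is rotated into one of the three shapes. The first two are slim
  and hence excluded; in the third its residues and weight agree with those of \<open>w\<close>, and
  duality applies.\<close>

lemma geo_lang_B:
  assumes w: "w \<in> lang_B l"
  shows "geo w"
proof (cases "w = []")
  case True
  then show ?thesis by (simp add: geo_def)
next
  case False
  obtain S where S: "w \<approx> flat (pairs S)" "S \<noteq> []" "cost (pairs S) = int (length w)"
    "\<forall>p\<in>set (pairs S). ess (modulus (fst p)) l (snd p)"
    using lang_B_slope_form[OF w False] by blast
  have red: "reduced (pairs S)"
  proof -
    have "\<not> a dvd e \<and> \<not> b dvd f" if "(e, f) \<in> set S" for e f
    proof -
      have "(Ga, e) \<in> set (pairs S)" "(Gb, f) \<in> set (pairs S)" using that by (induction S) auto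
      then show ?thesis using S(4) by (force simp: ess_def)
    qed
    then show ?thesis by (auto simp: reduced_pairs)
  qed
  have opt: "\<forall>p\<in>set (pairs S). opt (modulus (fst p)) l (snd p)" using S(4) by (simp add: ess_def)
  show ?thesis
  proof (rule geoI)
    fix v assume wv: "conjugate w v" and v: "geo v"
    have S_v: "conjugate (rotate n v) (flat (pairs S))" for n
      using conjugate_trans[OF conjugate_sym[OF conjugate_trans[OF wv conjugate_rotate]] eqv_imp_conjugate[OF S(1)]] .
    have geo: "geo (rotate n v)" for n by (rule geo_conjugate[OF v conjugate_rotate]) simp
    show "length w \<le> length v"
    proof (rule ex_shape[of v])
      fix n assume "mono_x (rotate n v)"
      then show ?thesis using not_conj_slim[OF red S(2) slim_mono_x] S_v by blast
    next
      fix n Q assume "rotate n v = y_word Q" "central_shape Q"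
      then show ?thesis using not_conj_slim[OF red S(2) slim_central[OF y_word_eqv]] S_v[of n] by simp
    next
      fix n Bs assume Bs: "rotate n v = blocks_word Bs" "Bs \<noteq> []" "\<forall>B\<in>set Bs. block_shape B"
      have "geo (blocks_word Bs)" using geo[of n] Bs(1) by simp
      then obtain S' where S': "reduced (pairs S')" "blocks_word Bs \<approx> flat (pairs S')"
        "cost (pairs S') = int (length (blocks_word Bs))"
        by (rule geo_blocks[OF _ Bs(2,3)]) blast
      have conjugate: "conjugate (flat (pairs S')) (flat (pairs S))"
        using conjugate_trans[OF conjugate_sym[OF eqv_imp_conjugate[OF S'(2)]] S_v[of n, unfolded Bs(1)]] .
      have "cost (pairs S) \<le> cost (pairs S')"
        by (rule opt_cost_le[OF opt conjugate_residues[OF red S'(1) conjugate] conjugate_expo(2)[OF conjugate_sym[OF conjugate]]])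
      then have "length w \<le> length (blocks_word Bs)" using S(3) S'(3) by simp
      then show ?thesis using arg_cong[OF Bs(1), of length] by simp
    qed
  qed
qed

lemma geo_lang_Y:
  assumes w: "w \<in> lang_Y l (opt b l)" and l: "l \<in> {- a..a}"
  shows "geo w"
proof -
  obtain d where d: "w \<in> lang_star (lang_U l d)" "opt b l (letter_sign (Gb, d) * int (count_list w (Gb, d)))"
    using w by (auto simp: lang_Y_def)
  note wd = lang_star_UD[OF d(1)]
  let ?T = "expo Ga w" and ?F = "expo Gb w"
  let ?Z = "[(Ga, ?T), (Gb, ?F)]"
  obtain n where n: "?T = l * int n" "n \<noteq> 0 \<longrightarrow> \<bar>l\<bar> = a" using wd(3) by blast
  have dvd: "a dvd ?T" using mult_dvd[OF n(2)] n(1) by simp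
  have "opt a l ?T"
    using opt_shift(1)[OF opt_0_residue, of l n] n l by (cases "n = 0") (auto intro: opt_0_residue)
  then have opt: "\<forall>p\<in>set ?Z. opt (modulus (fst p)) l (snd p)" using d(2) wd(1) by simp
  have cost: "cost ?Z = int (length w)" using wd(4) by simp
  have eqv: "w \<approx> flat ?Z" using wd(2) by simp
  show ?thesis
  proof (rule geoI)
    fix v assume wv: "conjugate w v" and v: "geo v"
    have w_v: "conjugate w (rotate n v)" for n by (rule conjugate_trans[OF wv conjugate_rotate])
    have geo: "geo (rotate n v)" for n by (rule geo_conjugate[OF v conjugate_rotate]) simp
    \<comment> \<open>Covers the powers of x and the words with central x-parts: for a product x^i
      y^j the exponent sums already determine the residues.\<close>
    have le: "length w \<le> length v"
      if u: "u \<approx> pw Ga (expo Ga u) @ pw Gb (expo Gb u)" "conjugate w u" "length u = length v" for u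
    proof -
      let ?Z' = "[(Ga, expo Ga u), (Gb, expo Gb u)]"
      have "expo s w mod modulus s = expo s u mod modulus s" for s
        using conjugate_expo(1)[OF u(2)] by (simp add: mod_eq_dvd_iff)
      from this[of Ga] this[of Gb] have res: "residues ?Z = residues ?Z'" by simp
      have "conjugate (flat ?Z) (flat ?Z')"
        using conjugate_trans[OF conjugate_sym[OF eqv_imp_conjugate[OF eqv]] conjugate_trans[OF u(2) eqv_imp_conjugate[OF u(1)]]] by simp
      then have "cost ?Z \<le> cost ?Z'"
        using opt_cost_le[OF opt arg_cong[OF res, of mset] conjugate_expo(2)] by blast
      then show ?thesis using cost abs_expo_add_le[of u] u(3) by simp
    qed
    show "length w \<le> length v"
    proof (rule ex_shape[of v])
      fix n assume A: "mono_x (rotate n v)"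
      show ?thesis
        by (rule le[of "rotate n v"]) (use A mono_x_eqv[OF A] w_v in simp_all)
    next
      fix n Q assume Q: "rotate n v = y_word Q" "central_shape Q"
      have "length (y_word Q) = length v" using arg_cong[OF Q(1), of length] by simp
      then show ?thesis by (rule le[OF y_word_eqv(1)[OF Q(2)] w_v[of n, unfolded Q(1)]])
    next
      fix n Bs assume Bs: "rotate n v = blocks_word Bs" "Bs \<noteq> []" "\<forall>B\<in>set Bs. block_shape B"
      have "geo (blocks_word Bs)" using geo[of n] Bs(1) by simp
      then obtain S where S: "reduced (pairs S)" "S \<noteq> []" "blocks_word Bs \<approx> flat (pairs S)"
        by (rule geo_blocks[OF _ Bs(2,3)]) blast
      have "conjugate w (flat (pairs S))"
        using conjugate_trans[OF w_v[of n, unfolded Bs(1)] eqv_imp_conjugate[OF S(3)]] .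
      then show ?thesis using not_conj_slim[OF S(1,2) slim_central[OF wd(2) dvd]] by blast
    qed
  qed
qed

lemma geo_iff: "geo v \<longleftrightarrow> v \<in> geo_lang"
proof
  assume "v \<in> geo_lang"
  then obtain x y where xy: "v = x @ y"
    "y @ x \<in> lang_pw Ga (\<lambda>_. True) \<union> (\<Union>l\<in>{- a..a}. lang_Y l (opt b l) \<union> lang_B l)"
    by (auto simp: geo_lang_def lang_rot_def)
  have "geo (y @ x)"
    using xy(2) by (auto simp: lang_pw_def intro: geo_pw_Ga geo_lang_Y geo_lang_B)
  from geo_conjugate[OF this conjugate_append_commute] show "geo v" using xy(1) by simp
qed (rule geo_in_lang)

section \<open>Regularity of the language\<close>

text \<open>From \<open>M\<close> on the differences in \<open>opt_iff\<close> are constant, and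
  divisibility by \<open>M\<close> has period \<open>M\<close>. For \<open>M = 0\<close> all nonzero
  exponents behave alike.\<close>

lemma ult_periodic_opt:
  assumes M: "0 \<le> M" and s: "s = 1 \<or> s = - 1"
  shows "ult_periodic {n. opt M l (s * int n)}" "ult_periodic {n. ess M l (s * int n)}"
proof -
  have *: "ult_periodic {n. opt M l (s * int n)} \<and> ult_periodic {n. ess M l (s * int n)}"
  proof (cases "M = 0")
    case True
    have "opt M l (s * int (n + 1)) = opt M l (s * int n) \<and> ess M l (s * int (n + 1)) = ess M l (s * int n)"
      if "1 \<le> n" for n
      using True s that by (auto simp: ess_def)
    then show ?thesis unfolding ult_periodic_def mem_Collect_eq by (metis zero_less_one)
  next
    case False
    then have M0: "0 < M" using M by simp
    have "opt M l (s * int (n + nat M)) = opt M l (s * int n) \<and>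
      ess M l (s * int (n + nat M)) = ess M l (s * int n)" if "nat M \<le> n" for n
    proof -
      have nM: "int (n + nat M) = int n + M" "M \<le> int n" using that M0 by auto
      have "opt M l (s * (int n + M)) = opt M l (s * int n)"
        using s
      proof
        assume 1: "s = 1"
        show ?thesis unfolding opt_iff[OF M0] 1 using nM(2) M0 by simp
      next
        assume 1: "s = - 1"
        show ?thesis unfolding opt_iff[OF M0] 1 using nM(2) M0 by simp
      qed
      moreover have "M dvd s * (int n + M) \<longleftrightarrow> M dvd s * int n"
        by (simp add: distrib_left)
      ultimately show ?thesis by (simp only: nM(1) ess_def)
    qed
    moreover have "0 < nat M" using M0 by simp
    ultimately show ?thesis unfolding ult_periodic_def mem_Collect_eq by blast
  qed
  show "ult_periodic {n. opt M l (s * int n)}" "ult_periodic {n. ess M l (s * int n)}"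
    using * by simp_all
qed

lemma regular_lang_Y:
  assumes "\<And>d. ult_periodic {n. P (letter_sign (Gb, d) * int n)}"
  shows "regular_language UNIV (lang_Y l P)"
proof -
  have "regular_language UNIV (lang_U l d)" for d
    using regular_Un(1)[OF regular_singleton[of "[(Gb, d)]"], of "if \<bar>l\<bar> = a then {pw Ga l} else {}"]
    by (simp add: lang_U_def regular_singleton regular_empty)
  then have "regular_language UNIV (lang_star (lang_U l d) \<inter> {w. count_list w (Gb, d) \<in> {n. P (letter_sign (Gb, d) * int n)}})" for d
    using regular_Un(2)[OF regular_star regular_count[OF assms]] by blast
  moreover have "lang_Y l P =
      (\<Union>d\<in>UNIV. lang_star (lang_U l d) \<inter> {w. count_list w (Gb, d) \<in> {n. P (letter_sign (Gb, d) * int n)}})"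
    by (auto simp: lang_Y_def)
  ultimately show ?thesis by (simp only:) (rule regular_UN, rule finite, simp only:)
qed

lemma regular_lang_pw:
  assumes "\<And>d. ult_periodic {n. P (letter_sign (s, d) * int n)}"
  shows "regular_language UNIV (lang_pw s P)"
proof -
  have "regular_language UNIV (lang_star {[(s, d)]} \<inter> {w. count_list w (s, d) \<in> {n. P (letter_sign (s, d) * int n)}})" for d
    using regular_Un(2)[OF regular_star[OF regular_singleton] regular_count[OF assms]] by blast
  moreover have "lang_pw s P =
      (\<Union>d\<in>UNIV. lang_star {[(s, d)]} \<inter> {w. count_list w (s, d) \<in> {n. P (letter_sign (s, d) * int n)}})"
  proof (intro equalityI subsetI)
    fix w assume "w \<in> lang_pw s P"
    then obtain e where e: "w = pw s e" "P e" by (auto simp: lang_pw_def)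
    obtain d where d: "letter_sign (s, d) * e = \<bar>e\<bar>" using ex_sign[of s e] by blast
    have "e = letter_sign (s, d) * int (nat \<bar>e\<bar>)" using d by (auto simp: letter_sign_def split: if_splits)
    then have w: "w = replicate (nat \<bar>e\<bar>) (s, d)" using e(1) pw_letter_sign[of s d "nat \<bar>e\<bar>"] by simp
    moreover have "count_list (replicate n x) x = n" for n and x :: "gen \<times> bool"
      by (induction n) simp_all
    ultimately have "count_list w (s, d) = nat \<bar>e\<bar>" by simp
    then have "w \<in> lang_star {[(s, d)]} \<inter> {w. count_list w (s, d) \<in> {n. P (letter_sign (s, d) * int n)}}"
      using w e(2) \<open>e = _\<close> by (simp add: lang_star_letter)
    then show "w \<in> (\<Union>d\<in>UNIV. lang_star {[(s, d)]} \<inter> {w. count_list w (s, d) \<in> {n. P (letter_sign (s, d) * int n)}})"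
      by blast
  next
    fix w assume "w \<in> (\<Union>d\<in>UNIV. lang_star {[(s, d)]} \<inter> {w. count_list w (s, d) \<in> {n. P (letter_sign (s, d) * int n)}})"
    then obtain d where d: "w \<in> lang_star {[(s, d)]}" "P (letter_sign (s, d) * int (count_list w (s, d)))"
      by blast
    have "w = pw s (letter_sign (s, d) * int (count_list w (s, d)))"
      unfolding pw_letter_sign by (rule lang_star_letter[THEN iffD1, OF d(1)])
    then show "w \<in> lang_pw s P" using d(2) unfolding lang_pw_def by blast
  qed
  ultimately show ?thesis by (simp only:) (rule regular_UN, rule finite, simp only:)
qed

lemma regular_geo_lang: "regular_language UNIV geo_lang"
proof -
  have s: "letter_sign c = 1 \<or> letter_sign c = - 1" for c :: "gen \<times> bool" by (simp add: letter_sign_def)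
  have pos: "0 \<le> a" "0 \<le> b" using a b by auto
  have 1: "regular_language UNIV (lang_pw Ga (\<lambda>_. True))"
    by (rule regular_lang_pw) (auto simp: ult_periodic_def)
  have 2: "regular_language UNIV (lang_Y l (opt b l))" for l
    by (rule regular_lang_Y) (rule ult_periodic_opt(1)[OF pos(2) s])
  have "regular_language UNIV (lang_Y l (ess b l))" for l
    by (rule regular_lang_Y) (rule ult_periodic_opt(2)[OF pos(2) s])
  moreover have "regular_language UNIV (lang_pw Ga (ess a l))" for l
    by (rule regular_lang_pw) (rule ult_periodic_opt(2)[OF pos(1) s])
  ultimately have 3: "regular_language UNIV (lang_B l)" for l
    unfolding lang_B_def by (intro regular_star regular_conc)
  show ?thesis unfolding geo_lang_def
    by (intro regular_rot regular_Un(1) regular_UN 1 2 3) simp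
qed

end

section \<open>Change of generators\<close>

definition word_hom :: "('s \<Rightarrow> 't gword) \<Rightarrow> 's gword \<Rightarrow> 't gword" where
  "word_hom f w = concat (map (\<lambda>c. if snd c then f (fst c) else inv_word (f (fst c))) w)"

lemma word_hom_simps [simp]:
  "word_hom f [] = []" "word_hom f (c # w) = (if snd c then f (fst c) else inv_word (f (fst c))) @ word_hom f w"
  "word_hom f (u @ v) = word_hom f u @ word_hom f v"
  by (simp_all add: word_hom_def)

lemma inv_word_Cons: "inv_word (c # w) = inv_word w @ [(fst c, \<not> snd c)]"
  by (simp add: inv_word_def case_prod_beta)

lemma inv_word_Nil [simp]: "inv_word [] = []"
  by (simp add: inv_word_def)

lemma word_hom_inv_word [simp]: "word_hom f (inv_word w) = inv_word (word_hom f w)"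
  by (induction w) (simp_all add: inv_word_Cons inv_word_append)

lemma word_hom_pres_eq:
  assumes "pres_eq R u v" and rel: "\<And>u v. (u, v) \<in> R \<Longrightarrow> pres_eq R' (word_hom f u) (word_hom f v)"
  shows "pres_eq R' (word_hom f u) (word_hom f v)"
  using assms(1)
proof (induction rule: pres_eq.induct)
  case (cancel s e)
  then show ?case
    using pres_eq_inv_word[of R' "f s"] pres_eq_inv_word_right[of R' "f s"] by simp
qed (simp_all add: pres_eq.refl pres_eq.sym pres_eq.append rel, rule pres_eq.trans)

lemma word_hom_hm_pres_eq:
  assumes "\<And>s. pres_eq R (word_hom f (g s)) [(s, True)]"
  shows "pres_eq R (word_hom f (word_hom g w)) w"
proof (induction w)
  case Nil
  show ?case by (simp add: pres_eq.refl)
next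
  case (Cons c w)
  have "pres_eq R (word_hom f (word_hom g [c])) [c]"
  proof (cases "snd c")
    case True
    then have "c = (fst c, True)" by (simp add: prod_eq_iff)
    then show ?thesis using assms[of "fst c"] True by simp
  next
    case False
    then have "inv_word [(fst c, True)] = [c]" by (simp add: inv_word_def prod_eq_iff)
    then show ?thesis using pres_eq_inv_word_cong[OF assms[of "fst c"]] False by simp
  qed
  from pres_eq.append[OF this Cons] show ?case by simp
qed

abbreviation wpow :: "nat \<Rightarrow> 'a list \<Rightarrow> 'a list" where
  "wpow n w \<equiv> concat (replicate n w)"

lemma word_hom_alt_word: "word_hom f (alt_word n u v) = alt_word n (word_hom f u) (word_hom f v)"
  by (induction n arbitrary: u v) simp_all

lemma word_hom_wpow: "word_hom f (wpow n w) = wpow n (word_hom f w)"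
  by (induction n) simp_all

lemma wpow_swap: "u @ wpow n (v @ u) = wpow n (u @ v) @ u"
  by (induction n) simp_all

lemma wpow_add: "wpow n w @ wpow k w = wpow (n + k) w"
  by (induction n) simp_all

lemma alt_word_even: "alt_word (2 * k) u v = wpow k (u @ v)"
  by (induction k) simp_all

lemma alt_word_Suc_even: "alt_word (Suc (2 * k)) u v = wpow k (u @ v) @ u"
  by (simp add: alt_word_even wpow_swap)

lemma wpow_pres_eq: "pres_eq R u v \<Longrightarrow> pres_eq R (wpow n u) (wpow n v)"
  by (induction n) (simp_all add: pres_eq.refl pres_eq.append)

lemma pw_int: "pw s (int n) = wpow n [(s, True)]"
  by (induction n) (simp_all add: pw_nonneg nat_add_distrib)

lemma inv_word_pw: "inv_word (pw s e) = pw s (- e)"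
  by (cases "e = 0"; simp add: pw_def inv_word_def; linarith)

section \<open>Transfer along an isomorphism of presentations\<close>

context two_gen
begin

text \<open>\<open>\<sigma>\<close> and \<open>\<tau>\<close> induce mutually inverse isomorphisms
  of the presented groups, so \<open>geo\<close> for formal words in x and y describes
  \<open>ConjGeo\<close> for words in the group elements.\<close>

lemma regular_ConjGeo_transfer:
  fixes A :: "(gen gword \<times> gen gword) set" and \<sigma> \<tau> :: "gen \<Rightarrow> gen gword"
  assumes \<sigma>: "\<And>u v. (u, v) \<in> rels \<Longrightarrow> pres_eq A (word_hom \<sigma> u) (word_hom \<sigma> v)"
    and \<tau>: "\<And>u v. (u, v) \<in> A \<Longrightarrow> word_hom \<tau> u \<approx> word_hom \<tau> v"
    and \<sigma>\<tau>: "\<And>s. pres_eq A (word_hom \<sigma> (\<tau> s)) [(s, True)]" and \<tau>\<sigma>: "\<And>s. word_hom \<tau> (\<sigma> s) \<approx> [(s, True)]"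
    and X: "X = {pres_class A (\<sigma> Ga), inv\<^bsub>pres_group A\<^esub> (pres_class A (\<sigma> Ga)),
                 pres_class A (\<sigma> Gb), inv\<^bsub>pres_group A\<^esub> (pres_class A (\<sigma> Gb))}"
  shows "regular_language X (ConjGeo (pres_group A) X)"
proof -
  let ?G = "pres_group A" and ?c = "\<lambda>w. pres_class A (word_hom \<sigma> w)"
  define el where "el c = ?c [c]" for c
  have X_el: "X = range el"
  proof -
    have "range el = {el (Ga, True), el (Ga, False), el (Gb, True), el (Gb, False)}"
    proof (intro equalityI subsetI)
      fix g assume "g \<in> range el"
      then obtain s d where "g = el (s, d)" by auto
      then show "g \<in> {el (Ga, True), el (Ga, False), el (Gb, True), el (Gb, False)}"
        by (cases s; cases d) simp_all
    qed auto
    then show ?thesis by (simp add: X el_def inv_pres_class)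
  qed
  have eqv_\<sigma>: "pres_eq A (word_hom \<sigma> u) (word_hom \<sigma> v) \<longleftrightarrow> u \<approx> v" for u v
  proof
    assume "pres_eq A (word_hom \<sigma> u) (word_hom \<sigma> v)"
    then have "word_hom \<tau> (word_hom \<sigma> u) \<approx> word_hom \<tau> (word_hom \<sigma> v)" by (rule word_hom_pres_eq) (rule \<tau>)
    then show "u \<approx> v"
      using word_hom_hm_pres_eq[OF \<tau>\<sigma>, of u] word_hom_hm_pres_eq[OF \<tau>\<sigma>, of v]
      by (blast intro: pres_eq.trans pres_eq.sym)
  qed (rule word_hom_pres_eq, assumption, rule \<sigma>)
  have proj: "word_proj ?G (map el w) = ?c w" for w
    by (induction w) (simp_all add: word_proj_def pres_group_one el_def)
  have dec: "\<exists>v. w = map el v" if "w \<in> lists X" for w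
    using that
  proof (induction w)
    case (Cons g w)
    then obtain v c where "w = map el v" "g = el c" by (auto simp: X_el)
    then have "g # w = map el (c # v)" by simp
    then show ?case by (rule exI)
  qed simp
  have enc: "map el v \<in> lists X" for v by (induction v) (simp_all add: X_el)
  \<comment> \<open>A conjugating element is given in the generators a and b; \<open>\<tau>\<close>
    rewrites it in x and y.\<close>
  have conj: "h \<in> conj_class ?G (?c v) \<longleftrightarrow> (\<exists>v'. h = ?c v' \<and> conjugate v v')" for h v
  proof
    assume "h \<in> conj_class ?G (?c v)"
    then obtain g where g: "g \<in> carrier ?G" "h = g \<otimes>\<^bsub>?G\<^esub> ?c v \<otimes>\<^bsub>?G\<^esub> inv\<^bsub>?G\<^esub> g"
      unfolding conj_class_def by blast
    then obtain u where u: "g = pres_class A u" by (auto simp: pres_group_def)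
    have h: "h = pres_class A (u @ word_hom \<sigma> v @ inv_word u)" using g(2) by (simp add: u inv_pres_class)
    let ?u = "word_hom \<tau> u"
    let ?v' = "?u @ v @ inv_word ?u"
    have "pres_eq A (word_hom \<sigma> ?v') (u @ word_hom \<sigma> v @ inv_word u)"
      using word_hom_hm_pres_eq[OF \<sigma>\<tau>, of u]
      by (simp add: pres_eq.append pres_eq_left pres_eq_inv_word_cong)
    then have "h = ?c ?v'" by (simp only: h pres_class_eq_iff pres_eq.sym)
    moreover have "conjugate v ?v'"
    proof (rule conjugate_trans)
      have "v \<approx> (v @ inv_word ?u) @ ?u"
        using pres_eq.sym[OF pres_eq_left[OF pres_eq_inv_word[of rels ?u], of v]] by simp
      then show "conjugate v ((v @ inv_word ?u) @ ?u)" by (rule eqv_imp_conjugate)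
      show "conjugate ((v @ inv_word ?u) @ ?u) ?v'" by (rule conjugate_append_commute)
    qed
    ultimately show "\<exists>v'. h = ?c v' \<and> conjugate v v'" by blast
  next
    assume "\<exists>v'. h = ?c v' \<and> conjugate v v'"
    then obtain v' w where h: "h = ?c v'" and w: "v @ w \<approx> w @ v'" by (auto simp: conjugate_def)
    let ?w = "word_hom \<sigma> w"
    have "pres_eq A (word_hom \<sigma> (v @ w)) (word_hom \<sigma> (w @ v'))" using w by (rule word_hom_pres_eq) (rule \<sigma>)
    then have "pres_eq A (?w @ word_hom \<sigma> v') (word_hom \<sigma> v @ ?w)" using pres_eq.sym by simp
    then have "pres_eq A (inv_word ?w @ ?w @ word_hom \<sigma> v') (inv_word ?w @ word_hom \<sigma> v @ ?w)"
      by (rule pres_eq_left)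
    moreover have "pres_eq A (word_hom \<sigma> v') (inv_word ?w @ ?w @ word_hom \<sigma> v')"
      using pres_eq.sym[OF pres_eq_right[OF pres_eq_inv_word[of A ?w], of "word_hom \<sigma> v'"]] by simp
    ultimately have "pres_eq A (word_hom \<sigma> v') (inv_word ?w @ word_hom \<sigma> v @ ?w)" by (blast intro: pres_eq.trans)
    then have "h = pres_class A (inv_word ?w) \<otimes>\<^bsub>?G\<^esub> ?c v \<otimes>\<^bsub>?G\<^esub> inv\<^bsub>?G\<^esub> (pres_class A (inv_word ?w))"
      by (simp add: h inv_pres_class pres_class_eq_iff)
    then show "h \<in> conj_class ?G (?c v)" unfolding conj_class_def
      by (intro CollectI exI[of _ "pres_class A (inv_word ?w)"]) simp
  qed
  have geo: "length v = conj_length ?G X (?c v) \<longleftrightarrow> geo v" for v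
  proof -
    let ?N = "conj_length ?G X (?c v)"
    have conjugate_refl: "conjugate v v" by (rule eqv_imp_conjugate[OF pres_eq.refl])
    have le: "?N \<le> length v'" if "conjugate v v'" for v'
    proof -
      have "?c v' \<in> conj_class ?G (?c v)" using conj that by blast
      then have "?N \<le> word_length ?G X (?c v')" unfolding conj_length_def by (intro Least_le) blast
      also have "\<dots> \<le> length v'" unfolding word_length_def
        by (rule Least_le) (use enc proj in \<open>auto intro!: bexI[of _ "map el v'"]\<close>)
      finally show ?thesis .
    qed
    have "\<exists>h\<in>conj_class ?G (?c v). word_length ?G X h = ?N"
      unfolding conj_length_def by (rule LeastI_ex) (use conj conjugate_refl in blast)
    then obtain v1 where v1: "conjugate v v1" "word_length ?G X (?c v1) = ?N" using conj by auto
    have "\<exists>w\<in>lists X. word_proj ?G w = ?c v1 \<and> length w = ?N"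
      unfolding v1(2)[symmetric] word_length_def
      by (rule LeastI_ex) (use enc proj in \<open>auto intro!: exI[of _ "length v1"] bexI[of _ "map el v1"]\<close>)
    then obtain v2 where v2: "?c v2 = ?c v1" "length v2 = ?N" using dec proj by force
    have "v1 \<approx> v2" using v2(1) eqv_\<sigma> pres_eq.sym unfolding pres_class_eq_iff by blast
    then have "conjugate v v2" using conjugate_trans[OF v1(1) eqv_imp_conjugate] by blast
    then show ?thesis using le le[OF conjugate_refl] v2(2) unfolding geo_def by (metis le_antisym)
  qed
  \<comment> \<open>Any letter with the right value will do: by \<open>geo\<close>, being geodesic
    depends only on the length and the value of a word.\<close>
  define lt where "lt g = (SOME c. el c = g)" for g
  have el_lt: "el (lt g) = g" if "g \<in> X" for g
  proof -
    obtain c where "el c = g" using \<open>g \<in> X\<close> X_el by blast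
    then show ?thesis unfolding lt_def by (rule someI)
  qed
  have "w \<in> ConjGeo ?G X \<longleftrightarrow> map lt w \<in> geo_lang" if "w \<in> lists X" for w
  proof -
    have "map el (map lt w) = w" using that el_lt by (induction w) auto
    then have "word_proj ?G w = ?c (map lt w)" using proj[of "map lt w"] by simp
    then show ?thesis using geo[of "map lt w"] geo_iff[of "map lt w"] that by (simp add: ConjGeo_def)
  qed
  then have "ConjGeo ?G X = {w \<in> lists X. map lt w \<in> geo_lang}"
    unfolding ConjGeo_def by blast
  moreover have "finite X" by (simp add: X)
  ultimately show ?thesis using regular_map_preimage[OF regular_geo_lang] by simp
qed

end

section \<open>The two families of dihedral Artin groups\<close>

lemma regular_ConjGeo_odd:
  assumes m: "m = Suc (2 * k)" and k: "1 \<le> k"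
  shows "regular_language (free_product_gens m) (ConjGeo (dihedral_artin m) (free_product_gens m))"
proof -
  interpret two_gen 2 "int m" by standard (use m k in auto)
  let ?A = "artin_rels m"
  define \<sigma> :: "gen \<Rightarrow> gen gword" where
    "\<sigma> s = (case s of Ga \<Rightarrow> alt_word m word_a word_b | Gb \<Rightarrow> word_a @ word_b)" for s
  \<comment> \<open>Solving x = (ab)^k a and y = ab gives a = y^(-k) x and b = a^(-1) y.\<close>
  define \<tau> :: "gen \<Rightarrow> gen gword" where
    "\<tau> s = (case s of Ga \<Rightarrow> pw Gb (- int k) @ pw Ga 1 | Gb \<Rightarrow> pw Ga (- 1) @ pw Gb (int k + 1))" for s
  let ?ab = "word_a @ word_b"
  have alt_m: "alt_word m u v = wpow k (u @ v) @ u" for u v :: "gen gword"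
    by (simp only: m alt_word_Suc_even)
  have X: "\<sigma> Ga = wpow k ?ab @ word_a" by (simp only: \<sigma>_def gen.case alt_m)
  have Y: "\<sigma> Gb = ?ab" by (simp add: \<sigma>_def)
  \<comment> \<open>One factor x is replaced by the other side of the Artin relation, so that the
    product becomes a single alternating word of length 2 m.\<close>
  have XX: "pres_eq ?A (\<sigma> Ga @ \<sigma> Ga) (wpow m ?ab)"
  proof -
    have "pres_eq ?A (alt_word m word_a word_b) (alt_word m word_b word_a)"
      by (rule pres_eq.rel) (simp add: artin_rels_def)
    then have "pres_eq ?A (\<sigma> Ga @ \<sigma> Ga) (\<sigma> Ga @ alt_word m word_b word_a)"
      by (intro pres_eq_left) (simp add: \<sigma>_def)
    moreover have "\<sigma> Ga @ alt_word m word_b word_a = wpow m ?ab"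
    proof -
      have "\<sigma> Ga @ alt_word m word_b word_a = wpow k ?ab @ (word_a @ wpow k (word_b @ word_a)) @ word_b"
        unfolding X m by (simp only: alt_word_Suc_even append_assoc)
      also have "\<dots> = wpow k ?ab @ wpow k ?ab @ ?ab" by (simp only: wpow_swap append_assoc)
      also have "\<dots> = wpow m ?ab"
        using wpow_add[of k ?ab "Suc k"] concat_replicate_commute[of k ?ab] m by (simp add: mult_2)
      finally show ?thesis .
    qed
    ultimately show ?thesis by simp
  qed
  have word_hom_pw: "word_hom \<sigma> (pw s (int n)) = wpow n (\<sigma> s)" for s n
    by (simp only: pw_int word_hom_wpow) simp
  have word_hom_Ga2: "word_hom \<sigma> (pw Ga 2) = \<sigma> Ga @ \<sigma> Ga" using word_hom_pw[of Ga 2] by (simp add: numeral_2_eq_2)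
  have word_hom_Gb1: "word_hom \<sigma> (pw Gb 1) = ?ab" using word_hom_pw[of Gb 1] Y by simp
  have \<sigma>_rel: "pres_eq ?A (word_hom \<sigma> u) (word_hom \<sigma> v)" if "(u, v) \<in> rels" for u v
  proof -
    have "pres_eq ?A ((\<sigma> Ga @ \<sigma> Ga) @ ?ab) (?ab @ \<sigma> Ga @ \<sigma> Ga)"
    proof -
      have "pres_eq ?A ((\<sigma> Ga @ \<sigma> Ga) @ ?ab) (wpow m ?ab @ ?ab)" by (rule pres_eq_right[OF XX])
      also have "wpow m ?ab @ ?ab = ?ab @ wpow m ?ab" by (rule concat_replicate_commute)
      also have "pres_eq ?A (?ab @ wpow m ?ab) (?ab @ \<sigma> Ga @ \<sigma> Ga)"
        by (rule pres_eq_left[OF pres_eq.sym[OF XX]])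
      finally show ?thesis .
    qed
    then have 1: "pres_eq ?A (word_hom \<sigma> (pw Ga 2 @ pw Gb 1)) (word_hom \<sigma> (pw Gb 1 @ pw Ga 2))"
      by (simp only: word_hom_simps(3) word_hom_Ga2 word_hom_Gb1)
    have 2: "pres_eq ?A (word_hom \<sigma> (pw Gb (int m))) (word_hom \<sigma> (pw Ga 2))"
      using pres_eq.sym[OF XX] by (simp only: word_hom_pw word_hom_Ga2 Y)
    have "u = pw Ga 2 @ pw Gb 1 \<and> v = pw Gb 1 @ pw Ga 2 \<or> u = pw Gb (int m) \<and> v = pw Ga 2"
      using that by (simp add: rels_def split: if_splits)
    then show ?thesis using 1 2 by blast
  qed
  have pq: "pres_eq rels (\<tau> Ga @ \<tau> Gb) (pw Gb 1)"
  proof -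
    have "pres_eq rels (\<tau> Ga @ \<tau> Gb) (pw Gb (- int k) @ [] @ pw Gb (int k + 1))"
      using pres_eq_mid[OF pw_add[of rels Ga 1 "- 1"], of "pw Gb (- int k)" "pw Gb (int k + 1)"]
      by (simp add: \<tau>_def)
    also have "pres_eq rels \<dots> (pw Gb 1)" using pw_add[of rels Gb "- int k" "int k + 1"] by simp
    finally show ?thesis .
  qed
  have pq_pow: "pres_eq rels (wpow n (\<tau> Ga @ \<tau> Gb)) (pw Gb (int n))" for n
    using wpow_pres_eq[OF pq, of n] pw_int[of Gb n] pw_int[of Gb 1] by simp
  have alt_pq: "pres_eq rels (alt_word m (\<tau> Ga) (\<tau> Gb)) (pw Ga 1)"
  proof -
    have "pres_eq rels (alt_word m (\<tau> Ga) (\<tau> Gb)) (pw Gb (int k) @ \<tau> Ga)"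
      unfolding alt_m by (rule pres_eq_right[OF pq_pow])
    also have "pres_eq rels \<dots> (pw Ga 1)"
      using pres_eq_right[OF pw_add[of rels Gb "int k" "- int k"], of "pw Ga 1"] by (simp add: \<tau>_def)
    finally show ?thesis .
  qed
  \<comment> \<open>Prepending the image of a gives (ab)^(k+1), that is, y^(k+1) = y^(-k) y^m =
    y^(-k) x^2, and y^(-k) x is the image of a.\<close>
  have alt_qp: "pres_eq rels (alt_word m (\<tau> Gb) (\<tau> Ga)) (pw Ga 1)"
  proof (rule pres_eq_cancel_left)
    have "\<tau> Ga @ alt_word m (\<tau> Gb) (\<tau> Ga) = alt_word (2 * Suc k) (\<tau> Ga) (\<tau> Gb)"
      by (simp only: m alt_word.simps mult_Suc_right add_2_eq_Suc)
    also have "pres_eq rels \<dots> (pw Gb (int (Suc k)))" unfolding alt_word_even by (rule pq_pow)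
    also have "pres_eq rels \<dots> (pw Gb (- int k) @ pw Gb (int m))"
      using pres_eq.sym[OF pw_add[of rels Gb "- int k" "int m"]] m by (simp add: add.commute)
    also have "pres_eq rels \<dots> (pw Gb (- int k) @ pw Ga 2)"
    proof (rule pres_eq_left[OF pres_eq.rel])
      have "m \<noteq> 0" using m by simp
      then show "(pw Gb (int m), pw Ga 2) \<in> rels" by (simp add: rels_def)
    qed
    also have "pres_eq rels \<dots> (\<tau> Ga @ pw Ga 1)"
      using pres_eq_left[OF pres_eq.sym[OF pw_add[of rels Ga 1 1]], of "pw Gb (- int k)"]
      by (simp add: \<tau>_def)
    finally show "pres_eq rels (\<tau> Ga @ alt_word m (\<tau> Gb) (\<tau> Ga)) (\<tau> Ga @ pw Ga 1)" .
  qed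
  have \<tau>_rel: "pres_eq rels (word_hom \<tau> u) (word_hom \<tau> v)" if "(u, v) \<in> ?A" for u v
  proof -
    have "word_hom \<tau> u = alt_word m (\<tau> Ga) (\<tau> Gb)" "word_hom \<tau> v = alt_word m (\<tau> Gb) (\<tau> Ga)"
      using that by (simp_all add: artin_rels_def word_hom_alt_word)
    then show ?thesis using pres_eq.trans[OF alt_pq pres_eq.sym[OF alt_qp]] by simp
  qed
  have \<sigma>\<tau>: "pres_eq ?A (word_hom \<sigma> (\<tau> s)) [(s, True)]" for s
  proof (cases s)
    case Ga
    have "word_hom \<sigma> (\<tau> Ga) = inv_word (wpow k ?ab) @ wpow k ?ab @ word_a"
      using word_hom_pw[of Gb k] Y X word_hom_pw[of Ga 1]
      by (simp add: \<tau>_def inv_word_pw[symmetric] del: word_hom_simps(2))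
    then show ?thesis using pres_eq_right[OF pres_eq_inv_word[of ?A "wpow k ?ab"], of word_a] Ga by simp
  next
    case Gb
    have "wpow (Suc k) ?ab = \<sigma> Ga @ word_b"
      using concat_replicate_commute[of k ?ab] X by simp
    then have "word_hom \<sigma> (\<tau> Gb) = inv_word (\<sigma> Ga) @ \<sigma> Ga @ word_b"
      using word_hom_pw[of Gb "Suc k"] Y word_hom_pw[of Ga 1]
      by (simp add: \<tau>_def inv_word_pw[symmetric] add.commute del: word_hom_simps(2))
    then show ?thesis using pres_eq_right[OF pres_eq_inv_word[of ?A "\<sigma> Ga"], of word_b] Gb by simp
  qed
  have \<tau>\<sigma>: "pres_eq rels (word_hom \<tau> (\<sigma> s)) ([(s, True)])" for s
    using alt_pq pq by (cases s) (simp_all add: \<sigma>_def word_hom_alt_word pw_def)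
  show ?thesis
    unfolding dihedral_artin_def
    by (rule regular_ConjGeo_transfer[OF \<sigma>_rel \<tau>_rel \<sigma>\<tau> \<tau>\<sigma>])
      (simp_all add: free_product_gens_def gen_x_def gen_y_def dihedral_artin_def \<sigma>_def m)
qed

lemma regular_ConjGeo_even:
  assumes m: "m = 2 * p" and p: "2 \<le> p"
  shows "regular_language (free_product_gens m) (ConjGeo (dihedral_artin m) (free_product_gens m))"
proof -
  interpret two_gen "int p" 0 by standard (use p in auto)
  let ?A = "artin_rels m"
  define \<sigma> :: "gen \<Rightarrow> gen gword" where
    "\<sigma> s = (case s of Ga \<Rightarrow> word_a @ word_b | Gb \<Rightarrow> word_a)" for s
  define \<tau> :: "gen \<Rightarrow> gen gword" where
    "\<tau> s = (case s of Ga \<Rightarrow> pw Gb 1 | Gb \<Rightarrow> pw Gb (- 1) @ pw Ga 1)" for s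
  let ?ab = "word_a @ word_b"
  have word_hom_pw: "word_hom \<sigma> (pw s (int n)) = wpow n (\<sigma> s)" for s n
    by (simp only: pw_int word_hom_wpow) simp
  \<comment> \<open>Multiplied by a on the left, (ba)^p = (ab)^p says that a commutes with
    (ab)^p.\<close>
  have \<sigma>_rel: "pres_eq ?A (word_hom \<sigma> u) (word_hom \<sigma> v)" if "(u, v) \<in> rels" for u v
  proof -
    have "pres_eq ?A (alt_word m word_b word_a) (alt_word m word_a word_b)"
      by (rule pres_eq.sym[OF pres_eq.rel]) (simp add: artin_rels_def)
    then have "pres_eq ?A (word_a @ wpow p (word_b @ word_a)) (word_a @ wpow p ?ab)"
      unfolding m alt_word_even by (rule pres_eq_left)
    then have 1: "pres_eq ?A (wpow p ?ab @ word_a) (word_a @ wpow p ?ab)"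
      by (simp only: wpow_swap)
    have "u = pw Ga (int p) @ pw Gb 1 \<and> v = pw Gb 1 @ pw Ga (int p)"
      using that by (simp add: rels_def)
    moreover have "word_hom \<sigma> (pw Gb 1) = word_a" "word_hom \<sigma> (pw Ga (int p)) = wpow p ?ab"
      using word_hom_pw[of Gb 1] word_hom_pw[of Ga p] by (simp_all add: \<sigma>_def)
    ultimately show ?thesis using 1 by (simp only: word_hom_simps(3))
  qed
  have pq: "pres_eq rels (\<tau> Ga @ \<tau> Gb) (pw Ga 1)"
    using pres_eq_right[OF pw_add[of rels Gb 1 "- 1"], of "pw Ga 1"] by (simp add: \<tau>_def)
  have pq_pow: "pres_eq rels (wpow n (\<tau> Ga @ \<tau> Gb)) (pw Ga (int n))" for n
    using wpow_pres_eq[OF pq, of n] pw_int[of Ga n] pw_int[of Ga 1] by simp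
  have alt_pq: "pres_eq rels (alt_word m (\<tau> Ga) (\<tau> Gb)) (pw Ga (int p))"
    unfolding m alt_word_even by (rule pq_pow)
  \<comment> \<open>Prepending the image of a gives (ab)^p a, and x^p is central.\<close>
  have alt_qp: "pres_eq rels (alt_word m (\<tau> Gb) (\<tau> Ga)) (pw Ga (int p))"
  proof (rule pres_eq_cancel_left)
    have "\<tau> Ga @ alt_word m (\<tau> Gb) (\<tau> Ga) = wpow p (\<tau> Ga @ \<tau> Gb) @ \<tau> Ga"
      by (simp only: m alt_word_Suc_even[symmetric] alt_word.simps)
    also have "pres_eq rels \<dots> (pw Ga (int p) @ \<tau> Ga)" by (rule pres_eq_right[OF pq_pow])
    also have "pres_eq rels \<dots> (\<tau> Ga @ pw Ga (int p))" by (rule central_1)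
    finally show "pres_eq rels (\<tau> Ga @ alt_word m (\<tau> Gb) (\<tau> Ga)) (\<tau> Ga @ pw Ga (int p))" .
  qed
  have \<tau>_rel: "pres_eq rels (word_hom \<tau> u) (word_hom \<tau> v)" if "(u, v) \<in> ?A" for u v
  proof -
    have "word_hom \<tau> u = alt_word m (\<tau> Ga) (\<tau> Gb)" "word_hom \<tau> v = alt_word m (\<tau> Gb) (\<tau> Ga)"
      using that by (simp_all add: artin_rels_def word_hom_alt_word)
    then show ?thesis using pres_eq.trans[OF alt_pq pres_eq.sym[OF alt_qp]] by simp
  qed
  have \<sigma>\<tau>: "pres_eq ?A (word_hom \<sigma> (\<tau> s)) [(s, True)]" for s
  proof (cases s)
    case Ga
    then show ?thesis by (simp add: \<tau>_def \<sigma>_def pw_def pres_eq.refl)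
  next
    case Gb
    then show ?thesis
      using pres_eq_right[OF pres_eq_inv_word[of ?A word_a], of word_b]
      by (simp add: \<tau>_def \<sigma>_def pw_def)
  qed
  have \<tau>\<sigma>: "pres_eq rels (word_hom \<tau> (\<sigma> s)) ([(s, True)])" for s
    using pq by (cases s) (simp_all add: \<sigma>_def \<tau>_def pw_def pres_eq.refl)
  show ?thesis
    unfolding dihedral_artin_def
    by (rule regular_ConjGeo_transfer[OF \<sigma>_rel \<tau>_rel \<sigma>\<tau> \<tau>\<sigma>])
      (simp_all add: free_product_gens_def gen_x_def gen_y_def dihedral_artin_def \<sigma>_def m)
qed

theorem theorem6p1:
  fixes m :: nat
  assumes "m \<ge> 3"
  shows "regular_language (free_product_gens m)
           (ConjGeo (dihedral_artin m) (free_product_gens m))"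
proof (cases "odd m")
  case True
  then obtain k where "m = Suc (2 * k)" by (auto elim: oddE)
  then show ?thesis using regular_ConjGeo_odd[of m k] assms by simp
next
  case False
  then obtain p where "m = 2 * p" by (auto elim: evenE)
  then show ?thesis using regular_ConjGeo_even[of m p] assms by simp
qed

end
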